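(* Let $\Lambda$ be a finite $k$-graph without sources, $r\in\mathbb R^k$ and $\beta\in\mathbb R$. There is an affine bijection between the gauge-invariant $\beta$-KMS states $\omega$ for $\alpha^r$ on $C^*(\Lambda)$ and the functions $f:\mathcal C_r(\beta)\to[0,1]$ with $\sum_{C\in\mathcal C_r(\beta)}f(C)=1$. The state $\omega$ corresponding to $f$ is determined by $$\omega(t_\lambda t_\gamma^* )=\delta_{\lambda,\gamma}\,e^{-\beta r\cdot d(\lambda)}\,\psi_{s(\lambda)}\qquad(\lambda,\gamma\in\Lambda),\qquad\text{where }\psi=\sum_{C\in\mathcal C_r(\beta)}f(C)\,x^C.$$
   Context: A $k$-graph $(\Lambda,d)$ is a countable small category with functor $d:\Lambda\to\mathbb N^k$ having the unique factorisation property (for $d(\lambda)=m+n$ there are unique $\mu,\nu$ with $d(\mu)=m,d(\nu)=n,\lambda=\mu\nu$). $\Lambda^0=d^{-1}(0)$ are the vertices, $\Lambda^n=d^{-1}(n)$, $r,s$ range and source, $v\Lambda^nw=\{\lambda\in\Lambda^n:r(\lambda)=v,s(\lambda)=w\}$, $v\Lambda w=\bigcup_nv\Lambda^nw$, $V\Lambda W=\bigcup_{v\in V,w\in W}v\Lambda w$. Finite: each $\Lambda^n$ finite; without sources: $v\Lambda^n\ne\emptyset$ for all $v,n$. Vertex matrices $A_i(v,w)=|v\Lambda^{e_i}w|$, $A^n=\prod_iA_i^{n_i}$. $C^*(\Lambda)$ is the universal $C^*$-algebra generated by partial isometries $\{t_\lambda\}$ with: $\{t_v\}_{v\in\Lambda^0}$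 mutually orthogonal projections; $t_\lambda t_\gamma=t_{\lambda\gamma}$ when $s(\lambda)=r(\gamma)$; $t_\lambda^*t_\lambda=t_{s(\lambda)}$; $t_v=\sum_{\lambda\in v\Lambda^n}t_\lambda t_\lambda^*$ for all $v,n$. Gauge action: $\gamma_z(t_\lambda)=\prod_iz_i^{d(\lambda)_i}t_\lambda$, $z\in\mathbb T^k$. $\alpha^r_t(t_\lambda)=e^{itr\cdot d(\lambda)}t_\lambda$; a $\beta$-KMS state for $\alpha^r$ is a state $\omega$ with $\omega(ab)=\omega(b\,\alpha^r_{i\beta}(a))$ for $a,b\in\mathrm{span}\{t_\lambda t_\gamma^*\}$, where $\alpha^r_{i\beta}(t_\lambda t_\gamma^* )=e^{-\beta r\cdot(d(\lambda)-d(\gamma))}t_\lambda t_\gamma^*$. Components: classes of $v\sim w$ iff $v\Lambda w\ne\emptyset\ne w\Lambda v$; a component is trivial if $C\Lambda C$ is a single vertex, non-trivial otherwise, positive if $\rho(A_i^C)>0$ for all $i$ ($B^S$ is the submatrix on $S\times S$, $\rho$ spectral radius). $\overline V=\{w:w\Lambda V\ne\emptyset\}$. For a finite sequence $F=(a_1,\dots,a_m)$ in $\mathbb N^k\setminus\{0\}$, $A_F=\sum_jA^{a_j}$; $F$ is well chosen if $A_F(v,w)>0$ iff $v\Lambda^lw\ne\emptyset$ for some $l\ne0$. A non-trivial component $C$ is $F$-harmonic if $\overline C\setminus C=\emptyset$ or $\rho(A_F^C)>\rho(A_F^{\overline C\setminus C})$. A positive harmonic component is a positive component that is $F$-harmonic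 for some (equivalently every) well chosen $F$; for it, $x^C$ is the unique vector in $[0,\infty)^{\Lambda^0}$ of unit $1$-norm with $A_Fx^C=\rho(A_F^C)x^C$ and $x^C_v=0$ for $v\notin\overline C$ (independent of the well chosen $F$). $\mathcal C_r(\beta)$ is the set of positive harmonic components $C$ with $\beta r=(\ln\rho(A_1^C),\dots,\ln\rho(A_k^C))$. *)

theory Defs
  imports "HOL-Analysis.Analysis" "HOL-Library.Function_Algebras"
begin

class cstar_algebra = real_normed_algebra_1 + banach +
  fixes cscale :: "complex \<Rightarrow> 'a \<Rightarrow> 'a"
    and adj :: "'a \<Rightarrow> 'a"
  assumes cscale_of_real: "cscale (complex_of_real x) a = scaleR x a"
    and cscale_add_left: "cscale (c + e) a = cscale c a + cscale e a"
    and cscale_add_right: "cscale c (a + b) = cscale c a + cscale c b"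
    and cscale_cscale: "cscale c (cscale e a) = cscale (c * e) a"
    and norm_cscale: "norm (cscale c a) = cmod c * norm a"
    and cscale_mult_left: "cscale c (a * b) = cscale c a * b"
    and cscale_mult_right: "cscale c (a * b) = a * cscale c b"
    and adj_adj: "adj (adj a) = a"
    and adj_add: "adj (a + b) = adj a + adj b"
    and adj_cscale: "adj (cscale c a) = cscale (cnj c) (adj a)"
    and adj_mult: "adj (a * b) = adj b * adj a"
    and cstar_identity: "norm (adj a * a) = (norm a)\<^sup>2"

definition cstar_span :: "'a::cstar_algebra set \<Rightarrow> 'a set" where
  "cstar_span S = {a. \<exists>(I::nat set) c x. finite I \<and> x ` I \<subseteq> S \<and> a = (\<Sum>i\<in>I. cscale (c i) (x i))}"

definition star_hom :: "('a::cstar_algebra \<Rightarrow> 'b::cstar_algebra) \<Rightarrow> bool" where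
  "star_hom h \<longleftrightarrow> (\<forall>a b. h (a + b) = h a + h b) \<and> (\<forall>c a. h (cscale c a) = cscale c (h a))
     \<and> (\<forall>a b. h (a * b) = h a * h b) \<and> (\<forall>a. h (adj a) = adj (h a))"

definition is_state :: "('a::cstar_algebra \<Rightarrow> complex) \<Rightarrow> bool" where
  "is_state w \<longleftrightarrow> (\<forall>a b. w (a + b) = w a + w b) \<and> (\<forall>c a. w (cscale c a) = c * w a)
     \<and> (\<forall>a. Im (w (adj a * a)) = 0 \<and> Re (w (adj a * a)) \<ge> 0) \<and> w 1 = 1"

text \<open>A k-graph: morphism set L (objects identified with identity morphisms), degree
  functor d into N^k (k = CARD('k)), range rg, source src, composition cmp (cmp l m = l m,
  defined when src l = rg m).\<close>
definition is_kgraph :: "'p set \<Rightarrow> ('p \<Rightarrow> 'k::finite \<Rightarrow> nat) \<Rightarrow> ('p \<Rightarrow> 'p) \<Rightarrow> ('p \<Rightarrow> 'p)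
    \<Rightarrow> ('p \<Rightarrow> 'p \<Rightarrow> 'p) \<Rightarrow> bool" where
  "is_kgraph L d rg src cmp \<longleftrightarrow>
     countable L
   \<and> (\<forall>l\<in>L. rg l \<in> L \<and> src l \<in> L \<and> rg (rg l) = rg l \<and> src (rg l) = rg l
              \<and> rg (src l) = src l \<and> src (src l) = src l)
   \<and> (\<forall>l\<in>L. \<forall>m\<in>L. src l = rg m \<longrightarrow>
        cmp l m \<in> L \<and> rg (cmp l m) = rg l \<and> src (cmp l m) = src m \<and> d (cmp l m) = d l + d m)
   \<and> (\<forall>l\<in>L. cmp (rg l) l = l \<and> cmp l (src l) = l)
   \<and> (\<forall>l\<in>L. \<forall>m\<in>L. \<forall>n\<in>L. src l = rg m \<longrightarrow> src m = rg n \<longrightarrow>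
        cmp (cmp l m) n = cmp l (cmp m n))
   \<and> (\<forall>l\<in>L. \<forall>m n. d l = m + n \<longrightarrow>
        (\<exists>!p. fst p \<in> L \<and> snd p \<in> L \<and> src (fst p) = rg (snd p) \<and> d (fst p) = m \<and> d (snd p) = n
              \<and> cmp (fst p) (snd p) = l))"

definition kg_finite :: "'p set \<Rightarrow> ('p \<Rightarrow> 'k \<Rightarrow> nat) \<Rightarrow> bool" where
  "kg_finite L d \<longleftrightarrow> (\<forall>n. finite {l\<in>L. d l = n})"

definition vert :: "'p set \<Rightarrow> ('p \<Rightarrow> 'k \<Rightarrow> nat) \<Rightarrow> 'p set" where
  "vert L d = {v\<in>L. d v = 0}"

definition no_sources :: "'p set \<Rightarrow> ('p \<Rightarrow> 'k \<Rightarrow> nat) \<Rightarrow> ('p \<Rightarrow> 'p) \<Rightarrow> bool" where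
  "no_sources L d rg \<longleftrightarrow> (\<forall>v\<in>vert L d. \<forall>n. \<exists>l\<in>L. rg l = v \<and> d l = n)"

definition paths :: "'p set \<Rightarrow> ('p \<Rightarrow> 'k \<Rightarrow> nat) \<Rightarrow> ('p \<Rightarrow> 'p) \<Rightarrow> ('p \<Rightarrow> 'p)
    \<Rightarrow> 'p \<Rightarrow> ('k \<Rightarrow> nat) \<Rightarrow> 'p \<Rightarrow> 'p set" where
  "paths L d rg src v n w = {l\<in>L. d l = n \<and> rg l = v \<and> src l = w}"

definition unitv :: "'k \<Rightarrow> 'k \<Rightarrow> nat" where
  "unitv i = (\<lambda>j. if j = i then 1 else 0)"

definition mmult :: "'p set \<Rightarrow> ('p \<Rightarrow> 'p \<Rightarrow> real) \<Rightarrow> ('p \<Rightarrow> 'p \<Rightarrow> real) \<Rightarrow> 'p \<Rightarrow> 'p \<Rightarrow> real" where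
  "mmult V A B = (\<lambda>v w. \<Sum>u\<in>V. A v u * B u w)"

definition mone :: "'p \<Rightarrow> 'p \<Rightarrow> real" where
  "mone = (\<lambda>v w. if v = w then 1 else 0)"

definition mpow :: "'p set \<Rightarrow> ('p \<Rightarrow> 'p \<Rightarrow> real) \<Rightarrow> nat \<Rightarrow> 'p \<Rightarrow> 'p \<Rightarrow> real" where
  "mpow V A n = (mmult V A ^^ n) mone"

definition vmat :: "'p set \<Rightarrow> ('p \<Rightarrow> 'k \<Rightarrow> nat) \<Rightarrow> ('p \<Rightarrow> 'p) \<Rightarrow> ('p \<Rightarrow> 'p)
    \<Rightarrow> 'k \<Rightarrow> 'p \<Rightarrow> 'p \<Rightarrow> real" where
  "vmat L d rg src i = (\<lambda>v w. real (card (paths L d rg src v (unitv i) w)))"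

definition coord_list :: "'k::finite list" where
  "coord_list = (SOME xs. distinct xs \<and> set xs = UNIV)"

definition vmat_pow :: "'p set \<Rightarrow> ('p \<Rightarrow> 'k::finite \<Rightarrow> nat) \<Rightarrow> ('p \<Rightarrow> 'p) \<Rightarrow> ('p \<Rightarrow> 'p)
    \<Rightarrow> ('k \<Rightarrow> nat) \<Rightarrow> 'p \<Rightarrow> 'p \<Rightarrow> real" where
  "vmat_pow L d rg src n = foldr (\<lambda>i M. mmult (vert L d) (mpow (vert L d) (vmat L d rg src i) (n i)) M)
      coord_list mone"

definition vmat_F :: "'p set \<Rightarrow> ('p \<Rightarrow> 'k::finite \<Rightarrow> nat) \<Rightarrow> ('p \<Rightarrow> 'p) \<Rightarrow> ('p \<Rightarrow> 'p)
    \<Rightarrow> ('k \<Rightarrow> nat) list \<Rightarrow> 'p \<Rightarrow> 'p \<Rightarrow> real" where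
  "vmat_F L d rg src F = (\<lambda>v w. sum_list (map (\<lambda>a. vmat_pow L d rg src a v w) F))"

definition spec_rad :: "'p set \<Rightarrow> ('p \<Rightarrow> 'p \<Rightarrow> real) \<Rightarrow> real" where
  "spec_rad S B = Sup {cmod mu | mu. \<exists>x::'p \<Rightarrow> complex. (\<exists>v\<in>S. x v \<noteq> 0) \<and>
      (\<forall>v\<in>S. (\<Sum>w\<in>S. complex_of_real (B v w) * x w) = mu * x v)}"

definition components :: "'p set \<Rightarrow> ('p \<Rightarrow> 'k \<Rightarrow> nat) \<Rightarrow> ('p \<Rightarrow> 'p) \<Rightarrow> ('p \<Rightarrow> 'p) \<Rightarrow> 'p set set" where
  "components L d rg src = {C. \<exists>v\<in>vert L d. C = {w\<in>vert L d.
      (\<exists>l\<in>L. rg l = v \<and> src l = w) \<and> (\<exists>l\<in>L. rg l = w \<and> src l = v)}}"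

definition trivial_comp :: "'p set \<Rightarrow> ('p \<Rightarrow> 'p) \<Rightarrow> ('p \<Rightarrow> 'p) \<Rightarrow> 'p set \<Rightarrow> bool" where
  "trivial_comp L rg src C \<longleftrightarrow> (\<exists>v. {l\<in>L. rg l \<in> C \<and> src l \<in> C} = {v})"

definition positive_comp :: "'p set \<Rightarrow> ('p \<Rightarrow> 'k \<Rightarrow> nat) \<Rightarrow> ('p \<Rightarrow> 'p) \<Rightarrow> ('p \<Rightarrow> 'p) \<Rightarrow> 'p set \<Rightarrow> bool" where
  "positive_comp L d rg src C \<longleftrightarrow> C \<in> components L d rg src \<and>
      (\<forall>i. spec_rad C (vmat L d rg src i) > 0)"

definition up_closure :: "'p set \<Rightarrow> ('p \<Rightarrow> 'k \<Rightarrow> nat) \<Rightarrow> ('p \<Rightarrow> 'p) \<Rightarrow> ('p \<Rightarrow> 'p) \<Rightarrow> 'p set \<Rightarrow> 'p set" where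
  "up_closure L d rg src W = {w\<in>vert L d. \<exists>l\<in>L. rg l = w \<and> src l \<in> W}"

definition well_chosen :: "'p set \<Rightarrow> ('p \<Rightarrow> 'k::finite \<Rightarrow> nat) \<Rightarrow> ('p \<Rightarrow> 'p) \<Rightarrow> ('p \<Rightarrow> 'p)
    \<Rightarrow> ('k \<Rightarrow> nat) list \<Rightarrow> bool" where
  "well_chosen L d rg src F \<longleftrightarrow> (\<forall>a\<in>set F. a \<noteq> 0) \<and>
     (\<forall>v\<in>vert L d. \<forall>w\<in>vert L d. vmat_F L d rg src F v w > 0 \<longleftrightarrow>
        (\<exists>n. n \<noteq> 0 \<and> paths L d rg src v n w \<noteq> {}))"

definition F_harmonic :: "'p set \<Rightarrow> ('p \<Rightarrow> 'k::finite \<Rightarrow> nat) \<Rightarrow> ('p \<Rightarrow> 'p) \<Rightarrow> ('p \<Rightarrow> 'p)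
    \<Rightarrow> ('k \<Rightarrow> nat) list \<Rightarrow> 'p set \<Rightarrow> bool" where
  "F_harmonic L d rg src F C \<longleftrightarrow> C \<in> components L d rg src \<and> \<not> trivial_comp L rg src C \<and>
     (up_closure L d rg src C - C = {} \<or>
      spec_rad C (vmat_F L d rg src F) > spec_rad (up_closure L d rg src C - C) (vmat_F L d rg src F))"

definition pos_harmonic :: "'p set \<Rightarrow> ('p \<Rightarrow> 'k::finite \<Rightarrow> nat) \<Rightarrow> ('p \<Rightarrow> 'p) \<Rightarrow> ('p \<Rightarrow> 'p)
    \<Rightarrow> 'p set \<Rightarrow> bool" where
  "pos_harmonic L d rg src C \<longleftrightarrow> positive_comp L d rg src C \<and>
     (\<exists>F. well_chosen L d rg src F \<and> F_harmonic L d rg src F C)"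

text \<open>The vector x^C (defined through an arbitrary well chosen F; it is independent of F).\<close>
definition xvec :: "'p set \<Rightarrow> ('p \<Rightarrow> 'k::finite \<Rightarrow> nat) \<Rightarrow> ('p \<Rightarrow> 'p) \<Rightarrow> ('p \<Rightarrow> 'p)
    \<Rightarrow> 'p set \<Rightarrow> 'p \<Rightarrow> real" where
  "xvec L d rg src C = (let F = (SOME F. well_chosen L d rg src F) in
     THE x. (\<forall>v. 0 \<le> x v) \<and> (\<forall>v. v \<notin> up_closure L d rg src C \<longrightarrow> x v = 0)
        \<and> (\<Sum>v\<in>vert L d. x v) = 1
        \<and> (\<forall>v\<in>vert L d. (\<Sum>w\<in>vert L d. vmat_F L d rg src F v w * x w)
                           = spec_rad C (vmat_F L d rg src F) * x v))"

definition Cr :: "'p set \<Rightarrow> ('p \<Rightarrow> 'k::finite \<Rightarrow> nat) \<Rightarrow> ('p \<Rightarrow> 'p) \<Rightarrow> ('p \<Rightarrow> 'p)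
    \<Rightarrow> ('k \<Rightarrow> real) \<Rightarrow> real \<Rightarrow> 'p set set" where
  "Cr L d rg src r \<beta> = {C. pos_harmonic L d rg src C \<and>
      (\<forall>i. \<beta> * r i = ln (spec_rad C (vmat L d rg src i)))}"

definition CK_family :: "'p set \<Rightarrow> ('p \<Rightarrow> 'k::finite \<Rightarrow> nat) \<Rightarrow> ('p \<Rightarrow> 'p) \<Rightarrow> ('p \<Rightarrow> 'p)
    \<Rightarrow> ('p \<Rightarrow> 'p \<Rightarrow> 'p) \<Rightarrow> ('p \<Rightarrow> 'a::cstar_algebra) \<Rightarrow> bool" where
  "CK_family L d rg src cmp t \<longleftrightarrow>
     (\<forall>v\<in>vert L d. adj (t v) = t v \<and> t v * t v = t v)
   \<and> (\<forall>v\<in>vert L d. \<forall>w\<in>vert L d. v \<noteq> w \<longrightarrow> t v * t w = 0)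
   \<and> (\<forall>l\<in>L. \<forall>m\<in>L. src l = rg m \<longrightarrow> t l * t m = t (cmp l m))
   \<and> (\<forall>l\<in>L. adj (t l) * t l = t (src l))
   \<and> (\<forall>v\<in>vert L d. \<forall>n. t v = (\<Sum>l\<in>{l\<in>L. rg l = v \<and> d l = n}. t l * adj (t l)))"

text \<open>(A, t) is C*(Lambda): t is a Cuntz-Krieger family generating A (as a C*-algebra) with
  nonzero vertex projections, which has the universal property with respect to Cuntz-Krieger
  families in A.  By the gauge-invariant uniqueness theorem any such A is canonically
  isomorphic to the universal C*-algebra C*(Lambda).\<close>
definition is_graph_algebra :: "'p set \<Rightarrow> ('p \<Rightarrow> 'k::finite \<Rightarrow> nat) \<Rightarrow> ('p \<Rightarrow> 'p) \<Rightarrow> ('p \<Rightarrow> 'p)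
    \<Rightarrow> ('p \<Rightarrow> 'p \<Rightarrow> 'p) \<Rightarrow> ('p \<Rightarrow> 'a::cstar_algebra) \<Rightarrow> bool" where
  "is_graph_algebra L d rg src cmp t \<longleftrightarrow>
     CK_family L d rg src cmp t
   \<and> (\<forall>v\<in>vert L d. t v \<noteq> 0)
   \<and> closure (cstar_span {t l * adj (t g) | l g. l \<in> L \<and> g \<in> L}) = UNIV
   \<and> (\<forall>s::'p \<Rightarrow> 'a. CK_family L d rg src cmp s \<longrightarrow>
        (\<exists>!h. star_hom h \<and> (\<forall>l\<in>L. h (t l) = s l)))"

definition rdot :: "('k::finite \<Rightarrow> real) \<Rightarrow> ('k \<Rightarrow> real) \<Rightarrow> real" where
  "rdot r x = (\<Sum>i\<in>UNIV. r i * x i)"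

definition gauge_invariant :: "'p set \<Rightarrow> ('p \<Rightarrow> 'k::finite \<Rightarrow> nat) \<Rightarrow> ('p \<Rightarrow> 'a::cstar_algebra)
    \<Rightarrow> ('a \<Rightarrow> complex) \<Rightarrow> bool" where
  "gauge_invariant L d t w \<longleftrightarrow> (\<forall>z::'k \<Rightarrow> complex. (\<forall>i. cmod (z i) = 1) \<longrightarrow>
     (\<forall>h. star_hom h \<and> (\<forall>l\<in>L. h (t l) = cscale (\<Prod>i\<in>UNIV. z i ^ d l i) (t l)) \<longrightarrow>
        (\<forall>a. w (h a) = w a)))"

text \<open>KMS_beta condition for alpha^r, written on the spanning elements t_l t_g^* (the condition
  for a, b in the span follows by (bi)linearity):
  omega(a b) = omega(b alpha_{i beta}(a)), alpha_{i beta}(t_l t_g^* ) = e^{-beta r.(d l - d g)} t_l t_g^*.\<close>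
definition is_KMS :: "'p set \<Rightarrow> ('p \<Rightarrow> 'k::finite \<Rightarrow> nat) \<Rightarrow> ('p \<Rightarrow> 'a::cstar_algebra)
    \<Rightarrow> ('k \<Rightarrow> real) \<Rightarrow> real \<Rightarrow> ('a \<Rightarrow> complex) \<Rightarrow> bool" where
  "is_KMS L d t r \<beta> w \<longleftrightarrow> is_state w \<and>
     (\<forall>l\<in>L. \<forall>g\<in>L. \<forall>m\<in>L. \<forall>n\<in>L.
        w ((t l * adj (t g)) * (t m * adj (t n))) =
        w ((t m * adj (t n)) * cscale (complex_of_real (exp (- \<beta> * rdot r (\<lambda>i. real (d l i) - real (d g i)))))
                                     (t l * adj (t g))))"

definition gi_KMS_states :: "'p set \<Rightarrow> ('p \<Rightarrow> 'k::finite \<Rightarrow> nat) \<Rightarrow> ('p \<Rightarrow> 'a::cstar_algebra)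
    \<Rightarrow> ('k \<Rightarrow> real) \<Rightarrow> real \<Rightarrow> ('a \<Rightarrow> complex) set" where
  "gi_KMS_states L d t r \<beta> = {w. is_KMS L d t r \<beta> w \<and> gauge_invariant L d t w}"

definition weight_fns :: "'p set set \<Rightarrow> ('p set \<Rightarrow> real) set" where
  "weight_fns CC = {f. (\<forall>C\<in>CC. 0 \<le> f C \<and> f C \<le> 1) \<and> (\<forall>C. C \<notin> CC \<longrightarrow> f C = 0)
                      \<and> (\<Sum>C\<in>CC. f C) = 1}"

end

theory Submission
  imports Defs
begin

text \<open>A gauge-invariant KMS state \<open>\<omega>\<close> is determined by \<open>\<psi>\<^sub>v = \<omega>(t\<^sub>v)\<close>, and the
  KMS condition forces \<open>\<psi>\<close> to be a nonnegative joint eigenvector, \<open>A\<^sub>i \<psi> = e\<^bsup>\<beta> r\<^sub>i\<^esup> \<psi>\<close>. Conversely such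
  a \<open>\<psi>\<close> prescribes values on the elements \<open>t\<^sub>l t\<^sub>g\<^sup>*\<close>; averaging over finite subgroups of the torus
  and compressing by \<open>t\<^sub>x\<close> bounds the resulting functional on the span, so that it extends to the
  algebra, and positivity is a sum of squares in a normal form.

  For the eigenvectors, let \<open>F\<close> be well chosen. The components \<open>C\<close> from which no other part of the
  support of \<open>\<psi>\<close> is reached satisfy \<open>\<rho>(A\<^sub>F\<^sup>C) = \<mu>\<close> for the eigenvalue \<open>\<mu>\<close> of \<open>\<psi>\<close>. Every other
  vertex of the support leads into one of them, so \<open>\<psi>\<close> is a strictly subinvariant positive vector
  there and the spectral radius drops below \<open>\<mu>\<close>. This shows both that these \<open>C\<close> are harmonic and
  that \<open>\<psi>\<close> minus the matching combination of the \<open>x\<^sup>C\<close> vanishes.\<close>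

section \<open>C*-algebras\<close>

text \<open>Two gaps shape the proof. On the algebra side, the universal property concerns families
  inside the given algebra. It yields one gauge endomorphism for each point of the torus, with no
  continuity in that point; an element of the span involves finitely many degrees, so finite
  subgroups separate them and sums replace integrals. The Cuntz-Krieger relations do not list
  orthogonality of range projections of equal degree; it is derived from the fact that they add up
  to a projection, by extremality of a projection in the unit ball of its corner. Norm estimates
  come from a square root of \<open>1 - h\<close>, hence the constants 3/4, 2 and 4; any finite
  bound will do, since positivity is proved separately on a dense span. On the matrix side,
  harmonicity is given for some well chosen list, while \<open>xvec\<close> uses the list picked by
  choice. Commutation of the vertex matrices bridges the two: the eigenvector obtained from one list
  is a joint eigenvector of all A_i, hence an eigenvector for every list.\<close>

lemma cscale_one [simp]: "cscale 1 (a::'a::cstar_algebra) = a"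
  using cscale_of_real[of 1 a] by simp

lemma cscale_zero_left [simp]: "cscale 0 (a::'a::cstar_algebra) = 0"
  using cscale_of_real[of 0 a] by simp

lemma cscale_zero_right [simp]: "cscale c (0::'a::cstar_algebra) = 0"
  using cscale_add_right[of c 0 "0::'a"] by simp

lemma cscale_minus_right: "cscale c (- a) = - cscale c (a::'a::cstar_algebra)"
  using cscale_add_right[of c a "- a"] by (simp add: eq_neg_iff_add_eq_0 add.commute)

lemma cscale_minus_left: "cscale (- c) a = - cscale c (a::'a::cstar_algebra)"
  using cscale_add_left[of c "- c" a] by (simp add: eq_neg_iff_add_eq_0 add.commute)

lemma cscale_diff_right: "cscale c (a - b) = cscale c a - cscale c (b::'a::cstar_algebra)"
  using cscale_add_right[of c a "- b"] by (simp add: cscale_minus_right)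

lemma cscale_sum_right: "cscale c (\<Sum>i\<in>I. f i) = (\<Sum>i\<in>I. cscale c (f i :: 'a::cstar_algebra))"
  by (induction I rule: infinite_finite_induct) (auto simp: cscale_add_right)

lemma cscale_sum_left: "cscale (\<Sum>i\<in>I. f i) (a::'a::cstar_algebra) = (\<Sum>i\<in>I. cscale (f i) a)"
  by (induction I rule: infinite_finite_induct) (auto simp: cscale_add_left)

lemma adj_zero [simp]: "adj (0::'a::cstar_algebra) = 0"
  using adj_add[of 0 "0::'a"] by simp

lemma adj_minus: "adj (- a) = - adj (a::'a::cstar_algebra)"
  using adj_add[of a "- a"] by (simp add: eq_neg_iff_add_eq_0 add.commute)

lemma adj_diff: "adj (a - b) = adj a - adj (b::'a::cstar_algebra)"
  using adj_add[of a "- b"] by (simp add: adj_minus)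

lemma adj_sum: "adj (\<Sum>i\<in>I. f i) = (\<Sum>i\<in>I. adj (f i :: 'a::cstar_algebra))"
  by (induction I rule: infinite_finite_induct) (auto simp: adj_add)

lemma adj_one [simp]: "adj (1::'a::cstar_algebra) = 1"
  by (metis adj_adj adj_mult mult.right_neutral)

lemma adj_scaleR: "adj (x *\<^sub>R a) = x *\<^sub>R adj (a::'a::cstar_algebra)"
  by (metis adj_cscale complex_cnj_complex_of_real cscale_of_real)

lemma norm_adj [simp]: "norm (adj a) = norm (a::'a::cstar_algebra)"
proof -
  have le: "norm b \<le> norm (adj b)" for b :: 'a
  proof (cases "norm b = 0")
    case False
    have "norm b * norm b \<le> norm (adj b) * norm b"
      using norm_mult_ineq[of "adj b" b] cstar_identity[of b] by (simp add: power2_eq_square)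
    then show ?thesis using False by simp
  qed simp
  show ?thesis using le[of a] le[of "adj a"] by (simp add: adj_adj)
qed

lemma bounded_linear_adj: "bounded_linear (adj :: 'a::cstar_algebra \<Rightarrow> 'a)"
  by (rule bounded_linear_intro[where K = 1]) (auto simp: adj_add adj_scaleR)

lemma bounded_linear_cscale: "bounded_linear (cscale c :: 'a::cstar_algebra \<Rightarrow> 'a)"
  by (rule bounded_linear_intro[where K = "cmod c"])
     (auto simp: cscale_add_right norm_cscale cscale_cscale mult.commute simp flip: cscale_of_real)

lemma norm_projection_le_1:
  fixes p :: "'a::cstar_algebra"
  assumes "adj p = p" "p * p = p"
  shows "norm p \<le> 1"
proof -
  have "norm p * norm p = norm p" using cstar_identity[of p] assms by (simp add: power2_eq_square)
  then show ?thesis by (cases "norm p = 0") auto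
qed

lemma norm_projection_eq_1:
  fixes p :: "'a::cstar_algebra"
  assumes "adj p = p" "p * p = p" "p \<noteq> 0"
  shows "norm p = 1"
  using cstar_identity[of p] assms by (simp add: power2_eq_square)

text \<open>The root \<^term>\<open>1 - y\<close> of \<^term>\<open>1 - h\<close> comes from the fixed point of
  \<^term>\<open>\<lambda>y. (1/2) *\<^sub>R (h + y * y)\<close>, a contraction of the ball of radius 1/2.\<close>
lemma sqrt_one_minus:
  fixes h g :: "'a::cstar_algebra"
  assumes h: "adj h = h" "norm h \<le> 3/4" and g: "g * h = h * g"
  obtains y where "adj y = y" "y * y = 1 - h" "g * y = y * g"
proof -
  define f where "f y = (1/2) *\<^sub>R (h + y * y)" for y
  \<comment> \<open>\<open>(3/4 + 1/4) / 2 = 1/2\<close> is what lets \<open>f\<close> map the ball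
    of radius 1/2 to itself. Self-adjointness and commuting with \<open>g\<close> are put into the
    set so that the fixed point inherits them.\<close>
  define s where "s = {y::'a. norm y \<le> 1/2 \<and> adj y = y \<and> g * y = y * g}"
  have "closed s"
    unfolding s_def
    by (intro closed_Collect_conj closed_Collect_le closed_Collect_eq continuous_intros
        bounded_linear.continuous_on[OF bounded_linear_adj])
  then have "complete s" by (simp add: complete_eq_closed)
  moreover have "s \<noteq> {}" by (auto simp: s_def intro!: exI[of _ 0])
  moreover have "f ` s \<subseteq> s"
  proof
    fix z assume "z \<in> f ` s"
    then obtain y where y: "norm y \<le> 1/2" "adj y = y" "g * y = y * g" "z = f y" by (auto simp: s_def)
    have "norm (y * y) \<le> 1/2 * (1/2)"
      using y(1) by (intro order_trans[OF norm_mult_ineq] mult_mono) auto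
    then have "norm (h + y * y) \<le> 1" using h(2) norm_triangle_ineq[of h "y * y"] by simp
    moreover have "g * (y * y) = y * y * g" by (metis y(3) mult.assoc)
    moreover have "norm z = norm (h + y * y) / 2" using y(4) by (simp add: f_def)
    moreover have "adj z = z" using y h by (simp add: f_def adj_scaleR adj_add adj_mult)
    ultimately show "z \<in> s"
      using y(4) g by (simp add: s_def f_def distrib_left distrib_right)
  qed
  moreover have "\<forall>y\<in>s. \<forall>z\<in>s. dist (f y) (f z) \<le> 1/2 * dist y z"
  proof (intro ballI)
    fix y z assume yz: "y \<in> s" "z \<in> s"
    have "y * y - z * z = y * (y - z) + (y - z) * z" by (simp add: algebra_simps)
    also have "norm \<dots> \<le> norm y * norm (y - z) + norm (y - z) * norm z"
      by (intro order_trans[OF norm_triangle_ineq] add_mono norm_mult_ineq)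
    also have "\<dots> \<le> 1/2 * norm (y - z) + norm (y - z) * (1/2)"
      using yz by (intro add_mono mult_mono) (auto simp: s_def)
    finally have "norm (y * y - z * z) \<le> norm (y - z)" by simp
    then show "dist (f y) (f z) \<le> 1/2 * dist y z"
      by (simp add: dist_norm f_def flip: scaleR_diff_right)
  qed
  ultimately obtain y where y: "y \<in> s" "f y = y"
    using Banach_fix[of s "1/2" f] by auto
  have "y + y = h + y * y"
  proof -
    have "2 *\<^sub>R f y = h + y * y" by (simp add: f_def)
    then show ?thesis using y(2) by (simp add: scaleR_2)
  qed
  then have "(1 - y) * (1 - y) = 1 - h" by (simp add: algebra_simps)
  moreover have "adj (1 - y) = 1 - y" "g * (1 - y) = (1 - y) * g"
    using y(1) by (auto simp: s_def adj_diff algebra_simps)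
  ultimately show ?thesis using that by blast
qed

section \<open>Automatic continuity of *-homomorphisms and states, and orthogonal
  projections\<close>

lemma star_homD:
  assumes "star_hom h"
  shows "h (a + b) = h a + h b" "h (cscale c a) = cscale c (h a)"
    "h (a * b) = h a * h b" "h (adj a) = adj (h a)"
    "h (x *\<^sub>R a) = x *\<^sub>R h a" "h 0 = 0" "h (a - b) = h a - h b"
proof -
  show *: "h (a + b) = h a + h b" "h (cscale c a) = cscale c (h a)"
    "h (a * b) = h a * h b" "h (adj a) = adj (h a)" for a b c
    using assms by (auto simp: star_hom_def)
  show "h (x *\<^sub>R a) = x *\<^sub>R h a" by (metis *(2) cscale_of_real)
  show "h 0 = 0" using *(1)[of 0 0] by simp
  show "h (a - b) = h a - h b" using *(1)[of "a - b" b] by simp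
qed

lemma star_hom_sum: "star_hom h \<Longrightarrow> h (\<Sum>i\<in>I. f i) = (\<Sum>i\<in>I. h (f i))"
  by (induction I rule: infinite_finite_induct) (auto simp: star_homD)

text \<open>A small self-adjoint \<open>a\<close> is the real part of the unitary \<open>a + i sqrt (1 - a\<^sup>2)\<close>, whose image
  is contractive.\<close>
lemma star_hom_selfadjoint_norm_le:
  fixes h :: "'a::cstar_algebra \<Rightarrow> 'b::cstar_algebra"
  assumes h: "star_hom h" and a: "adj a = a"
  shows "norm (h a) \<le> 2 * norm a"
proof -
  \<comment> \<open>The radius 1/2 keeps \<open>norm (a * a)\<close> at most 1/4, within the range
    of \<open>sqrt_one_minus\<close>; scaling back to arbitrary \<open>a\<close> costs the factor
    2.\<close>
  have small: "norm (h a) \<le> 1" if a: "adj a = a" "norm a \<le> 1/2" for a :: 'a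
  proof -
    have "norm (a * a) \<le> 1/2 * (1/2)"
      using a(2) by (intro order_trans[OF norm_mult_ineq] mult_mono) auto
    then obtain b where b: "adj b = b" "b * b = 1 - a * a" "a * b = b * a"
      using sqrt_one_minus[of "a * a" a] a by (auto simp: adj_mult mult.assoc)
    define u where "u = h a + cscale \<i> (h b)"
    have u': "adj u = h a - cscale \<i> (h b)"
      using a b by (simp add: u_def adj_add adj_cscale cscale_minus_left flip: star_homD[OF h])
    have "adj u * u = h a * h a + h b * h b + cscale \<i> (h a * h b - h b * h a)"
      unfolding u' unfolding u_def
      by (simp add: algebra_simps cscale_diff_right cscale_add_right cscale_cscale cscale_minus_left
          flip: cscale_mult_left cscale_mult_right)
    also have "h a * h b = h b * h a" using b(3) by (metis star_homD(3)[OF h])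
    also have "h a * h a + h b * h b = h 1"
      by (simp add: b(2) flip: star_homD[OF h])
    finally have "adj u * u = h 1" by simp
    \<comment> \<open>A \<open>star_hom\<close> may send 1 to a proper projection, but a projection
      has norm at most 1.\<close>
    moreover have "norm (h 1) \<le> 1"
      by (rule norm_projection_le_1) (simp_all flip: star_homD[OF h])
    ultimately have "(norm u)\<^sup>2 \<le> 1" using cstar_identity[of u] by simp
    then have "norm u \<le> 1" using power2_le_imp_le[of "norm u" 1] by simp
    moreover have "2 *\<^sub>R h a = u + adj u" unfolding u' unfolding u_def by (simp add: scaleR_2)
    then have "2 * norm (h a) \<le> norm u + norm (adj u)"
      using norm_triangle_ineq[of u "adj u"] by (metis norm_scaleR abs_numeral)
    ultimately show ?thesis by simp
  qed
  show ?thesis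
  proof (cases "a = 0")
    case False
    have "norm (h ((1 / (2 * norm a)) *\<^sub>R a)) \<le> 1"
      using False a by (intro small) (auto simp: adj_scaleR)
    then show ?thesis using False by (simp add: star_homD[OF h] field_simps)
  qed (simp add: star_homD[OF h])
qed

lemma star_hom_norm_le:
  fixes h :: "'a::cstar_algebra \<Rightarrow> 'b::cstar_algebra"
  assumes h: "star_hom h"
  shows "norm (h a) \<le> 2 * norm a"
proof -
  have "(norm (h a))\<^sup>2 = norm (h (adj a * a))"
    by (simp add: star_homD[OF h] cstar_identity)
  also have "\<dots> \<le> 2 * norm (adj a * a)"
    by (rule star_hom_selfadjoint_norm_le[OF h]) (simp add: adj_mult adj_adj)
  also have "\<dots> \<le> (2 * norm a)\<^sup>2" by (simp add: cstar_identity power_mult_distrib)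
  finally show ?thesis by (rule power2_le_imp_le) simp
qed

lemma star_hom_bounded_linear: "star_hom h \<Longrightarrow> bounded_linear h"
  by (rule bounded_linear_intro[where K = 2])
     (auto simp: star_homD star_hom_norm_le mult.commute[of _ 2])

lemma is_stateD:
  assumes "is_state w"
  shows "w (a + b) = w a + w b" "w (cscale c a) = c * w a"
    "Im (w (adj a * a)) = 0" "Re (w (adj a * a)) \<ge> 0" "w 1 = 1"
    "w (- a) = - w a" "w (a - b) = w a - w b" "w 0 = 0" "w (x *\<^sub>R a) = of_real x * w a"
proof -
  show *: "w (a + b) = w a + w b" "w (cscale c a) = c * w a"
    "Im (w (adj a * a)) = 0" "Re (w (adj a * a)) \<ge> 0" "w 1 = 1" for a b c
    using assms by (auto simp: is_state_def)
  show "w 0 = 0" using *(1)[of 0 0] by simp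
  show "w (a - b) = w a - w b" using *(1)[of "a - b" b] by simp
  show "w (x *\<^sub>R a) = of_real x * w a" by (metis *(2) cscale_of_real)
  show "w (- a) = - w a" using *(2)[of "-1" a] by (simp add: cscale_minus_left)
qed

lemma is_state_sum: "is_state w \<Longrightarrow> w (\<Sum>i\<in>I. f i) = (\<Sum>i\<in>I. w (f i))"
  by (induction I rule: infinite_finite_induct) (auto simp: is_stateD)

text \<open>Positivity alone forces continuity. For self-adjoint \<open>g\<close> of norm at most
  3/4, \<open>1 - g\<close> is the square of a self-adjoint element, so \<open>w g\<close> is real
  and at most 1; taking both \<open>h\<close> and \<open>- h\<close> bounds \<open>w\<close> on that
  ball. The real and imaginary parts of \<open>a\<close> contribute 2 each to the constant
  4.\<close>

lemma is_state_bounded: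
  fixes w :: "'a::cstar_algebra \<Rightarrow> complex"
  assumes w: "is_state w"
  shows "bounded_linear w"
proof -
  have small: "cmod (w h) \<le> 1" if h: "adj h = h" "norm h \<le> 3/4" for h :: 'a
  proof -
    have *: "Im (w g) = 0 \<and> Re (w g) \<le> 1" if g: "adj g = g" "norm g \<le> 3/4" for g :: 'a
    proof -
      obtain y where "adj y = y" "y * y = 1 - g" using sqrt_one_minus[of g 1] g by auto
      then show ?thesis using is_stateD(3,4)[OF w, of y] by (simp add: is_stateD[OF w])
    qed
    have "w h = of_real (Re (w h))" "\<bar>Re (w h)\<bar> \<le> 1"
      using *[of h] *[of "- h"] h by (auto simp: is_stateD[OF w] adj_minus complex_eq_iff)
    then show ?thesis by (metis norm_of_real)
  qed
  have sa: "cmod (w h) \<le> 2 * norm h" if h: "adj h = h" for h :: 'a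
  proof (cases "h = 0")
    case False
    have "cmod (w ((1 / (2 * norm h)) *\<^sub>R h)) \<le> 1"
      using False h by (intro small) (auto simp: adj_scaleR)
    then show ?thesis
      using False by (simp add: is_stateD[OF w] norm_mult norm_divide field_simps)
  qed (simp add: is_stateD[OF w])
  have "cmod (w a) \<le> norm a * 4" for a
  proof -
    define h k where "h = (1/2) *\<^sub>R (a + adj a)" and "k = cscale (- \<i> / 2) (a - adj a)"
    have "adj h = h" "adj k = k"
      by (auto simp: h_def k_def adj_scaleR adj_add adj_adj adj_cscale adj_diff cscale_diff_right
          cscale_minus_left add.commute)
    moreover have "a = h + cscale \<i> k"
    proof -
      have "cscale \<i> k = (1/2) *\<^sub>R (a - adj a)"
        by (simp add: k_def cscale_cscale flip: cscale_of_real)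
      then show ?thesis
        by (simp add: h_def scaleR_diff_right scaleR_add_right flip: scaleR_left.add)
    qed
    moreover have "norm h \<le> norm a" "norm k \<le> norm a"
      using norm_triangle_ineq[of a "adj a"] norm_triangle_ineq4[of a "adj a"]
      by (auto simp: h_def k_def norm_cscale norm_divide)
    ultimately show ?thesis
      using sa[of h] sa[of k] norm_triangle_ineq[of "w h" "\<i> * w k"]
      by (simp add: is_stateD[OF w] norm_mult)
  qed
  then show ?thesis
    by (intro bounded_linear_intro[where K = 4]) (auto simp: is_stateD[OF w] scaleR_conv_of_real[where 'a = complex])
qed

text \<open>Averaging \<open>(p + w)\<^sup>2\<close> and \<open>(p + i w)\<^sup>2\<close> gives \<open>p + (1 + i) w\<close>, so the bound for \<open>w\<close>
  passes to \<open>(1 + i) w\<close> and, iterating, to arbitrarily large multiples of \<open>w\<close>.\<close>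
lemma corner_extreme_complex:
  fixes p w :: "'a::cstar_algebra"
  assumes p: "p * p = p" "p * w = w" "w * p = w" "norm p \<le> 1"
    and w: "\<And>k::nat. norm (p + cscale (\<i> ^ k) w) \<le> 1"
  shows "w = 0"
proof -
  define W where "W n = cscale ((1 + \<i>) ^ n) w" for n
  have pW: "p * W n = W n" "W n * p = W n" for n
    using p by (simp_all add: W_def flip: cscale_mult_left cscale_mult_right)
  have bound: "norm (p + cscale (\<i> ^ k) (W n)) \<le> 1" for n k
  proof (induction n arbitrary: k)
    case (Suc n)
    define x y where "x = p + cscale (\<i> ^ k) (W n)" and "y = p + cscale (\<i> ^ Suc k) (W n)"
    have sq: "(p + cscale c (W n)) * (p + cscale c (W n))
        = p + 2 *\<^sub>R cscale c (W n) + cscale (c * c) (W n * W n)" for c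
      using p pW by (simp add: algebra_simps scaleR_2 cscale_cscale cscale_add_right
          flip: cscale_mult_left cscale_mult_right)
    have W: "W (Suc n) = W n + cscale \<i> (W n)"
      by (simp add: W_def cscale_cscale algebra_simps flip: cscale_add_left)
    have "x * x + y * y = 2 *\<^sub>R (p + cscale (\<i> ^ k) (W (Suc n)))"
      unfolding x_def y_def sq W
      by (simp add: algebra_simps cscale_add_right cscale_cscale scaleR_2 cscale_minus_left)
    moreover have "norm (x * x) \<le> 1 * 1" "norm (y * y) \<le> 1 * 1"
      using Suc.IH[of k] Suc.IH[of "Suc k"] unfolding x_def y_def
      by (intro order_trans[OF norm_mult_ineq] mult_mono; simp)+
    ultimately have "norm (2 *\<^sub>R (p + cscale (\<i> ^ k) (W (Suc n)))) \<le> 2"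
      using norm_triangle_ineq[of "x * x" "y * y"] by simp
    then show ?case by simp
  qed (simp add: W_def w)
  have cmod_1i: "cmod (1 + \<i>) = sqrt 2" by (simp add: cmod_def)
  have "sqrt 2 ^ n * norm w \<le> 2" for n
  proof -
    have "norm (W n) \<le> norm (p + cscale (\<i> ^ 0) (W n)) + norm p"
      using norm_triangle_ineq4[of "p + W n" p] by simp
    also have "\<dots> \<le> 2" using bound[of 0 n] p(4) by simp
    finally show ?thesis by (simp add: W_def norm_cscale norm_power cmod_1i)
  qed
  moreover have "\<exists>n. 2 / norm w < sqrt 2 ^ n" by (rule real_arch_pow) simp
  ultimately show ?thesis
    by (metis divide_less_eq linorder_not_less norm_le_zero_iff zero_less_norm_iff)
qed

text \<open>The average of the squares of \<open>p + e\<close> and \<open>p - e\<close> is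
  \<open>p + e * e\<close>, which is also \<open>adj u * u\<close> for \<open>u = p + i e\<close>
  and \<open>u = p - i e\<close>. Hence these have norm at most 1 too, and all four powers of i are
  available for \<open>corner_extreme_complex\<close>.\<close>

lemma corner_extreme:
  fixes p e :: "'a::cstar_algebra"
  assumes p: "adj p = p" "p * p = p" "p * e = e" "e * p = e" and e: "adj e = e"
    and n: "norm (p + e) \<le> 1" "norm (p - e) \<le> 1"
  shows "e = 0"
proof (rule corner_extreme_complex[OF p(2-4)])
  show "norm p \<le> 1" using p by (simp add: norm_projection_le_1)
  have sq: "(norm (p + cscale \<i> e))\<^sup>2 \<le> 1" "(norm (p - cscale \<i> e))\<^sup>2 \<le> 1"
  proof -
    have "(p + e) * (p + e) + (p - e) * (p - e) = 2 *\<^sub>R (p + e * e)"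
      using p by (simp add: algebra_simps scaleR_2)
    moreover have "norm ((p + e) * (p + e)) \<le> 1 * 1" "norm ((p - e) * (p - e)) \<le> 1 * 1"
      using n by (intro order_trans[OF norm_mult_ineq] mult_mono; simp)+
    ultimately have "norm (2 *\<^sub>R (p + e * e)) \<le> 2"
      using norm_triangle_ineq[of "(p + e) * (p + e)" "(p - e) * (p - e)"] by simp
    moreover have "adj (p + cscale \<i> e) * (p + cscale \<i> e) = p + e * e"
      "adj (p - cscale \<i> e) * (p - cscale \<i> e) = p + e * e"
      using p e by (simp_all add: adj_add adj_diff adj_cscale cscale_minus_left algebra_simps
          cscale_cscale cscale_add_right cscale_diff_right flip: cscale_mult_left cscale_mult_right)
    ultimately show "(norm (p + cscale \<i> e))\<^sup>2 \<le> 1" "(norm (p - cscale \<i> e))\<^sup>2 \<le> 1"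
      unfolding cstar_identity[symmetric] by simp_all
  qed
  have i: "norm (p + cscale \<i> e) \<le> 1" "norm (p - cscale \<i> e) \<le> 1"
    using sq power2_le_imp_le[of _ 1] by auto
  fix k :: nat
  have "\<i> ^ k = 1 \<or> \<i> ^ k = -1 \<or> \<i> ^ k = \<i> \<or> \<i> ^ k = -\<i>"
    by (induction k) auto
  then show "norm (p + cscale (\<i> ^ k) e) \<le> 1"
    using n i by (elim disjE) (simp_all add: cscale_minus_left)
qed

text \<open>With \<open>p = q j\<close>, the compressions \<open>e k\<close> over
  \<open>k \<noteq> j\<close> add up to 0, and each \<open>p - e k\<close> has norm at most 1. Since
  \<open>e i\<close> is minus the sum of the other compressions, these one-sided bounds give
  \<open>norm (n p + e i) \<le> n\<close> as well as \<open>norm (n p - e i) \<le> n\<close>.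
  Extremality of \<open>p\<close> then kills \<open>e i\<close>, which equals
  \<open>adj (q i * q j) * (q i * q j)\<close>.\<close>

lemma orthogonal_of_sum_projections:
  fixes q :: "'i \<Rightarrow> 'a::cstar_algebra"
  assumes I: "finite I" "i \<in> I" "j \<in> I" "i \<noteq> j"
    and q: "\<And>k. k \<in> I \<Longrightarrow> adj (q k) = q k" "\<And>k. k \<in> I \<Longrightarrow> q k * q k = q k"
    and P: "(\<Sum>k\<in>I. q k) * q j = q j"
  shows "q i * q j = 0"
proof -
  define p where "p = q j"
  define e where "e k = p * q k * p" for k
  define J where "J = I - {j}"
  define n where "n = real (card J)"
  have p: "adj p = p" "p * p = p" using q I by (auto simp: p_def)
  have "norm p \<le> 1" using p by (rule norm_projection_le_1)
  have fJ: "finite J" "i \<in> J" using I by (auto simp: J_def)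
  then have n: "n \<ge> 1" by (simp add: n_def Suc_le_eq card_gt_0_iff) (use fJ in blast)
  have pe: "p * e k = e k" "e k * p = e k" for k
    using p by (simp_all add: e_def mult.assoc) (metis mult.assoc)
  have "(\<Sum>k\<in>I. e k) = p"
    using P p by (simp add: e_def mult.assoc flip: sum_distrib_left sum_distrib_right p_def)
  moreover have "e j = p" using p by (simp add: e_def flip: p_def)
  ultimately have s0: "(\<Sum>k\<in>J. e k) = 0"
    using I by (simp add: J_def sum_diff1)
  have ne: "norm (p - e k) \<le> 1" if "k \<in> I" for k
  proof -
    have "p - e k = p * (1 - q k) * p" using p by (simp add: e_def algebra_simps)
    also have "norm \<dots> \<le> 1 * 1 * 1"
    proof (intro order_trans[OF norm_mult_ineq] mult_mono)
      show "norm (1 - q k) \<le> 1"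
        using q that by (intro norm_projection_le_1) (auto simp: adj_diff algebra_simps)
    qed (use \<open>norm p \<le> 1\<close> in auto)
    finally show ?thesis by simp
  qed
  have "norm (n *\<^sub>R p + e i) \<le> n"
  proof -
    have "(\<Sum>k\<in>J-{i}. p - e k) = (n - 1) *\<^sub>R p + e i"
      using s0 fJ by (simp add: sum_subtractf sum_diff1 n_def of_nat_diff Suc_le_eq card_gt_0_iff
          scaleR_conv_of_real algebra_simps card_Diff_singleton_if)
        (metis One_nat_def Suc_pred card_gt_0_iff emptyE of_nat_Suc add.commute distrib_right mult_1)
    moreover have "norm (\<Sum>k\<in>J-{i}. p - e k) \<le> real (card (J - {i})) * 1"
      using ne by (intro sum_norm_bound) (auto simp: J_def)
    ultimately have "norm ((n - 1) *\<^sub>R p + e i) \<le> n - 1"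
      using fJ n by (simp add: n_def of_nat_diff)
    moreover have "norm (n *\<^sub>R p + e i) = norm (p + ((n - 1) *\<^sub>R p + e i))"
      by (simp add: algebra_simps)
    ultimately show ?thesis
      using \<open>norm p \<le> 1\<close> norm_triangle_ineq[of p "(n - 1) *\<^sub>R p + e i"] by linarith
  qed
  moreover have "norm (n *\<^sub>R p - e i) \<le> n"
  proof -
    have "n *\<^sub>R p - e i = (n - 1) *\<^sub>R p + (p - e i)" by (simp add: algebra_simps)
    also have "norm \<dots> \<le> (n - 1) * norm p + 1"
      using ne[of i] I n norm_triangle_ineq[of "(n - 1) *\<^sub>R p" "p - e i"] by simp
    also have "\<dots> \<le> (n - 1) * 1 + 1" using \<open>norm p \<le> 1\<close> n by (intro add_mono mult_left_mono) auto
    finally show ?thesis by simp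
  qed
  moreover have "p + (1/n) *\<^sub>R e i = (1/n) *\<^sub>R (n *\<^sub>R p + e i)"
    "p - (1/n) *\<^sub>R e i = (1/n) *\<^sub>R (n *\<^sub>R p - e i)"
    using n by (simp_all add: scaleR_add_right scaleR_diff_right)
  ultimately have "norm (p + (1/n) *\<^sub>R e i) \<le> 1" "norm (p - (1/n) *\<^sub>R e i) \<le> 1"
    using n by simp_all
  moreover have ade: "adj (e i) = e i" using p q I by (simp add: e_def adj_mult mult.assoc)
  ultimately have "(1/n) *\<^sub>R e i = 0"
    using p ade by (intro corner_extreme[of p]) (auto simp: pe adj_scaleR)
  then have "e i = 0" using n by simp
  moreover have "e i = adj (q i * q j) * (q i * q j)"
    using q I by (simp add: e_def p_def adj_mult) (metis mult.assoc)
  ultimately show ?thesis using cstar_identity[of "q i * q j"] by simp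
qed

section \<open>Linear spans and the extension of bounded functionals\<close>

lemma cstar_span_alt:
  "cstar_span X = {\<Sum>x\<in>S. cscale (c x) x | S c. finite S \<and> S \<subseteq> X}"
proof (intro equalityI subsetI)
  fix a assume "a \<in> cstar_span X"
  then obtain I :: "nat set" and c x
    where I: "finite I" "x ` I \<subseteq> X" and a: "a = (\<Sum>i\<in>I. cscale (c i) (x i))"
    by (auto simp: cstar_span_def)
  have "a = (\<Sum>y\<in>x ` I. \<Sum>i\<in>{i\<in>I. x i = y}. cscale (c i) (x i))"
    unfolding a by (rule sum.image_gen[OF I(1)])
  also have "\<dots> = (\<Sum>y\<in>x ` I. cscale (\<Sum>i\<in>{i\<in>I. x i = y}. c i) y)"
    by (intro sum.cong refl) (simp add: cscale_sum_left)
  finally show "a \<in> {\<Sum>x\<in>S. cscale (c x) x | S c. finite S \<and> S \<subseteq> X}"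
    using I by (intro CollectI exI[of _ "x ` I"] exI[of _ "\<lambda>y. \<Sum>i\<in>{i\<in>I. x i = y}. c i"]) auto
next
  fix a assume "a \<in> {\<Sum>x\<in>S. cscale (c x) x | S c. finite S \<and> S \<subseteq> X}"
  then obtain S c where S: "finite S" "S \<subseteq> X" and a: "a = (\<Sum>x\<in>S. cscale (c x) x)" by auto
  obtain h where h: "bij_betw h {0..<card S} S" using ex_bij_betw_nat_finite[OF S(1)] by blast
  have "a = (\<Sum>i\<in>{0..<card S}. cscale (c (h i)) (h i))"
    unfolding a by (rule sum.reindex_bij_betw[OF h, symmetric])
  then show "a \<in> cstar_span X"
    using S(2) bij_betw_imp_surj_on[OF h] unfolding cstar_span_def
    by (intro CollectI exI[of _ "{0..<card S}"] exI[of _ "\<lambda>i. c (h i)"] exI[of _ h]) auto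
qed

text \<open>As \<open>m\<close> may fail to be injective, one preimage is picked for each generator;
  coefficients can then be indexed by \<open>Q\<close> instead of by elements of the
  algebra.\<close>

lemma cstar_span_imageE:
  assumes "a \<in> cstar_span (m ` Q)"
  obtains S c where "finite S" "S \<subseteq> Q" "a = (\<Sum>q\<in>S. cscale (c q) (m q))"
proof -
  obtain T c where T: "finite T" "T \<subseteq> m ` Q" "a = (\<Sum>x\<in>T. cscale (c x) x)"
    using assms by (auto simp: cstar_span_alt)
  obtain S where S: "S \<subseteq> Q" "inj_on m S" "T = m ` S"
    using T(2) by (auto simp: subset_image_inj)
  show ?thesis
    using that[of S "\<lambda>q. c (m q)"] T S by (simp add: sum.reindex finite_image_iff)
qed

lemma cstar_span_imageI:
  assumes "finite S" "S \<subseteq> Q"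
  shows "(\<Sum>q\<in>S. cscale (c q) (m q)) \<in> cstar_span (m ` Q)"
proof -
  obtain h where h: "bij_betw h {0..<card S} S" using ex_bij_betw_nat_finite[OF assms(1)] by blast
  have "(\<Sum>q\<in>S. cscale (c q) (m q)) = (\<Sum>i\<in>{0..<card S}. cscale (c (h i)) (m (h i)))"
    by (rule sum.reindex_bij_betw[OF h, symmetric])
  then show ?thesis
    using assms(2) bij_betw_imp_surj_on[OF h] unfolding cstar_span_def
    by (intro CollectI exI[of _ "{0..<card S}"] exI[of _ "\<lambda>i. c (h i)"] exI[of _ "m \<circ> h"]) auto
qed

lemma cstar_span_base: "x \<in> X \<Longrightarrow> x \<in> cstar_span X"
  unfolding cstar_span_alt by (intro CollectI exI[of _ "{x}"] exI[of _ "\<lambda>_. 1"]) auto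

lemma cstar_span_0: "0 \<in> cstar_span X"
  unfolding cstar_span_alt by (intro CollectI exI[of _ "{}"]) auto

lemma cstar_span_cscale: "a \<in> cstar_span X \<Longrightarrow> cscale c a \<in> cstar_span X"
  unfolding cstar_span_alt
proof (clarify, goal_cases)
  case (1 S e)
  then show ?case
    by (intro exI[of _ S] exI[of _ "\<lambda>x. c * e x"]) (auto simp: cscale_sum_right cscale_cscale)
qed

lemma cstar_span_add:
  assumes "a \<in> cstar_span X" "b \<in> cstar_span X"
  shows "a + b \<in> cstar_span X"
proof -
  obtain S T c e where S: "finite S" "S \<subseteq> X" "a = (\<Sum>x\<in>S. cscale (c x) x)"
    and T: "finite T" "T \<subseteq> X" "b = (\<Sum>x\<in>T. cscale (e x) x)"
    using assms unfolding cstar_span_alt by blast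
  define c' where "c' x = (if x \<in> S then c x else 0) + (if x \<in> T then e x else 0)" for x
  have "a = (\<Sum>x\<in>S\<union>T. cscale (if x \<in> S then c x else 0) x)"
    "b = (\<Sum>x\<in>S\<union>T. cscale (if x \<in> T then e x else 0) x)"
    unfolding S T using S(1) T(1) by (auto intro!: sum.mono_neutral_cong_left)
  then have "a + b = (\<Sum>x\<in>S\<union>T. cscale (c' x) x)"
    by (simp add: c'_def cscale_add_left sum.distrib)
  then show ?thesis
    unfolding cstar_span_alt using S T by (intro CollectI exI[of _ "S \<union> T"] exI[of _ c']) auto
qed

lemma cstar_span_sum: "(\<And>i. i \<in> I \<Longrightarrow> f i \<in> cstar_span X) \<Longrightarrow> (\<Sum>i\<in>I. f i) \<in> cstar_span X"
  by (induction I rule: infinite_finite_induct) (auto simp: cstar_span_0 cstar_span_add)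

lemma dense_eqI:
  fixes f g :: "'a::topological_space \<Rightarrow> 'b::t2_space"
  assumes "closure S = UNIV" "continuous_on UNIV f" "continuous_on UNIV g" "\<And>x. x \<in> S \<Longrightarrow> f x = g x"
  shows "f x = g x"
proof -
  have "closed {x. f x = g x}" using assms(2,3) by (rule closed_Collect_eq)
  then have "closure S \<subseteq> {x. f x = g x}" using assms(4) by (intro closure_minimal) auto
  then show ?thesis using assms(1) by auto
qed

text \<open>The elements \<open>m q\<close> may be linearly dependent, so it is not clear that the
  values \<open>\<phi> q\<close> define a function on the span. The bound, applied to the difference
  of two representations, gives well-definedness and the Lipschitz property at once. Linearity
  survives the extension to the closure by density, used in one argument of the sum at a
  time.\<close>

lemma extend_functional:
  fixes m :: "'q \<Rightarrow> 'a::cstar_algebra" and \<phi> :: "'q \<Rightarrow> complex"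
  assumes dense: "closure (cstar_span (m ` Q)) = UNIV" and K: "0 \<le> K"
    and bound: "\<And>S c. finite S \<Longrightarrow> S \<subseteq> Q \<Longrightarrow>
      cmod (\<Sum>q\<in>S. c q * \<phi> q) \<le> K * norm (\<Sum>q\<in>S. cscale (c q) (m q))"
  obtains w where "bounded_linear w" "\<And>c a. w (cscale c a) = c * w a" "\<And>q. q \<in> Q \<Longrightarrow> w (m q) = \<phi> q"
proof -
  define rep where "rep a S c \<longleftrightarrow> finite S \<and> S \<subseteq> Q \<and> a = (\<Sum>q\<in>S. cscale (c q) (m q))" for a S c
  define val where "val S c = (\<Sum>q\<in>S. c q * \<phi> q)" for S c
  define D where "D = cstar_span (m ` Q)"
  define ext where "ext S c q = (if q \<in> S then c q else 0 :: complex)" for S c and q :: 'q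
  have ext: "rep a (S \<union> T) (ext S c)" "val (S \<union> T) (ext S c) = val S c"
    if "rep a S c" "finite T" "T \<subseteq> Q" for a S T c
  proof -
    have "(\<Sum>q\<in>S. cscale (c q) (m q)) = (\<Sum>q\<in>S\<union>T. cscale (ext S c q) (m q))"
      using that by (intro sum.mono_neutral_cong_left) (auto simp: rep_def ext_def)
    then show "rep a (S \<union> T) (ext S c)" using that unfolding rep_def by (intro conjI) simp_all
    show "val (S \<union> T) (ext S c) = val S c"
      using that unfolding val_def
      by (intro sum.mono_neutral_cong_right) (auto simp: rep_def ext_def)
  qed
  have rep_scale: "rep (cscale k a) S (\<lambda>q. k * c q)" "val S (\<lambda>q. k * c q) = k * val S c"
    if "rep a S c" for k a S c
    using that by (auto simp: rep_def val_def cscale_sum_right cscale_cscale sum_distrib_left mult.assoc)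
  have rep_add: "\<exists>U e. rep (a + b) U e \<and> val U e = val S c + val T d"
    if "rep a S c" "rep b T d" for a b S T c d
  proof -
    have 1: "rep a (S \<union> T) (ext S c)" "val (S \<union> T) (ext S c) = val S c"
      "rep b (S \<union> T) (ext T d)" "val (S \<union> T) (ext T d) = val T d"
      using ext[of a S c T] ext[of b T d S] that by (auto simp: rep_def Un_commute)
    have "rep (a + b) (S \<union> T) (\<lambda>q. ext S c q + ext T d q)"
      using 1(1,3) by (auto simp: rep_def cscale_add_left sum.distrib)
    moreover have "val (S \<union> T) (\<lambda>q. ext S c q + ext T d q) = val S c + val T d"
      unfolding 1(2,4)[symmetric] by (simp add: val_def distrib_right sum.distrib)
    ultimately show ?thesis by blast
  qed
  have lip: "cmod (val S c - val T d) \<le> K * norm (a - b)" if r: "rep a S c" "rep b T d" for a b S T c d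
  proof -
    obtain U e where "rep (a + cscale (-1) b) U e" "val U e = val S c + - val T d"
      using rep_add[OF r(1) rep_scale(1)[OF r(2), of "-1"]] rep_scale(2)[OF r(2), of "-1"]
      by (metis mult_minus1)
    then have U: "finite U" "U \<subseteq> Q" "a - b = (\<Sum>q\<in>U. cscale (e q) (m q))"
      and e: "val S c - val T d = (\<Sum>q\<in>U. e q * \<phi> q)"
      by (simp_all add: rep_def val_def cscale_minus_left)
    show ?thesis unfolding U(3) e by (rule bound[OF U(1,2)])
  qed
  have repE: "\<exists>S c. rep a S c" if "a \<in> D" for a
    using that cstar_span_imageE[of a m Q] unfolding D_def rep_def by metis
  then obtain S0 c0 where rep0: "\<And>a. a \<in> D \<Longrightarrow> rep a (S0 a) (c0 a)" by metis
  define f where "f a = val (S0 a) (c0 a)" for a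
  have f: "f a = val S c" if r: "rep a S c" for a S c
  proof -
    have "a \<in> D" using r cstar_span_imageI[of S Q c m] by (simp add: rep_def D_def)
    then have "cmod (val (S0 a) (c0 a) - val S c) \<le> K * norm (a - a)" using r by (intro lip rep0)
    then show ?thesis by (simp add: f_def)
  qed
  have "K-lipschitz_on D f"
  proof (rule lipschitz_onI[OF _ K])
    fix a b assume "a \<in> D" "b \<in> D"
    then obtain S c T d where "rep a S c" "rep b T d" using repE by meson
    then show "dist (f a) (f b) \<le> K * dist a b" using lip f by (simp add: dist_norm)
  qed
  then obtain g where "K-lipschitz_on (closure D) g" and gf: "\<forall>x\<in>D. g x = f x"
    using lipschitz_extend_closure by blast
  then have g: "K-lipschitz_on UNIV g" using dense by (simp add: D_def)
  have cont: "continuous_on UNIV g" by (rule lipschitz_on_continuous_on[OF g])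
  have cont': "continuous_on UNIV (\<lambda>x. g (h x))" if "continuous_on UNIV h" for h
    using continuous_on_compose2[OF cont that] by auto
  have D: "closure D = UNIV" using dense by (simp add: D_def)
  have add0: "g (a + b) = g a + g b" if a: "a \<in> D" and b: "b \<in> D" for a b
  proof -
    obtain S c T d where r: "rep a S c" "rep b T d" using repE a b by meson
    have "a + b \<in> D" using a b by (simp add: D_def cstar_span_add)
    then show ?thesis using rep_add[OF r] f r a b gf by auto
  qed
  have add1: "g (a + b) = g a + g b" if a: "a \<in> D" for a b
    by (rule dense_eqI[OF D]) (auto intro!: continuous_intros cont cont' add0 a)
  have add: "g (a + b) = g a + g b" for a b
    by (rule dense_eqI[OF D]) (auto intro!: continuous_intros cont cont' add1)
  have scale: "g (cscale k a) = k * g a" for k a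
  proof (rule dense_eqI[OF D, of "\<lambda>a. g (cscale k a)"])
    fix a assume a: "a \<in> D"
    then obtain S c where r: "rep a S c" using repE by meson
    have "cscale k a \<in> D" using a by (simp add: D_def cstar_span_cscale)
    then show "g (cscale k a) = k * g a"
      using rep_scale[OF r, of k] f[OF r] f[of "cscale k a" S "\<lambda>q. k * c q"] a gf by simp
  qed (auto intro!: continuous_intros cont cont' bounded_linear.continuous_on[OF bounded_linear_cscale])
  have "g 0 = 0" using scale[of 0 0] by simp
  have "bounded_linear g"
  proof (rule bounded_linear_intro[where K = K])
    show "g (x *\<^sub>R a) = x *\<^sub>R g a" for x a
      using scale[of "of_real x" a] by (simp add: cscale_of_real scaleR_conv_of_real)
    show "norm (g a) \<le> norm a * K" for a
      using lipschitz_onD[OF g, of a 0] \<open>g 0 = 0\<close> by (simp add: mult.commute)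
  qed (rule add)
  moreover have "g (m q) = \<phi> q" if "q \<in> Q" for q
  proof -
    have "m q \<in> D" using that by (simp add: D_def cstar_span_base)
    moreover have "rep (m q) {q} (\<lambda>_. 1)" using that by (simp add: rep_def)
    ultimately show ?thesis using f gf by (fastforce simp: val_def)
  qed
  ultimately show ?thesis using that scale by blast
qed

section \<open>Nonnegative matrices\<close>

text \<open>The eigenvalue equation is read at the index where the ratio of
  \<open>cmod (y v)\<close> to \<open>x v\<close> is largest. The eigenvector lives on a subset
  \<open>T\<close>, so principal submatrices are covered as well.\<close>

lemma subinvariant_eigenvalue_le:
  fixes B :: "'p \<Rightarrow> 'p \<Rightarrow> real"
  assumes S: "finite S" "T \<subseteq> S" and B: "\<forall>v\<in>S. \<forall>w\<in>S. 0 \<le> B v w"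
    and x: "\<And>v. v \<in> S \<Longrightarrow> 0 < x v" "\<And>v. v \<in> S \<Longrightarrow> (\<Sum>w\<in>S. B v w * x w) \<le> \<theta> * x v"
    and y: "\<exists>v\<in>T. y v \<noteq> (0::complex)" "\<And>v. v \<in> T \<Longrightarrow> (\<Sum>w\<in>T. of_real (B v w) * y w) = mu * y v"
  shows "cmod mu \<le> \<theta>"
proof -
  have fT: "finite T" "T \<noteq> {}" using S y(1) finite_subset by auto
  define c where "c = Max ((\<lambda>v. cmod (y v) / x v) ` T)"
  have c: "cmod (y v) \<le> c * x v" if "v \<in> T" for v
  proof -
    have "cmod (y v) / x v \<le> c" unfolding c_def using fT that by (intro Max_ge) auto
    then show ?thesis using x(1)[of v] S that by (simp add: field_simps subset_iff)
  qed
  have "c \<in> (\<lambda>v. cmod (y v) / x v) ` T" unfolding c_def using fT by (intro Max_in) auto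
  then obtain v where v: "v \<in> T" "c = cmod (y v) / x v" by auto
  obtain u where u: "u \<in> T" "y u \<noteq> 0" using y(1) by auto
  have "0 < c * x u" using c[OF u(1)] u(2) by (meson less_le_trans zero_less_norm_iff)
  then have cpos: "0 < c" using x(1)[of u] u S by (auto simp: zero_less_mult_iff subset_iff)
  have xv: "0 < x v" "v \<in> S" using x(1) v S by auto
  have "cmod mu * cmod (y v) = cmod (\<Sum>w\<in>T. of_real (B v w) * y w)"
    using y(2)[OF v(1)] by (simp add: norm_mult)
  also have "\<dots> \<le> (\<Sum>w\<in>T. B v w * (c * x w))"
  proof (rule sum_norm_le)
    fix w assume w: "w \<in> T"
    then have "0 \<le> B v w" using B S xv by auto
    then show "cmod (of_real (B v w) * y w) \<le> B v w * (c * x w)"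
      using c[OF w] by (simp add: norm_mult mult_left_mono)
  qed
  also have "\<dots> \<le> (\<Sum>w\<in>S. B v w * (c * x w))"
    using S B x(1) cpos xv by (intro sum_mono2) (auto intro!: mult_nonneg_nonneg intro: less_imp_le)
  also have "\<dots> = c * (\<Sum>w\<in>S. B v w * x w)" by (simp add: sum_distrib_left algebra_simps)
  also have "\<dots> \<le> c * (\<theta> * x v)" using x(2) xv cpos by (intro mult_left_mono) auto
  finally have "cmod mu * (c * x v) \<le> \<theta> * (c * x v)" using v xv by (simp add: algebra_simps)
  then show ?thesis using cpos xv by simp
qed

lemma bounded_functions_convergent_subsequence:
  fixes f :: "nat \<Rightarrow> 'p \<Rightarrow> real"
  assumes "finite S" "\<And>n v. v \<in> S \<Longrightarrow> \<bar>f n v\<bar> \<le> b"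
  obtains r l where "strict_mono (r :: nat \<Rightarrow> nat)" "\<And>v. v \<in> S \<Longrightarrow> (\<lambda>n. f (r n) v) \<longlonglongrightarrow> l v"
proof -
  have "\<exists>r l. strict_mono (r :: nat \<Rightarrow> nat) \<and> (\<forall>v\<in>S. (\<lambda>n. f (r n) v) \<longlonglongrightarrow> l v)"
    using assms
  proof (induction S)
    case empty
    show ?case by (intro exI[of _ id]) (auto simp: strict_mono_def)
  next
    case (insert u S)
    have "\<exists>r l. strict_mono (r :: nat \<Rightarrow> nat) \<and> (\<forall>v\<in>S. (\<lambda>n. f (r n) v) \<longlonglongrightarrow> l v)"
      using insert.prems by (intro insert.IH) auto
    then obtain r l where r: "strict_mono (r :: nat \<Rightarrow> nat)"
      and l: "\<And>v. v \<in> S \<Longrightarrow> (\<lambda>n. f (r n) v) \<longlonglongrightarrow> l v" by blast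
    have "bounded (range (\<lambda>n. f (r n) u))"
      using insert.prems by (auto simp: bounded_iff)
    then obtain k s where s: "strict_mono (s :: nat \<Rightarrow> nat)" and k: "((\<lambda>n. f (r n) u) \<circ> s) \<longlonglongrightarrow> k"
      using bounded_imp_convergent_subsequence by blast
    have "(\<lambda>n. f (r (s n)) v) \<longlonglongrightarrow> l v" if "v \<in> S" for v
      using LIMSEQ_subseq_LIMSEQ[OF l[OF that] s] by (simp add: o_def)
    then have "\<forall>v\<in>insert u S. (\<lambda>n. f ((r \<circ> s) n) v) \<longlonglongrightarrow> (l(u := k)) v"
      using k insert.hyps by (auto simp: o_def)
    then show ?case using strict_mono_o[OF r s] by blast
  qed
  then show ?thesis using that by blast
qed

text \<open>The eigenvalue is the least \<open>\<theta>\<close> admitting a positive vector with \<open>B x \<le> \<theta> x\<close>; if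
  \<open>B x \<noteq> \<theta> x\<close> for a limiting vector \<open>x\<close>, then \<open>B x\<close> would admit a smaller \<open>\<theta>\<close>.\<close>
lemma positive_matrix_eigenvector:
  fixes B :: "'p \<Rightarrow> 'p \<Rightarrow> real"
  assumes S: "finite S" "S \<noteq> {}" and B: "\<forall>v\<in>S. \<forall>w\<in>S. 0 < B v w"
  shows "\<exists>x \<theta>. (\<forall>v\<in>S. 0 < x v) \<and> (\<Sum>v\<in>S. x v) = 1
    \<and> (\<forall>v\<in>S. (\<Sum>w\<in>S. B v w * x w) = \<theta> * x v)"
proof -
  have Bpos: "0 < (\<Sum>w\<in>S. B v w * z w)"
    if "v \<in> S" "\<And>w. w \<in> S \<Longrightarrow> 0 \<le> z w" "u \<in> S" "0 < z u" for v u z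
    using that S B by (intro sum_pos2[where i = u]) (auto intro!: mult_nonneg_nonneg intro: less_imp_le)
  define P where "P \<theta> x \<longleftrightarrow> (\<forall>v\<in>S. 0 < x v \<and> (\<Sum>w\<in>S. B v w * x w) \<le> \<theta> * x v)" for \<theta> :: real and x
  define \<Theta> where "\<Theta> = {\<theta>. \<exists>x. P \<theta> x}"
  have attained: "\<exists>u\<in>S. Max ((\<lambda>v. (\<Sum>w\<in>S. B v w * x w) / x v) ` S) = (\<Sum>w\<in>S. B u w * x w) / x u
      \<and> P (Max ((\<lambda>v. (\<Sum>w\<in>S. B v w * x w) / x v) ` S)) x"
    if x: "\<forall>v\<in>S. 0 < x v" for x
  proof -
    let ?m = "Max ((\<lambda>v. (\<Sum>w\<in>S. B v w * x w) / x v) ` S)"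
    have "?m \<in> (\<lambda>v. (\<Sum>w\<in>S. B v w * x w) / x v) ` S" using S by (intro Max_in) auto
    moreover have "(\<Sum>w\<in>S. B v w * x w) / x v \<le> ?m" if "v \<in> S" for v
      using S that by (intro Max_ge) auto
    ultimately show ?thesis using x by (auto simp: P_def field_simps)
  qed
  have "\<Theta> \<noteq> {}" using attained[of "\<lambda>_. 1"] by (auto simp: \<Theta>_def)
  have pos: "0 < \<theta>" if "P \<theta> x" for \<theta> x
  proof -
    obtain u where u: "u \<in> S" using S by auto
    have "0 < (\<Sum>w\<in>S. B u w * x w)" using that u by (intro Bpos[of u x u]) (auto simp: P_def less_imp_le)
    also have "\<dots> \<le> \<theta> * x u" using that u by (auto simp: P_def)
    finally show ?thesis using that u by (auto simp: P_def zero_less_mult_iff)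
  qed
  have bdd: "bdd_below \<Theta>" using pos by (intro bdd_belowI[of _ 0]) (auto simp: \<Theta>_def less_imp_le)
  define \<theta> where "\<theta> = Inf \<Theta>"
  have "\<theta> \<ge> 0" unfolding \<theta>_def using \<open>\<Theta> \<noteq> {}\<close> pos by (intro cInf_greatest) (auto simp: \<Theta>_def less_imp_le)
  have "\<exists>t x. P t x \<and> (\<Sum>v\<in>S. x v) = 1 \<and> t < \<theta> + 1 / real (Suc n)" for n
  proof -
    have "Inf \<Theta> < \<theta> + 1 / real (Suc n)" by (simp add: \<theta>_def)
    then obtain t where "t \<in> \<Theta>" and t: "t < \<theta> + 1 / real (Suc n)"
      using cInf_lessD[OF \<open>\<Theta> \<noteq> {}\<close>, of "\<theta> + 1 / real (Suc n)"] by blast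
    then obtain x where x: "P t x" by (auto simp: \<Theta>_def)
    define s where "s = (\<Sum>v\<in>S. x v)"
    have s: "0 < s" unfolding s_def using x S by (intro sum_pos) (auto simp: P_def)
    have "P t (\<lambda>v. x v / s)"
      unfolding P_def
    proof (intro ballI conjI)
      fix v assume v: "v \<in> S"
      show "0 < x v / s" using x s v by (auto simp: P_def)
      have "(\<Sum>w\<in>S. B v w * (x w / s)) = (\<Sum>w\<in>S. B v w * x w) / s"
        by (simp add: sum_divide_distrib)
      also have "\<dots> \<le> t * x v / s" using x s v by (intro divide_right_mono) (auto simp: P_def)
      finally show "(\<Sum>w\<in>S. B v w * (x w / s)) \<le> t * (x v / s)" by simp
    qed
    moreover have "(\<Sum>v\<in>S. x v / s) = 1" using s by (simp flip: sum_divide_distrib s_def)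
    ultimately show ?thesis using t by blast
  qed
  then obtain t f where f: "\<And>n. P (t n) (f n)" "\<And>n. (\<Sum>v\<in>S. f n v) = 1"
    and t: "\<And>n. t n < \<theta> + 1 / real (Suc n)" by metis
  have "\<bar>f n v\<bar> \<le> 1" if "v \<in> S" for n v
  proof -
    have "f n v \<le> (\<Sum>v\<in>S. f n v)"
      using S that f(1)[of n] by (intro member_le_sum) (auto simp: P_def less_imp_le)
    then show ?thesis using f(1)[of n] f(2)[of n] that by (auto simp: P_def abs_if)
  qed
  then obtain r x where r: "strict_mono (r :: nat \<Rightarrow> nat)"
    and x: "\<And>v. v \<in> S \<Longrightarrow> (\<lambda>n. f (r n) v) \<longlonglongrightarrow> x v"
    using bounded_functions_convergent_subsequence[of S f 1] S by metis
  have x0: "0 \<le> x v" if "v \<in> S" for v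
    using x[OF that] f(1) that by (intro LIMSEQ_le_const[of _ "x v" 0]) (auto simp: P_def less_imp_le)
  have "(\<lambda>n. \<Sum>v\<in>S. f (r n) v) \<longlonglongrightarrow> (\<Sum>v\<in>S. x v)" by (intro tendsto_sum x)
  then have x1: "(\<Sum>v\<in>S. x v) = 1" using f(2) by (simp add: LIMSEQ_const_iff)
  have xB: "(\<Sum>w\<in>S. B v w * x w) \<le> \<theta> * x v" if v: "v \<in> S" for v
  proof (rule LIMSEQ_le)
    show "(\<lambda>n. \<Sum>w\<in>S. B v w * f (r n) w) \<longlonglongrightarrow> (\<Sum>w\<in>S. B v w * x w)" by (intro tendsto_intros x)
    have "(\<lambda>n. \<theta> + 1 / real (Suc n)) \<longlonglongrightarrow> \<theta> + 0"
      by (intro tendsto_intros LIMSEQ_Suc[OF lim_1_over_n])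
    then have "(\<lambda>n. \<theta> + 1 / real (Suc (r n))) \<longlonglongrightarrow> \<theta>"
      using LIMSEQ_subseq_LIMSEQ[OF _ r] by (fastforce simp: o_def)
    then show "(\<lambda>n. (\<theta> + 1 / real (Suc (r n))) * f (r n) v) \<longlonglongrightarrow> \<theta> * x v"
      by (intro tendsto_intros x v)
    show "\<exists>N. \<forall>n\<ge>N. (\<Sum>w\<in>S. B v w * f (r n) w) \<le> (\<theta> + 1 / real (Suc (r n))) * f (r n) v"
    proof (intro exI allI impI)
      fix n
      have "(\<Sum>w\<in>S. B v w * f (r n) w) \<le> t (r n) * f (r n) v" using f(1) v by (auto simp: P_def)
      also have "\<dots> \<le> (\<theta> + 1 / real (Suc (r n))) * f (r n) v"
        using f(1)[of "r n"] v t[of "r n"] by (intro mult_right_mono) (auto simp: P_def less_imp_le)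
      finally show "(\<Sum>w\<in>S. B v w * f (r n) w) \<le> (\<theta> + 1 / real (Suc (r n))) * f (r n) v" .
    qed
  qed
  have "\<exists>u\<in>S. 0 < x u"
    using x0 x1 by (metis less_eq_real_def sum.neutral zero_neq_one)
  then obtain u where u: "u \<in> S" "0 < x u" by auto
  have xpos: "0 < x v" if "v \<in> S" for v
  proof -
    have "0 < \<theta> * x v" using Bpos[of v x u, OF that x0 u] xB[OF that] by simp
    then show ?thesis using \<open>\<theta> \<ge> 0\<close> by (auto simp: zero_less_mult_iff)
  qed
  have "(\<Sum>w\<in>S. B v w * x w) = \<theta> * x v" if "v \<in> S" for v
  proof (rule ccontr)
    assume "(\<Sum>w\<in>S. B v w * x w) \<noteq> \<theta> * x v"
    then have v: "v \<in> S" "0 < \<theta> * x v - (\<Sum>w\<in>S. B v w * x w)" using that xB[OF that] by auto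
    define y where "y v = (\<Sum>w\<in>S. B v w * x w)" for v
    have y: "0 < y v" if "v \<in> S" for v unfolding y_def by (rule Bpos[of v x u, OF that x0 u])
    \<comment> \<open>\<open>\<theta> x - y\<close> is nonnegative and nonzero at \<open>v\<close>;
      as all entries of \<open>B\<close> are positive, \<open>B\<close> makes it positive
      everywhere. The strict inequality at one index thus spreads to all.\<close>
    have ylt: "(\<Sum>w\<in>S. B u w * y w) < \<theta> * y u" if "u \<in> S" for u
    proof -
      have "0 < (\<Sum>w\<in>S. B u w * (\<theta> * x w - y w))"
        using that v xB by (intro Bpos[of u _ v]) (auto simp: y_def)
      also have "\<dots> = \<theta> * y u - (\<Sum>w\<in>S. B u w * y w)"
        by (simp add: y_def[of u] sum_subtractf sum_distrib_left algebra_simps)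
      finally show ?thesis by simp
    qed
    obtain u where "u \<in> S" "P ((\<Sum>w\<in>S. B u w * y w) / y u) y"
      using attained[of y] y by auto
    then have "\<theta> \<le> (\<Sum>w\<in>S. B u w * y w) / y u"
      unfolding \<theta>_def using bdd by (intro cInf_lower) (auto simp: \<Theta>_def)
    then show False using ylt[OF \<open>u \<in> S\<close>] y[OF \<open>u \<in> S\<close>] by (simp add: field_simps)
  qed
  then show ?thesis using xpos x1 by blast
qed

definition eigenvalues_on :: "'p set \<Rightarrow> ('p \<Rightarrow> 'p \<Rightarrow> real) \<Rightarrow> complex set" where
  "eigenvalues_on S B = {mu. \<exists>x::'p \<Rightarrow> complex. (\<exists>v\<in>S. x v \<noteq> 0) \<and>
      (\<forall>v\<in>S. (\<Sum>w\<in>S. of_real (B v w) * x w) = mu * x v)}"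

lemma spec_rad_eq: "spec_rad S B = Sup (cmod ` eigenvalues_on S B)"
  unfolding spec_rad_def eigenvalues_on_def by (intro arg_cong[of _ _ Sup]) auto

lemma real_eigenvalue:
  fixes x :: "'p \<Rightarrow> real"
  assumes "v \<in> S" "x v \<noteq> 0" "\<And>v. v \<in> S \<Longrightarrow> (\<Sum>w\<in>S. B v w * x w) = \<theta> * x v"
  shows "of_real \<theta> \<in> eigenvalues_on S B"
  unfolding eigenvalues_on_def
  using assms by (intro CollectI exI[of _ "\<lambda>w. of_real (x w)"])
    (auto simp flip: of_real_mult of_real_sum)

text \<open>The general case follows by letting \<open>\<epsilon> \<rightarrow> 0\<close> in the positive matrices \<open>B + \<epsilon>\<close>.\<close>
lemma Perron_Frobenius_aux:
  fixes B :: "'p \<Rightarrow> 'p \<Rightarrow> real"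
  assumes S: "finite S" "S \<noteq> {}" and B: "\<forall>v\<in>S. \<forall>w\<in>S. 0 \<le> B v w"
  shows "\<exists>x \<theta>. (\<forall>v\<in>S. 0 \<le> x v) \<and> (\<Sum>v\<in>S. x v) = 1
    \<and> (\<forall>v\<in>S. (\<Sum>w\<in>S. B v w * x w) = \<theta> * x v) \<and> 0 \<le> \<theta>
    \<and> (\<forall>T mu. T \<subseteq> S \<longrightarrow> mu \<in> eigenvalues_on T B \<longrightarrow> cmod mu \<le> \<theta>)"
proof -
  define e where "e n = 1 / real (Suc n)" for n
  have e: "0 < e n" for n by (simp add: e_def)
  have e0: "e \<longlonglongrightarrow> 0" unfolding e_def by (rule LIMSEQ_Suc[OF lim_1_over_n])
  have "\<exists>x t. (\<forall>v\<in>S. 0 < x v \<and> (\<Sum>w\<in>S. (B v w + e n) * x w) = t * x v) \<and> (\<Sum>v\<in>S. x v) = 1" for n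
  proof -
    have "\<forall>v\<in>S. \<forall>w\<in>S. 0 < B v w + e n" using B e by (auto intro: add_nonneg_pos)
    then show ?thesis using positive_matrix_eigenvector[OF S, of "\<lambda>v w. B v w + e n"] by blast
  qed
  then obtain f t where f: "\<And>n v. v \<in> S \<Longrightarrow> 0 < f n v" "\<And>n. (\<Sum>v\<in>S. f n v) = 1"
    and t: "\<And>n v. v \<in> S \<Longrightarrow> (\<Sum>w\<in>S. (B v w + e n) * f n w) = t n * f n v" by metis
  have "\<bar>f n v\<bar> \<le> 1" if "v \<in> S" for n v
  proof -
    have "f n v \<le> (\<Sum>v\<in>S. f n v)"
      using S that f(1) by (intro member_le_sum) (auto simp: less_imp_le)
    then show ?thesis using f(1)[of v n] f(2)[of n] that by auto
  qed
  then obtain r x where r: "strict_mono (r :: nat \<Rightarrow> nat)"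
    and x: "\<And>v. v \<in> S \<Longrightarrow> (\<lambda>n. f (r n) v) \<longlonglongrightarrow> x v"
    using bounded_functions_convergent_subsequence[of S f 1] S by metis
  have er: "(\<lambda>n. e (r n)) \<longlonglongrightarrow> 0" using LIMSEQ_subseq_LIMSEQ[OF e0 r] by (simp add: o_def)
  have x0: "0 \<le> x v" if "v \<in> S" for v
    using x[OF that] f(1) that by (intro LIMSEQ_le_const[of _ "x v" 0]) (auto simp: less_imp_le)
  have "(\<lambda>n. \<Sum>v\<in>S. f (r n) v) \<longlonglongrightarrow> (\<Sum>v\<in>S. x v)" by (intro tendsto_sum x)
  then have x1: "(\<Sum>v\<in>S. x v) = 1" using f(2) by (simp add: LIMSEQ_const_iff)
  \<comment> \<open>For a vector with entries adding up to 1, the eigenvalue is the sum of the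
    entries of its image. The eigenvalues therefore converge along with the vectors.\<close>
  define \<theta> where "\<theta> = (\<Sum>v\<in>S. \<Sum>w\<in>S. B v w * x w)"
  have "t n = (\<Sum>v\<in>S. \<Sum>w\<in>S. (B v w + e n) * f n w)" for n
    using f(2)[of n] by (simp add: t flip: sum_distrib_left)
  then have "(\<lambda>n. t (r n)) \<longlonglongrightarrow> (\<Sum>v\<in>S. \<Sum>w\<in>S. (B v w + 0) * x w)"
    by (simp only:) (intro tendsto_intros x er)
  then have tr: "(\<lambda>n. t (r n)) \<longlonglongrightarrow> \<theta>" by (simp add: \<theta>_def)
  have eig: "(\<Sum>w\<in>S. B v w * x w) = \<theta> * x v" if "v \<in> S" for v
  proof (rule LIMSEQ_unique)
    have "(\<lambda>n. \<Sum>w\<in>S. (B v w + e (r n)) * f (r n) w) \<longlonglongrightarrow> (\<Sum>w\<in>S. (B v w + 0) * x w)"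
      by (intro tendsto_intros x er)
    then show "(\<lambda>n. t (r n) * f (r n) v) \<longlonglongrightarrow> (\<Sum>w\<in>S. B v w * x w)"
      by (simp add: t[OF that])
    show "(\<lambda>n. t (r n) * f (r n) v) \<longlonglongrightarrow> \<theta> * x v" by (intro tendsto_intros tr x that)
  qed
  have "0 \<le> \<theta>" unfolding \<theta>_def using B x0 by (intro sum_nonneg mult_nonneg_nonneg) auto
  moreover have "cmod mu \<le> \<theta>" if T: "T \<subseteq> S" "mu \<in> eigenvalues_on T B" for T mu
  proof -
    obtain y where y: "\<exists>v\<in>T. y v \<noteq> 0" "\<forall>v\<in>T. (\<Sum>w\<in>T. of_real (B v w) * y w) = mu * y v"
      using T(2) unfolding eigenvalues_on_def by blast
    \<comment> \<open>The comparison uses \<open>f n\<close>, which is positive everywhere and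
      subinvariant for the smaller matrix \<open>B\<close>; the limit \<open>x\<close> may have
      zeros.\<close>
    have "cmod mu \<le> t n" for n
    proof (rule subinvariant_eigenvalue_le[of S T B "f n" "t n" y mu])
      fix v assume v: "v \<in> S"
      have "(\<Sum>w\<in>S. B v w * f n w) \<le> (\<Sum>w\<in>S. (B v w + e n) * f n w)"
        using e f(1) by (intro sum_mono mult_right_mono) (auto intro: less_imp_le)
      then show "(\<Sum>w\<in>S. B v w * f n w) \<le> t n * f n v" using t[OF v] by simp
    qed (use S T(1) B f(1) y in auto)
    then show ?thesis using tr by (intro LIMSEQ_le_const[OF tr]) auto
  qed
  ultimately show ?thesis using x0 x1 eig by blast
qed

text \<open>The supremum in \<open>spec_rad\<close> is a maximum, attained at a nonnegative
  eigenvector. Letting \<open>T\<close> range over the subsets of \<open>S\<close> in the last claim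
  compares the blocks of \<open>B\<close> with \<open>B\<close> itself.\<close>

lemma Perron_Frobenius:
  fixes B :: "'p \<Rightarrow> 'p \<Rightarrow> real"
  assumes S: "finite S" "S \<noteq> {}" and B: "\<forall>v\<in>S. \<forall>w\<in>S. 0 \<le> B v w"
  shows "\<exists>x. (\<forall>v\<in>S. 0 \<le> x v) \<and> (\<Sum>v\<in>S. x v) = 1
      \<and> (\<forall>v\<in>S. (\<Sum>w\<in>S. B v w * x w) = spec_rad S B * x v)"
    and "of_real (spec_rad S B) \<in> eigenvalues_on S B"
    and "\<And>T mu. T \<subseteq> S \<Longrightarrow> mu \<in> eigenvalues_on T B \<Longrightarrow> cmod mu \<le> spec_rad S B"
proof -
  obtain x \<theta> where x: "\<forall>v\<in>S. 0 \<le> x v" "(\<Sum>v\<in>S. x v) = 1"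
    "\<forall>v\<in>S. (\<Sum>w\<in>S. B v w * x w) = \<theta> * x v" "0 \<le> \<theta>"
    "\<forall>T mu. T \<subseteq> S \<longrightarrow> mu \<in> eigenvalues_on T B \<longrightarrow> cmod mu \<le> \<theta>"
    using Perron_Frobenius_aux[OF S B] by (elim exE conjE) (rule that)
  obtain v where "v \<in> S" "x v \<noteq> 0" using x(2) by (metis sum.neutral zero_neq_one)
  then have e: "of_real \<theta> \<in> eigenvalues_on S B" using x(3) by (intro real_eigenvalue[of v S x]) auto
  then have "\<theta> \<in> cmod ` eigenvalues_on S B" using x(4) by (intro image_eqI[of _ _ "of_real \<theta>"]) auto
  moreover have "y \<le> \<theta>" if "y \<in> cmod ` eigenvalues_on S B" for y using x(5) that by auto
  ultimately have \<theta>: "spec_rad S B = \<theta>" unfolding spec_rad_eq by (rule cSup_eq_maximum)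
  show "\<exists>x. (\<forall>v\<in>S. 0 \<le> x v) \<and> (\<Sum>v\<in>S. x v) = 1
      \<and> (\<forall>v\<in>S. (\<Sum>w\<in>S. B v w * x w) = spec_rad S B * x v)"
    unfolding \<theta> using x by (intro exI[of _ x]) simp
  show "of_real (spec_rad S B) \<in> eigenvalues_on S B"
    "\<And>T mu. T \<subseteq> S \<Longrightarrow> mu \<in> eigenvalues_on T B \<Longrightarrow> cmod mu \<le> spec_rad S B"
    unfolding \<theta> using e x(5) by blast+
qed

text \<open>\<open>T\<close> has to be nonempty: over the empty set, \<open>spec_rad\<close> is the
  supremum of no values at all. This is also why empty remainders of a closure are treated
  separately throughout.\<close>

lemma spec_rad_mono:
  assumes S: "finite S" and B: "\<forall>v\<in>S. \<forall>w\<in>S. 0 \<le> B v w" and T: "T \<noteq> {}" "T \<subseteq> S"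
  shows "spec_rad T B \<le> spec_rad S B"
proof -
  have "of_real (spec_rad T B) \<in> eigenvalues_on T B"
    using T S B by (intro Perron_Frobenius(2)) (auto intro: finite_subset)
  then have "cmod (of_real (spec_rad T B)) \<le> spec_rad S B"
    using T S B by (intro Perron_Frobenius(3)) auto
  then show ?thesis by simp
qed

lemma real_eigenvalue_le_spec_rad:
  fixes x :: "'p \<Rightarrow> real"
  assumes S: "finite S" and B: "\<forall>v\<in>S. \<forall>w\<in>S. 0 \<le> B v w"
    and x: "v \<in> S" "x v \<noteq> 0" "\<And>v. v \<in> S \<Longrightarrow> (\<Sum>w\<in>S. B v w * x w) = \<theta> * x v"
  shows "\<theta> \<le> spec_rad S B"
proof -
  have "of_real \<theta> \<in> eigenvalues_on S B" using x by (rule real_eigenvalue)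
  moreover have "S \<noteq> {}" using x(1) by auto
  ultimately have "cmod (of_real \<theta>) \<le> spec_rad S B"
    using S B by (intro Perron_Frobenius(3)) auto
  then show ?thesis by simp
qed

lemma spec_rad_le_subinvariant:
  assumes S: "finite S" "S \<noteq> {}" and B: "\<forall>v\<in>S. \<forall>w\<in>S. 0 \<le> B v w"
    and x: "\<And>v. v \<in> S \<Longrightarrow> 0 < x v" "\<And>v. v \<in> S \<Longrightarrow> (\<Sum>w\<in>S. B v w * x w) \<le> \<theta> * x v"
  shows "spec_rad S B \<le> \<theta>"
proof -
  have "of_real (spec_rad S B) \<in> eigenvalues_on S B" by (rule Perron_Frobenius(2)[OF S B])
  then obtain y where "\<exists>v\<in>S. y v \<noteq> (0::complex)"
    "\<And>v. v \<in> S \<Longrightarrow> (\<Sum>w\<in>S. of_real (B v w) * y w) = of_real (spec_rad S B) * y v"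
    by (auto simp: eigenvalues_on_def)
  then have "cmod (of_real (spec_rad S B)) \<le> \<theta>"
    by (intro subinvariant_eigenvalue_le[OF S(1) order_refl B x])
  then show ?thesis by simp
qed

text \<open>A positive eigenvector is subinvariant for its own eigenvalue, so no other eigenvalue is
  larger in modulus. This reads off the radii of the blocks of A_i and of A_F on a component from
  one vector.\<close>

lemma spec_rad_eqI:
  assumes S: "finite S" "S \<noteq> {}" and B: "\<forall>v\<in>S. \<forall>w\<in>S. 0 \<le> B v w"
    and x: "\<And>v. v \<in> S \<Longrightarrow> 0 < x v" "\<And>v. v \<in> S \<Longrightarrow> (\<Sum>w\<in>S. B v w * x w) = \<theta> * x v"
  shows "spec_rad S B = \<theta>"
proof (rule antisym)
  show "spec_rad S B \<le> \<theta>" using x by (intro spec_rad_le_subinvariant[OF S B, of x]) auto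
  obtain v where v: "v \<in> S" using S by auto
  show "\<theta> \<le> spec_rad S B"
    using x(1)[OF v] by (intro real_eigenvalue_le_spec_rad[OF S(1) B v _ x(2)]) auto
qed

text \<open>By finiteness the largest ratio \<open>m\<close> is still below \<open>\<theta>\<close>,
  and \<open>x\<close> is subinvariant for \<open>m\<close>.\<close>

lemma spec_rad_less:
  assumes S: "finite S" "S \<noteq> {}" and B: "\<forall>v\<in>S. \<forall>w\<in>S. 0 \<le> B v w"
    and x: "\<And>v. v \<in> S \<Longrightarrow> 0 < x v" "\<And>v. v \<in> S \<Longrightarrow> (\<Sum>w\<in>S. B v w * x w) < \<theta> * x v"
  shows "spec_rad S B < \<theta>"
proof -
  define m where "m = Max ((\<lambda>v. (\<Sum>w\<in>S. B v w * x w) / x v) ` S)"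
  have "m \<in> (\<lambda>v. (\<Sum>w\<in>S. B v w * x w) / x v) ` S" unfolding m_def using S by (intro Max_in) auto
  then have "m < \<theta>" using x by (auto simp: field_simps)
  moreover have "(\<Sum>w\<in>S. B v w * x w) / x v \<le> m" if "v \<in> S" for v
    unfolding m_def using S that by (intro Max_ge) auto
  then have "spec_rad S B \<le> m"
    using x(1) by (intro spec_rad_le_subinvariant[OF S B x(1)]) (auto simp: field_simps)
  ultimately show ?thesis by simp
qed

text \<open>Subtract from \<open>y\<close> the largest multiple of \<open>x\<close> that stays below
  it. The difference is nonnegative, solves the same equation and vanishes at some \<open>u\<close>;
  row \<open>u\<close> being positive, it vanishes everywhere.\<close>

lemma positive_matrix_eigenvector_unique:
  fixes x y :: "'p \<Rightarrow> real"
  assumes S: "finite S" and B: "\<forall>v\<in>S. \<forall>w\<in>S. 0 < B v w"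
    and x: "\<And>v. v \<in> S \<Longrightarrow> 0 < x v" "\<And>v. v \<in> S \<Longrightarrow> (\<Sum>w\<in>S. B v w * x w) = \<theta> * x v"
    and y: "\<And>v. v \<in> S \<Longrightarrow> (\<Sum>w\<in>S. B v w * y w) = \<theta> * y v"
  obtains c where "\<And>v. v \<in> S \<Longrightarrow> y v = c * x v"
proof (cases "S = {}")
  case False
  define c where "c = Min ((\<lambda>v. y v / x v) ` S)"
  have "c \<in> (\<lambda>v. y v / x v) ` S" unfolding c_def using S False by (intro Min_in) auto
  then obtain u where u: "u \<in> S" "y u = c * x u" using x(1) by force
  have c: "0 \<le> y v - c * x v" if "v \<in> S" for v
  proof -
    have "c \<le> y v / x v" unfolding c_def using S that by (intro Min_le) auto
    then show ?thesis using x(1)[OF that] by (simp add: field_simps)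
  qed
  have "(\<Sum>w\<in>S. B u w * (y w - c * x w)) = (\<Sum>w\<in>S. B u w * y w) - c * (\<Sum>w\<in>S. B u w * x w)"
    by (simp add: algebra_simps sum_subtractf sum_distrib_left)
  also have "\<dots> = 0" using x(2) y u by simp
  finally have "\<forall>w\<in>S. B u w * (y w - c * x w) = 0"
    using S B u c by (subst (asm) sum_nonneg_eq_0_iff) (auto intro!: mult_nonneg_nonneg intro: less_imp_le)
  then have "y v = c * x v" if "v \<in> S" for v using B u(1) that by force
  then show ?thesis by (rule that)
qed (use that in auto)

section \<open>Paths in a k-graph\<close>

lemma multi_index_induct [case_names zero add]:
  fixes n :: "'k::finite \<Rightarrow> nat"
  assumes "P 0" "\<And>i n. P n \<Longrightarrow> P (unitv i + n)"
  shows "P n"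
proof (induction "\<Sum>i\<in>UNIV. n i" arbitrary: n)
  case 0
  then have "n = 0" by (auto simp: fun_eq_iff)
  then show ?case using assms(1) by (simp add: zero_fun_def)
next
  case (Suc m)
  then obtain i where i: "n i > 0" by (metis gr0I sum.neutral zero_neq_one nat.distinct(1))
  define n' where "n' = n(i := n i - 1)"
  have n: "n = unitv i + n'" using i by (auto simp: n'_def unitv_def fun_eq_iff)
  have "(\<Sum>i\<in>UNIV. n i) = 1 + (\<Sum>i\<in>UNIV. n' i)"
    unfolding n by (simp add: sum.distrib unitv_def)
  then have "P n'" using Suc by simp
  then show ?case unfolding n by (rule assms)
qed

lemma coord_list: "distinct (coord_list :: 'k::finite list)" "set (coord_list :: 'k list) = UNIV"
proof -
  have "\<exists>xs::'k list. distinct xs \<and> set xs = UNIV" using finite_distinct_list[OF finite_class.finite_UNIV] by blast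
  then have "distinct (coord_list :: 'k list) \<and> set (coord_list :: 'k list) = UNIV"
    unfolding coord_list_def by (rule someI_ex)
  then show "distinct (coord_list :: 'k list)" "set (coord_list :: 'k list) = UNIV" by auto
qed

definition mpower :: "('k::finite \<Rightarrow> real) \<Rightarrow> ('k \<Rightarrow> nat) \<Rightarrow> real" where
  "mpower q n = (\<Prod>i\<in>UNIV. q i ^ n i)"

lemma mpower_add: "mpower q (m + n) = mpower q m * mpower q n"
  by (simp add: mpower_def power_add prod.distrib)

lemma mpower_0 [simp]: "mpower q 0 = 1"
  by (simp add: mpower_def)

lemma mpower_unitv [simp]: "mpower q (unitv i) = q i"
  by (simp add: mpower_def unitv_def prod.If_cases if_distrib cong: if_cong)

lemma mpower_pos: "(\<And>i. 0 < q i) \<Longrightarrow> 0 < mpower q n"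
  by (simp add: mpower_def prod_pos)

locale kgraph =
  fixes L :: "'p set" and d :: "'p \<Rightarrow> 'k::finite \<Rightarrow> nat" and rg src :: "'p \<Rightarrow> 'p"
    and cmp :: "'p \<Rightarrow> 'p \<Rightarrow> 'p"
  assumes is_kgraph: "is_kgraph L d rg src cmp"
    and kg_finite: "kg_finite L d"
    and no_sources: "no_sources L d rg"
begin

abbreviation "V \<equiv> vert L d"
abbreviation "pths \<equiv> paths L d rg src"

lemma rg_src [simp]:
  assumes "l \<in> L"
  shows "rg l \<in> L" "src l \<in> L" "rg (rg l) = rg l" "src (rg l) = rg l" "rg (src l) = src l" "src (src l) = src l"
  using is_kgraph assms unfolding is_kgraph_def by blast+

lemma cmp [simp]:
  assumes "l \<in> L" "m \<in> L" "src l = rg m"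
  shows "cmp l m \<in> L" "rg (cmp l m) = rg l" "src (cmp l m) = src m" "d (cmp l m) = d l + d m"
  using is_kgraph assms unfolding is_kgraph_def by blast+

lemma cmp_id [simp]:
  assumes "l \<in> L"
  shows "cmp (rg l) l = l" "cmp l (src l) = l"
  using is_kgraph assms unfolding is_kgraph_def by blast+

lemma factorisation_ex1:
  assumes "l \<in> L" "d l = m + n"
  shows "\<exists>!p. fst p \<in> L \<and> snd p \<in> L \<and> src (fst p) = rg (snd p) \<and> d (fst p) = m \<and> d (snd p) = n
              \<and> cmp (fst p) (snd p) = l"
  using is_kgraph assms unfolding is_kgraph_def by blast

lemma factorisation:
  assumes "l \<in> L" "d l = m + n"
  obtains a b where "a \<in> L" "b \<in> L" "src a = rg b" "d a = m" "d b = n" "l = cmp a b"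
  using factorisation_ex1[OF assms] by (metis prod.collapse)

lemma cmp_cancel:
  assumes "a \<in> L" "b \<in> L" "src a = rg b" "a' \<in> L" "b' \<in> L" "src a' = rg b'"
    and "d a = d a'" "cmp a b = cmp a' b'"
  shows "a = a'" "b = b'"
proof -
  have e: "d (cmp a b) = d a + d b" "d (cmp a' b') = d a' + d b'"
    using cmp(4)[OF assms(1-3)] cmp(4)[OF assms(4-6)] .
  then have db: "d b' = d b" using assms(7,8) by (metis add_left_cancel)
  have "\<exists>!p. fst p \<in> L \<and> snd p \<in> L \<and> src (fst p) = rg (snd p) \<and> d (fst p) = d a \<and> d (snd p) = d b
              \<and> cmp (fst p) (snd p) = cmp a b"
    by (intro factorisation_ex1 cmp(1) e(1) assms)
  then have "(a, b) = (a', b')"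
    by (rule ex1E) (metis assms db fst_conv snd_conv)
  then show "a = a'" "b = b'" by auto
qed

lemma d_rg_src [simp]:
  assumes "l \<in> L"
  shows "d (rg l) = 0" "d (src l) = 0"
proof -
  have "d l = d (rg l) + d l" "d l = d l + d (src l)" using cmp(4)[of "rg l" l] cmp(4)[of l "src l"] assms by auto
  then show "d (rg l) = 0" "d (src l) = 0" by (metis add_cancel_left_right add_cancel_right_right add.commute)+
qed

lemma rg_src_V [simp]: "l \<in> L \<Longrightarrow> rg l \<in> V" "l \<in> L \<Longrightarrow> src l \<in> V"
  by (auto simp: vert_def)

lemma finite_degree: "finite {l\<in>L. d l = n}"
  using kg_finite by (simp add: kg_finite_def)

lemma finite_V [simp]: "finite V"
  using finite_degree[of 0] by (simp add: vert_def)

lemma vertI: "l \<in> L \<Longrightarrow> d l = 0 \<Longrightarrow> l \<in> V"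
  by (simp add: vert_def)

text \<open>Both \<open>cmp v (src v)\<close> and \<open>cmp (rg v) v\<close> factor
  \<open>v\<close> into morphisms of degree 0, so unique factorisation identifies \<open>v\<close>
  with its range and its source.\<close>

lemma vertD [simp]:
  assumes "v \<in> V"
  shows "v \<in> L" "d v = 0" "rg v = v" "src v = v"
proof -
  show v: "v \<in> L" "d v = 0" using assms by (auto simp: vert_def)
  have "v = rg v" by (rule cmp_cancel(1)[of v "src v" "rg v" v]) (use v in auto)
  then show "rg v = v" by simp
  show "src v = v" by (rule cmp_cancel(2)[of v "src v" "rg v" v]) (use v in auto)
qed

lemma finite_paths [simp]: "finite (pths v n w)"
  by (rule finite_subset[OF _ finite_degree[of n]]) (auto simp: paths_def)

lemma finite_range_degree [simp]: "finite {l\<in>L. rg l = v \<and> d l = n}"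
  by (rule finite_subset[OF _ finite_degree[of n]]) auto

section \<open>Path counts and powers of the vertex matrices\<close>

definition pc :: "('k \<Rightarrow> nat) \<Rightarrow> 'p \<Rightarrow> 'p \<Rightarrow> real" where
  "pc n v w = real (card (pths v n w))"

lemma pc_nonneg [simp]: "0 \<le> pc n v w" by (simp add: pc_def)

lemma pc_pos_iff: "0 < pc n v w \<longleftrightarrow> pths v n w \<noteq> {}"
  by (simp add: pc_def card_gt_0_iff)

lemma vmat_pc: "vmat L d rg src i = pc (unitv i)"
  by (simp add: vmat_def pc_def fun_eq_iff)

lemma pc_0: "v \<in> V \<Longrightarrow> pc 0 v w = mone v w"
proof -
  assume v: "v \<in> V"
  have "pths v 0 w = (if v = w then {v} else {})"
  proof (intro set_eqI iffI)
    fix l assume "l \<in> pths v 0 w"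
    then have "l \<in> V" "rg l = v" "src l = w" by (auto simp: paths_def intro: vertI)
    then show "l \<in> (if v = w then {v} else {})" by auto
  qed (use v in \<open>auto simp: paths_def split: if_splits\<close>)
  then show ?thesis by (simp add: pc_def mone_def)
qed

text \<open>Unique factorisation cuts a path of degree \<open>a + b\<close> at a unique midpoint.
  Since addition of degrees commutes, this is also the source of the commutation of the vertex
  matrices and of the independence of A^n from the order in \<open>coord_list\<close>.\<close>

lemma pc_add: "(\<Sum>u\<in>V. pc a v u * pc b u w) = pc (a + b) v w"
proof -
  have "bij_betw (\<lambda>(u, l, m). cmp l m) (SIGMA u:V. pths v a u \<times> pths u b w) (pths v (a + b) w)"
    unfolding bij_betw_def
  proof (intro conjI equalityI subsetI)
    show "inj_on (\<lambda>(u, l, m). cmp l m) (SIGMA u:V. pths v a u \<times> pths u b w)"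
    proof (rule inj_onI, clarify)
      fix u l m u' l' m'
      assume "l \<in> pths v a u" "m \<in> pths u b w" "l' \<in> pths v a u'" "m' \<in> pths u' b w" "cmp l m = cmp l' m'"
      then show "u = u' \<and> (l, m) = (l', m')"
        using cmp_cancel[of l m l' m'] by (auto simp: paths_def)
    qed
  next
    fix x assume x: "x \<in> pths v (a + b) w"
    then obtain l m where lm: "l \<in> L" "m \<in> L" "src l = rg m" "d l = a" "d m = b" "x = cmp l m"
      using factorisation[of x a b] by (auto simp: paths_def)
    then have "(src l, l, m) \<in> (SIGMA u:V. pths v a u \<times> pths u b w)"
      using x by (auto simp: paths_def)
    then show "x \<in> (\<lambda>(u, l, m). cmp l m) ` (SIGMA u:V. pths v a u \<times> pths u b w)"
      using lm(6) by force
  qed (auto simp: paths_def)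
  then have "card (SIGMA u:V. pths v a u \<times> pths u b w) = card (pths v (a + b) w)"
    by (rule bij_betw_same_card)
  then have "real (\<Sum>u\<in>V. card (pths v a u \<times> pths u b w)) = real (card (pths v (a + b) w))"
    by (subst (asm) card_SigmaI) auto
  then show ?thesis by (simp add: pc_def card_cartesian_product)
qed

lemma mpow_pc:
  assumes "v \<in> V"
  shows "mpow V (vmat L d rg src i) n v w = pc (\<lambda>j. if j = i then n else 0) v w"
  using assms
proof (induction n arbitrary: v)
  case 0
  have "(\<lambda>j. if j = i then 0 else 0) = (0 :: 'k \<Rightarrow> nat)" by auto
  then show ?case using 0 by (simp add: mpow_def pc_0)
next
  case (Suc n)
  have "mpow V (vmat L d rg src i) (Suc n) v w
      = (\<Sum>u\<in>V. pc (unitv i) v u * mpow V (vmat L d rg src i) n u w)"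
    by (simp add: mpow_def mmult_def vmat_pc)
  also have "\<dots> = (\<Sum>u\<in>V. pc (unitv i) v u * pc (\<lambda>j. if j = i then n else 0) u w)"
    by (intro sum.cong refl) (simp add: Suc.IH)
  also have "\<dots> = pc (\<lambda>j. if j = i then Suc n else 0) v w"
    unfolding pc_add by (intro arg_cong[of _ _ "\<lambda>m. pc m v w"]) (auto simp: unitv_def)
  finally show ?case .
qed

lemma vmat_pow_pc:
  assumes "v \<in> V"
  shows "vmat_pow L d rg src n v w = pc n v w"
proof -
  have "foldr (\<lambda>i M. mmult V (mpow V (vmat L d rg src i) (n i)) M) xs mone v w
      = pc (\<lambda>i. if i \<in> set xs then n i else 0) v w" if "distinct xs" "v \<in> V" for xs v
    using that
  proof (induction xs arbitrary: v)
    case Nil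
    have "(\<lambda>i. if i \<in> set [] then n i else 0) = (0 :: 'k \<Rightarrow> nat)" by auto
    then show ?case using Nil by (simp add: pc_0)
  next
    case (Cons i xs)
    have "foldr (\<lambda>i M. mmult V (mpow V (vmat L d rg src i) (n i)) M) (i # xs) mone v w
        = (\<Sum>u\<in>V. pc (\<lambda>j. if j = i then n i else 0) v u * pc (\<lambda>i. if i \<in> set xs then n i else 0) u w)"
      using Cons by (simp add: mmult_def mpow_pc)
    also have "\<dots> = pc (\<lambda>j. if j \<in> set (i # xs) then n j else 0) v w"
      unfolding pc_add using Cons.prems
      by (intro arg_cong[of _ _ "\<lambda>m. pc m v w"]) auto
    finally show ?case .
  qed
  from this[OF coord_list(1) assms] show ?thesis by (simp add: vmat_pow_def coord_list)
qed

lemma vmat_F_pc: "v \<in> V \<Longrightarrow> vmat_F L d rg src F v w = (\<Sum>a\<leftarrow>F. pc a v w)"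
  by (simp add: vmat_F_def vmat_pow_pc)

lemma vmat_F_nonneg: "v \<in> V \<Longrightarrow> 0 \<le> vmat_F L d rg src F v w"
  by (auto simp: vmat_F_pc intro!: sum_list_nonneg)

lemma vmat_F_pos_iff: "v \<in> V \<Longrightarrow> 0 < vmat_F L d rg src F v w \<longleftrightarrow> (\<exists>a\<in>set F. pths v a w \<noteq> {})"
proof -
  assume v: "v \<in> V"
  have "(\<Sum>a\<leftarrow>F. pc a v w) = 0 \<longleftrightarrow> (\<forall>a\<in>set F. pc a v w = 0)"
    by (subst sum_list_nonneg_eq_0_iff) auto
  moreover have "pc a v w \<noteq> 0 \<longleftrightarrow> pths v a w \<noteq> {}" for a
    using pc_pos_iff[of a v w] pc_nonneg[of a v w] by linarith
  ultimately show ?thesis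
    using vmat_F_nonneg[OF v, of F w] unfolding vmat_F_pc[OF v] by (metis less_eq_real_def less_irrefl)
qed

lemma sum_list_sum: "(\<Sum>x\<in>X. \<Sum>a\<leftarrow>F. f a x) = (\<Sum>a\<leftarrow>F. \<Sum>x\<in>X. f a x :: real)"
  by (induction F) (auto simp: sum.distrib)

lemma vmat_F_apply:
  assumes "v \<in> V"
  shows "(\<Sum>w\<in>V. vmat_F L d rg src F v w * x w) = (\<Sum>a\<leftarrow>F. \<Sum>w\<in>V. pc a v w * x w)"
  using assms by (simp add: vmat_F_pc sum_list_mult_const[symmetric] sum_list_sum)

lemma pc_commute_apply:
  "(\<Sum>w\<in>V. pc a v w * (\<Sum>u\<in>V. pc b w u * x u)) = (\<Sum>w\<in>V. pc b v w * (\<Sum>u\<in>V. pc a w u * x u))"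
proof -
  have "(\<Sum>w\<in>V. pc a v w * (\<Sum>u\<in>V. pc b w u * x u)) = (\<Sum>u\<in>V. pc (a + b) v u * x u)" for a b
    unfolding sum_distrib_left
    by (subst sum.swap) (simp add: mult.assoc[symmetric] pc_add flip: sum_distrib_right)
  then show ?thesis by (simp add: add.commute)
qed

lemma vmat_F_commute_apply:
  assumes "v \<in> V"
  shows "(\<Sum>w\<in>V. vmat_F L d rg src F v w * (\<Sum>u\<in>V. pc b w u * x u))
    = (\<Sum>w\<in>V. pc b v w * (\<Sum>u\<in>V. vmat_F L d rg src F w u * x u))"
proof -
  have "(\<Sum>w\<in>V. pc b v w * (\<Sum>u\<in>V. vmat_F L d rg src F w u * x u))
      = (\<Sum>w\<in>V. pc b v w * (\<Sum>a\<leftarrow>F. \<Sum>u\<in>V. pc a w u * x u))"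
    by (intro sum.cong refl) (simp add: vmat_F_apply)
  also have "\<dots> = (\<Sum>a\<leftarrow>F. \<Sum>w\<in>V. pc b v w * (\<Sum>u\<in>V. pc a w u * x u))"
    by (simp add: sum_list_const_mult[symmetric] sum_list_sum)
  also have "\<dots> = (\<Sum>a\<leftarrow>F. \<Sum>w\<in>V. pc a v w * (\<Sum>u\<in>V. pc b w u * x u))"
    by (subst pc_commute_apply) (rule refl)
  finally show ?thesis using vmat_F_apply[OF assms, of F "\<lambda>w. \<Sum>u\<in>V. pc b w u * x u"] by simp
qed

lemma joint_eigenvector:
  assumes x: "\<And>i v. v \<in> V \<Longrightarrow> (\<Sum>w\<in>V. pc (unitv i) v w * x w) = q i * x v" and v: "v \<in> V"
  shows "(\<Sum>w\<in>V. pc n v w * x w) = mpower q n * x v"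
  using v
proof (induction n arbitrary: v rule: multi_index_induct)
  case zero
  have "(\<Sum>w\<in>V. pc 0 v w * x w) = (\<Sum>w\<in>V. if v = w then x w else 0)"
    by (intro sum.cong refl) (simp only: pc_0[OF zero], simp add: mone_def)
  also have "\<dots> = mpower q 0 * x v"
    unfolding mpower_0 using zero by simp
  finally show ?case .
next
  case (add i n)
  have "(\<Sum>w\<in>V. pc (unitv i + n) v w * x w) = (\<Sum>u\<in>V. pc (unitv i) v u * (\<Sum>w\<in>V. pc n u w * x w))"
    unfolding pc_add[symmetric] sum_distrib_left sum_distrib_right
    by (subst sum.swap) (simp add: mult.assoc)
  also have "\<dots> = (\<Sum>u\<in>V. pc (unitv i) v u * (mpower q n * x u))"
    by (intro sum.cong refl) (simp add: add.IH)
  also have "\<dots> = mpower q n * (\<Sum>u\<in>V. pc (unitv i) v u * x u)"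
    by (simp add: sum_distrib_left algebra_simps)
  finally show ?case unfolding mpower_add mpower_unitv x[OF add.prems] by (simp only: ac_simps)
qed

lemma joint_eigenvector_vmat_F:
  assumes "\<And>i v. v \<in> V \<Longrightarrow> (\<Sum>w\<in>V. pc (unitv i) v w * x w) = q i * x v" and "v \<in> V"
  shows "(\<Sum>w\<in>V. vmat_F L d rg src F v w * x w) = (\<Sum>a\<leftarrow>F. mpower q a) * x v"
proof -
  have "(\<Sum>w\<in>V. pc a v w * x w) = mpower q a * x v" for a
    using assms by (intro joint_eigenvector) auto
  then show ?thesis unfolding vmat_F_apply[OF assms(2)] by (simp add: sum_list_mult_const)
qed

section \<open>Reachability and well chosen lists\<close>

definition reach :: "'p \<Rightarrow> 'p \<Rightarrow> bool" where
  "reach v w \<longleftrightarrow> (\<exists>l\<in>L. rg l = v \<and> src l = w)"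

text \<open>The positions of the positive entries of A_F for well chosen \<open>F\<close>. Off the
  diagonal it agrees with \<open>reach\<close>, since a path of degree 0 is a vertex.\<close>

definition reach1 :: "'p \<Rightarrow> 'p \<Rightarrow> bool" where
  "reach1 v w \<longleftrightarrow> (\<exists>l\<in>L. rg l = v \<and> src l = w \<and> d l \<noteq> 0)"

lemma reach_refl: "v \<in> V \<Longrightarrow> reach v v"
  by (auto simp: reach_def intro!: bexI[of _ v])

lemma reach_trans: "reach u v \<Longrightarrow> reach v w \<Longrightarrow> reach u w"
  unfolding reach_def by (metis cmp(1-3))

lemma reach1_reach: "reach1 v w \<Longrightarrow> reach v w"
  by (auto simp: reach_def reach1_def)

lemma cmp_degree_nonzero:
  assumes "l \<in> L" "m \<in> L" "src l = rg m" "d l \<noteq> 0 \<or> d m \<noteq> 0"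
  shows "reach1 (rg l) (src m)"
proof -
  have "d (cmp l m) \<noteq> 0" using assms by (auto simp: fun_eq_iff)
  then show ?thesis unfolding reach1_def using assms by (intro bexI[of _ "cmp l m"]) auto
qed

lemma reach_reach1_trans: "reach u v \<Longrightarrow> reach1 v w \<Longrightarrow> reach1 u w"
  using cmp_degree_nonzero unfolding reach_def reach1_def[of v] by metis

lemma reach1_reach_trans: "reach1 u v \<Longrightarrow> reach v w \<Longrightarrow> reach1 u w"
  using cmp_degree_nonzero unfolding reach_def reach1_def[of u v] by metis

lemma reach_cases: "reach v w \<Longrightarrow> v = w \<or> reach1 v w"
proof -
  assume "reach v w"
  then obtain l where l: "l \<in> L" "rg l = v" "src l = w" by (auto simp: reach_def)
  show ?thesis
  proof (cases "d l = 0")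
    case True
    then have "l \<in> V" using l by (intro vertI)
    then show ?thesis using l by auto
  qed (use l in \<open>auto simp: reach1_def\<close>)
qed

lemma reach_V: "reach v w \<Longrightarrow> v \<in> V" "reach v w \<Longrightarrow> w \<in> V"
  by (auto simp: reach_def)

lemma reach1_iff: "(\<exists>n. n \<noteq> 0 \<and> pths v n w \<noteq> {}) \<longleftrightarrow> reach1 v w"
  by (auto simp: reach1_def paths_def)

lemma pc_pos_reach: "0 < pc n v w \<Longrightarrow> reach v w"
  by (auto simp: pc_pos_iff paths_def reach_def)

lemma well_chosen_pos_iff:
  "well_chosen L d rg src F \<Longrightarrow> v \<in> V \<Longrightarrow> w \<in> V \<Longrightarrow> 0 < vmat_F L d rg src F v w \<longleftrightarrow> reach1 v w"
  unfolding well_chosen_def reach1_iff by blast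

text \<open>One degree for each of the finitely many pairs in \<open>reach1\<close> suffices. This
  guarantees that the choice inside \<open>xvec\<close> denotes a well chosen list.\<close>

lemma ex_well_chosen: "\<exists>F. well_chosen L d rg src F"
proof -
  have "\<forall>p\<in>{p\<in>V\<times>V. reach1 (fst p) (snd p)}. \<exists>n. n \<noteq> 0 \<and> pths (fst p) n (snd p) \<noteq> {}"
    by (auto simp: reach1_iff)
  then obtain n where n: "\<And>p. p \<in> V\<times>V \<Longrightarrow> reach1 (fst p) (snd p) \<Longrightarrow>
      n p \<noteq> 0 \<and> pths (fst p) (n p) (snd p) \<noteq> {}" by (metis (no_types, lifting) mem_Collect_eq)
  have "finite {p\<in>V\<times>V. reach1 (fst p) (snd p)}" by simp
  then obtain ps where ps: "set ps = {p\<in>V\<times>V. reach1 (fst p) (snd p)}"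
    using finite_list by blast
  have "well_chosen L d rg src (map n ps)"
    unfolding well_chosen_def reach1_iff
  proof (intro conjI ballI)
    fix a assume "a \<in> set (map n ps)"
    then show "a \<noteq> 0" using n ps by auto
  next
    fix v w assume v: "v \<in> V" and w: "w \<in> V"
    show "0 < vmat_F L d rg src (map n ps) v w \<longleftrightarrow> reach1 v w"
      unfolding vmat_F_pos_iff[OF v]
    proof
      assume "\<exists>a\<in>set (map n ps). pths v a w \<noteq> {}"
      then obtain p where "p \<in> set ps" "pths v (n p) w \<noteq> {}" by auto
      moreover then have "n p \<noteq> 0" using n ps by auto
      ultimately show "reach1 v w" unfolding reach1_iff[symmetric] by blast
    next
      assume "reach1 v w"
      then have "(v, w) \<in> set ps" "pths v (n (v, w)) w \<noteq> {}" using n[of "(v, w)"] ps v w by auto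
      then show "\<exists>a\<in>set (map n ps). pths v a w \<noteq> {}" by auto
    qed
  qed
  then show ?thesis by blast
qed

section \<open>Components\<close>

abbreviation "comps \<equiv> components L d rg src"
abbreviation "upcl \<equiv> up_closure L d rg src"

lemma comps_alt: "comps = {C. \<exists>v\<in>V. C = {w. reach v w \<and> reach w v}}"
proof -
  have "{w\<in>V. (\<exists>l\<in>L. rg l = v \<and> src l = w) \<and> (\<exists>l\<in>L. rg l = w \<and> src l = v)} = {w. reach v w \<and> reach w v}" for v
    by (auto simp: reach_def)
  then show ?thesis by (simp add: components_def)
qed

lemma comps_eq:
  assumes "C \<in> comps" "v \<in> C"
  shows "C = {w. reach v w \<and> reach w v}"
proof -
  obtain u where "C = {w. reach u w \<and> reach w u}" using assms(1) by (auto simp: comps_alt)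
  then show ?thesis using assms(2) reach_trans by blast
qed

lemma comps_subset: "C \<in> comps \<Longrightarrow> C \<subseteq> V"
  by (auto simp: comps_alt dest: reach_V)

lemma finite_comps_member: "C \<in> comps \<Longrightarrow> finite C"
  using comps_subset finite_V finite_subset by blast

lemma finite_comps: "finite comps"
  by (rule finite_subset[of _ "Pow V"]) (auto dest: comps_subset)

lemma comps_nonempty: "C \<in> comps \<Longrightarrow> C \<noteq> {}"
  by (auto simp: comps_alt dest: reach_refl)

lemma comps_reach: "C \<in> comps \<Longrightarrow> v \<in> C \<Longrightarrow> w \<in> C \<Longrightarrow> reach v w"
  using comps_eq by blast

lemma comps_disjoint: "C \<in> comps \<Longrightarrow> C' \<in> comps \<Longrightarrow> v \<in> C \<Longrightarrow> v \<in> C' \<Longrightarrow> C = C'"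
  using comps_eq by blast

lemma comp_of: "v \<in> V \<Longrightarrow> {w. reach v w \<and> reach w v} \<in> comps \<and> v \<in> {w. reach v w \<and> reach w v}"
  by (auto simp: comps_alt reach_refl)

text \<open>A path of nonzero degree inside \<open>C\<close> could be spliced between
  \<open>v\<close> and \<open>w\<close>; without one, every morphism inside \<open>C\<close> is a
  vertex, and mutual reachability leaves only \<open>v\<close>. For well chosen \<open>F\<close>,
  the block of A_F on a non-trivial component therefore has all entries positive.\<close>

lemma nontrivial_reach1:
  assumes C: "C \<in> comps" and nt: "\<not> trivial_comp L rg src C" and vw: "v \<in> C" "w \<in> C"
  shows "reach1 v w"
proof (rule ccontr)
  assume n: "\<not> reach1 v w"
  have d0: "d l = 0" if l: "l \<in> L" "rg l \<in> C" "src l \<in> C" for l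
  proof (rule ccontr)
    assume "d l \<noteq> 0"
    then have "reach1 (rg l) (src l)" using l by (auto simp: reach1_def)
    then have "reach1 v (src l)" using comps_reach[OF C vw(1) l(2)] reach_reach1_trans by blast
    then show False using comps_reach[OF C l(3) vw(2)] reach1_reach_trans n by blast
  qed
  have "{l\<in>L. rg l \<in> C \<and> src l \<in> C} = {v}"
  proof (intro equalityI subsetI)
    fix l assume "l \<in> {l\<in>L. rg l \<in> C \<and> src l \<in> C}"
    then have l: "l \<in> L" "rg l \<in> C" "src l \<in> C" by auto
    have "l \<in> V" by (rule vertI[OF l(1) d0[OF l]])
    then have "l \<in> C" using l(2) by simp
    obtain m where m: "m \<in> L" "rg m = v" "src m = l"
      using comps_reach[OF C vw(1) \<open>l \<in> C\<close>] by (auto simp: reach_def)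
    then have "m \<in> V" using d0[of m] vw \<open>l \<in> C\<close> by (intro vertI) auto
    then show "l \<in> {v}" using m by auto
  qed (use vw comps_subset[OF C] in auto)
  then show False using nt by (auto simp: trivial_comp_def)
qed

lemma reach1_nontrivial:
  assumes C: "C \<in> comps" and "v \<in> C" "w \<in> C" "reach1 v w"
  shows "\<not> trivial_comp L rg src C"
proof
  assume "trivial_comp L rg src C"
  then obtain u where u: "{l\<in>L. rg l \<in> C \<and> src l \<in> C} = {u}" by (auto simp: trivial_comp_def)
  obtain l where l: "l \<in> L" "rg l = v" "src l = w" "d l \<noteq> 0" using assms by (auto simp: reach1_def)
  have "v \<in> V" using assms comps_subset by auto
  then have "l \<in> {u}" "v \<in> {u}" using l assms(2,3) unfolding u[symmetric] by auto
  then show False using l \<open>v \<in> V\<close> by auto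
qed

lemma upcl_alt: "upcl W = {w. \<exists>u\<in>W. reach w u}"
  by (auto simp: up_closure_def reach_def)

lemma upcl_subset: "upcl W \<subseteq> V"
  by (auto simp: up_closure_def)

lemma subset_upcl: "W \<subseteq> V \<Longrightarrow> W \<subseteq> upcl W"
  by (auto simp: upcl_alt intro!: reach_refl)

lemma upcl_reach: "reach v w \<Longrightarrow> w \<in> upcl W \<Longrightarrow> v \<in> upcl W"
  unfolding upcl_alt using reach_trans by blast

text \<open>\<open>C\<close> is final in its closure. So an eigenvalue equation for a vector
  supported in \<open>upcl C\<close>, read on the rows in \<open>C\<close>, is an equation for the
  block on \<open>C\<close> alone.\<close>

lemma reach_upcl_comp:
  assumes "C \<in> comps" "v \<in> C" "w \<in> upcl C" "reach v w"
  shows "w \<in> C"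
proof -
  obtain u where "u \<in> C" "reach w u" using assms by (auto simp: upcl_alt)
  then have "reach w v" using comps_reach[OF assms(1) \<open>u \<in> C\<close> assms(2)] reach_trans by blast
  then show ?thesis using comps_eq[OF assms(1,2)] assms(4) by blast
qed

lemma upcl_diff_reach1:
  assumes "C \<in> comps" "w \<in> upcl C - C" "u \<in> C"
  shows "reach1 w u"
proof -
  obtain u' where "u' \<in> C" "reach w u'" using assms by (auto simp: upcl_alt)
  then have "reach w u" using comps_reach[OF assms(1) _ assms(3)] reach_trans by blast
  then show ?thesis using reach_cases assms by blast
qed

end

context kgraph
begin

section \<open>Joint eigenvectors and harmonic components\<close>

abbreviation "AF F \<equiv> vmat_F L d rg src F"
abbreviation "Ai i \<equiv> vmat L d rg src i"

lemma Ai_nonneg [simp]: "0 \<le> Ai i v w" by (simp add: vmat_pc)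

lemma Ai_reach: "Ai i v w \<noteq> 0 \<Longrightarrow> reach v w"
  using pc_pos_reach[of "unitv i" v w] pc_nonneg[of "unitv i" v w] by (auto simp: vmat_pc less_le)

lemma AF_reach: "v \<in> V \<Longrightarrow> AF F v w \<noteq> 0 \<Longrightarrow> reach v w"
  using vmat_F_pos_iff[of v F w] vmat_F_nonneg[of v F w]
  by (auto simp: less_le paths_def reach_def)

text \<open>\<open>U\<close> bounds the support of \<open>x\<close>. It is taken to be the closure
  of \<open>C\<close> for the vectors attached to components, and the positivity set for a general
  joint eigenvector.\<close>

lemma sum_comp_row:
  assumes C: "C \<in> comps" "v \<in> C" and x: "\<And>w. w \<in> V \<Longrightarrow> w \<notin> U \<Longrightarrow> x w = 0"
    and U: "\<And>w. w \<in> U \<Longrightarrow> reach v w \<Longrightarrow> w \<in> C"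
    and M: "\<And>w. M v w \<noteq> (0::real) \<Longrightarrow> reach v w"
  shows "(\<Sum>w\<in>V. M v w * x w) = (\<Sum>w\<in>C. M v w * x w)"
  using comps_subset[OF C(1)] x U M by (intro sum.mono_neutral_right) auto

lemma eigenvector_pos:
  assumes M: "\<And>w. w \<in> V \<Longrightarrow> 0 \<le> M v w" and x: "\<And>w. w \<in> V \<Longrightarrow> (0::real) \<le> x w"
    and eq: "(\<Sum>w\<in>V. M v w * x w) = \<mu> * x v" and u: "u \<in> V" "0 < M v u" "0 < x u" and v: "0 \<le> x v"
  shows "0 < \<mu>" "0 < x v"
proof -
  have "0 < (\<Sum>w\<in>V. M v w * x w)"
    using u M x by (intro sum_pos2[OF finite_V u(1)]) auto
  then show "0 < \<mu>" "0 < x v" using v unfolding eq by (auto simp: zero_less_mult_iff)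
qed

text \<open>Restricting a row from \<open>V\<close> to \<open>D\<close> drops at least the positive
  term of the exit vertex, so \<open>x\<close> is strictly subinvariant on \<open>D\<close>. It
  serves for a closure minus its component and for the part of a support outside its final
  components.\<close>

lemma spec_rad_less_of_exit:
  assumes D: "D \<subseteq> V" "D \<noteq> {}" and x: "\<And>v. v \<in> V \<Longrightarrow> 0 \<le> x v" "\<And>v. v \<in> D \<Longrightarrow> 0 < x v"
    and eq: "\<And>v. v \<in> V \<Longrightarrow> (\<Sum>w\<in>V. AF F v w * x w) = \<mu> * x v"
    and exit: "\<And>v. v \<in> D \<Longrightarrow> \<exists>u\<in>V - D. 0 < x u \<and> 0 < AF F v u"
  shows "spec_rad D (AF F) < \<mu>"
proof (rule spec_rad_less[of D "AF F" x])
  show "finite D" using D finite_V finite_subset by blast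
  show "\<forall>v\<in>D. \<forall>w\<in>D. 0 \<le> AF F v w" using D vmat_F_nonneg by blast
  fix v assume v: "v \<in> D"
  then obtain u where u: "u \<in> V - D" "0 < x u" "0 < AF F v u" using exit by blast
  have nn: "0 \<le> AF F v w * x w" if "w \<in> V" for w
    using that v D vmat_F_nonneg x by (auto intro!: mult_nonneg_nonneg)
  have "(\<Sum>w\<in>D. AF F v w * x w) < (\<Sum>w\<in>V. AF F v w * x w)"
    using u D nn by (intro sum_strict_mono2[OF finite_V D(1) u(1)]) auto
  then show "(\<Sum>w\<in>D. AF F v w * x w) < \<mu> * x v" using eq v D by auto
qed (use D x in auto)

text \<open>The vector x^C up to scaling. The eigenvalue is a parameter, so the predicate applies to
  any list \<open>F\<close> before its radius on \<open>C\<close> is known.\<close>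

definition comp_vector :: "('k \<Rightarrow> nat) list \<Rightarrow> 'p set \<Rightarrow> real \<Rightarrow> ('p \<Rightarrow> real) \<Rightarrow> bool" where
  "comp_vector F C \<mu> x \<longleftrightarrow> (\<forall>v. 0 \<le> x v) \<and> (\<forall>v. v \<notin> upcl C \<longrightarrow> x v = 0) \<and> (\<forall>v\<in>C. 0 < x v)
    \<and> (\<forall>v\<in>V. (\<Sum>w\<in>V. AF F v w * x w) = \<mu> * x v)"

lemma comp_vector_row:
  assumes C: "C \<in> comps" "v \<in> C" and x: "\<And>v. v \<notin> upcl C \<Longrightarrow> x v = 0"
    and M: "\<And>w. M v w \<noteq> (0::real) \<Longrightarrow> reach v w"
  shows "(\<Sum>w\<in>V. M v w * x w) = (\<Sum>w\<in>C. M v w * x w)"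
  using C x M by (intro sum_comp_row[where U = "upcl C"]) (auto intro: reach_upcl_comp)

text \<open>Every vertex of the closure outside \<open>C\<close> exits into \<open>C\<close>, so the
  existence of such a vector already gives the strict drop demanded by harmonicity. Through a common
  vector the drop becomes available for \<open>F0\<close> when harmonicity was given for another
  list.\<close>

lemma comp_vector_spec_rad:
  assumes F: "well_chosen L d rg src F" and C: "C \<in> comps" and x: "comp_vector F C \<mu> x"
  shows "spec_rad C (AF F) = \<mu>" "upcl C - C \<noteq> {} \<Longrightarrow> spec_rad (upcl C - C) (AF F) < \<mu>"
proof -
  note x' = x[unfolded comp_vector_def]
  have CV: "C \<subseteq> V" by (rule comps_subset[OF C])
  show "spec_rad C (AF F) = \<mu>"
  proof (rule spec_rad_eqI[of C "AF F" x])
    fix v assume v: "v \<in> C"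
    then have "(\<Sum>w\<in>C. AF F v w * x w) = (\<Sum>w\<in>V. AF F v w * x w)"
      using CV x' by (intro comp_vector_row[OF C, symmetric]) (auto intro: AF_reach)
    then show "(\<Sum>w\<in>C. AF F v w * x w) = \<mu> * x v" using x' v CV by auto
  qed (use x' CV C comps_nonempty finite_comps_member vmat_F_nonneg in auto)
  show "spec_rad (upcl C - C) (AF F) < \<mu>" if D: "upcl C - C \<noteq> {}"
  proof (rule spec_rad_less_of_exit[OF _ D])
    show sub: "upcl C - C \<subseteq> V" using upcl_subset by auto
    obtain u where u: "u \<in> C" using comps_nonempty[OF C] by blast
    fix v assume v: "v \<in> upcl C - C"
    then have *: "0 < AF F v u" using sub u CV upcl_diff_reach1[OF C v u] well_chosen_pos_iff[OF F] by blast
    then show "\<exists>u\<in>V - (upcl C - C). 0 < x u \<and> 0 < AF F v u"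
      using u CV x' by blast
    show "0 < x v"
      using x' u v sub CV * by (intro eigenvector_pos(2)[of "AF F" v x \<mu> u]) (auto simp: vmat_F_nonneg)
  qed (use x' in auto)
qed

text \<open>The block on \<open>C\<close> is positive, so \<open>y\<close> is a multiple of
  \<open>x\<close> there. The difference of \<open>y\<close> and this multiple lives on the closure
  minus \<open>C\<close>, whose radius is below \<open>\<mu>\<close>, so it cannot be an eigenvector
  for \<open>\<mu>\<close> and is 0.\<close>

lemma comp_vector_unique:
  assumes F: "well_chosen L d rg src F" and C: "C \<in> comps" "\<not> trivial_comp L rg src C"
    and x: "comp_vector F C \<mu> x"
    and y: "\<And>v. v \<notin> upcl C \<Longrightarrow> y v = 0" "\<And>v. v \<in> V \<Longrightarrow> (\<Sum>w\<in>V. AF F v w * y w) = \<mu> * y v"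
  obtains c where "\<And>v. y v = c * x v"
proof -
  note x' = x[unfolded comp_vector_def]
  have CV: "C \<subseteq> V" by (rule comps_subset[OF C(1)])
  have row: "(\<Sum>w\<in>C. AF F v w * z w) = (\<Sum>w\<in>V. AF F v w * z w)"
    if "v \<in> C" "\<And>v. v \<notin> upcl C \<Longrightarrow> z v = 0" for v z
    using that CV by (intro comp_vector_row[OF C(1), symmetric]) (auto intro: AF_reach)
  obtain c where c: "\<And>v. v \<in> C \<Longrightarrow> y v = c * x v"
  proof (rule positive_matrix_eigenvector_unique[of C "AF F" x \<mu> y])
    show "\<forall>v\<in>C. \<forall>w\<in>C. 0 < AF F v w"
      using nontrivial_reach1[OF C] well_chosen_pos_iff[OF F] CV by blast
  qed (use finite_comps_member[OF C(1)] x' y CV in \<open>auto simp: row\<close>)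
  define z where "z v = y v - c * x v" for v
  define D where "D = upcl C - C"
  have z0: "z v = 0" if "v \<notin> D" for v
    using that c y(1) x' by (auto simp: z_def D_def)
  have zV: "(\<Sum>w\<in>V. AF F v w * z w) = \<mu> * z v" if "v \<in> V" for v
  proof -
    have "(\<Sum>w\<in>V. AF F v w * z w) = (\<Sum>w\<in>V. AF F v w * y w) - c * (\<Sum>w\<in>V. AF F v w * x w)"
      by (simp add: z_def algebra_simps sum_subtractf sum_distrib_left)
    also have "\<dots> = \<mu> * y v - c * (\<mu> * x v)" using y(2) x' that by simp
    finally show ?thesis by (simp add: z_def algebra_simps)
  qed
  have "z v = 0" for v
  proof (rule ccontr)
    assume nz: "z v \<noteq> 0"
    then have v: "v \<in> D" using z0 by blast
    have DV: "D \<subseteq> V" using upcl_subset by (auto simp: D_def)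
    have "\<mu> \<le> spec_rad D (AF F)"
    proof (rule real_eigenvalue_le_spec_rad[of D "AF F" v z])
      fix u assume u: "u \<in> D"
      have "(\<Sum>w\<in>D. AF F u w * z w) = (\<Sum>w\<in>V. AF F u w * z w)"
        using DV z0 by (intro sum.mono_neutral_left) auto
      then show "(\<Sum>w\<in>D. AF F u w * z w) = \<mu> * z u" using zV u DV by auto
    qed (use v nz DV finite_subset[OF DV] vmat_F_nonneg in auto)
    then show False using comp_vector_spec_rad(2)[OF F C(1) x] v by (auto simp: D_def)
  qed
  then show ?thesis using that[of c] by (simp add: z_def)
qed

text \<open>The Perron-Frobenius vector of the whole closure is extended by 0. If it vanished on
  \<open>C\<close>, it would be an eigenvector on the closure minus \<open>C\<close> for an
  eigenvalue at least the radius on \<open>C\<close>, against harmonicity. Being positive at one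
  vertex of \<open>C\<close>, it is positive on all of \<open>C\<close>.\<close>

lemma harmonic_comp_vector:
  assumes F: "well_chosen L d rg src F" and h: "F_harmonic L d rg src F C"
  obtains x where "comp_vector F C (spec_rad C (AF F)) x" "(\<Sum>v\<in>V. x v) = 1"
proof -
  have C: "C \<in> comps" "\<not> trivial_comp L rg src C" using h by (auto simp: F_harmonic_def)
  have CV: "C \<subseteq> V" "C \<noteq> {}" using comps_subset[OF C(1)] comps_nonempty[OF C(1)] by auto
  define S where "S = upcl C"
  have SV: "S \<subseteq> V" "C \<subseteq> S" using upcl_subset subset_upcl[OF CV(1)] by (auto simp: S_def)
  have fin: "finite S" "S \<noteq> {}" using SV CV finite_subset[OF SV(1)] by auto
  have nn: "\<forall>v\<in>S. \<forall>w\<in>S. 0 \<le> AF F v w" using SV vmat_F_nonneg by blast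
  obtain y where y: "\<forall>v\<in>S. 0 \<le> y v" "(\<Sum>v\<in>S. y v) = 1"
    "\<forall>v\<in>S. (\<Sum>w\<in>S. AF F v w * y w) = spec_rad S (AF F) * y v"
    using Perron_Frobenius(1)[OF fin nn] by (elim exE conjE) (rule that)
  define \<rho> where "\<rho> = spec_rad S (AF F)"
  define x where "x v = (if v \<in> S then y v else 0)" for v
  have x0: "0 \<le> x v" for v using y(1) by (simp add: x_def)
  have xoff: "x v = 0" if "v \<notin> upcl C" for v using that by (simp add: x_def S_def)
  have xV: "(\<Sum>w\<in>V. AF F v w * x w) = \<rho> * x v" if v: "v \<in> V" for v
  proof (cases "v \<in> S")
    case True
    have "(\<Sum>w\<in>V. AF F v w * x w) = (\<Sum>w\<in>S. AF F v w * y w)"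
      using SV by (intro sum.mono_neutral_cong_right) (auto simp: x_def)
    then show ?thesis using y(3) True by (simp add: \<rho>_def x_def)
  next
    case False
    have "AF F v w * x w = 0" for w
      using False AF_reach[OF v] upcl_reach[of v w C] by (auto simp: x_def S_def)
    then have "(\<Sum>w\<in>V. AF F v w * x w) = 0" by (rule sum.neutral[OF ballI])
    then show ?thesis using False by (simp add: x_def)
  qed
  have x1: "(\<Sum>v\<in>V. x v) = 1"
  proof -
    have "(\<Sum>v\<in>V. x v) = (\<Sum>v\<in>S. y v)"
      using SV by (intro sum.mono_neutral_cong_right) (auto simp: x_def)
    then show ?thesis using y(2) by simp
  qed
  have "\<exists>u\<in>C. 0 < x u"
  proof (rule ccontr)
    assume "\<not> (\<exists>u\<in>C. 0 < x u)"
    then have xC: "x u = 0" if "u \<in> C" for u using x0[of u] that by force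
    define D where "D = upcl C - C"
    have DV: "D \<subseteq> V" using upcl_subset by (auto simp: D_def)
    obtain v where v: "x v \<noteq> 0" using x1 by (metis sum.neutral zero_neq_one)
    then have vD: "v \<in> D" using xC xoff by (auto simp: D_def)
    have "\<rho> \<le> spec_rad D (AF F)"
    proof (rule real_eigenvalue_le_spec_rad[of D "AF F" v x])
      fix u assume u: "u \<in> D"
      have "(\<Sum>w\<in>D. AF F u w * x w) = (\<Sum>w\<in>V. AF F u w * x w)"
        using DV xoff xC by (intro sum.mono_neutral_left) (auto simp: D_def)
      then show "(\<Sum>w\<in>D. AF F u w * x w) = \<rho> * x u" using xV u DV by auto
    qed (use v vD DV finite_subset[OF DV] vmat_F_nonneg in auto)
    also have "\<dots> < spec_rad C (AF F)" using h vD by (auto simp: F_harmonic_def D_def)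
    also have "\<dots> \<le> \<rho>" unfolding \<rho>_def using fin nn CV SV by (intro spec_rad_mono) auto
    finally show False by simp
  qed
  then obtain u where u: "u \<in> C" "0 < x u" by blast
  have xC: "0 < x v" if "v \<in> C" for v
  proof -
    have "0 < AF F v u"
      using nontrivial_reach1[OF C that u(1)] well_chosen_pos_iff[OF F] CV that u by blast
    then show ?thesis
      using x0 xV u CV that by (intro eigenvector_pos(2)[of "AF F" v x \<rho> u]) (auto simp: vmat_F_nonneg)
  qed
  have "comp_vector F C \<rho> x" using x0 xoff xC xV by (auto simp: comp_vector_def)
  moreover then have "spec_rad C (AF F) = \<rho>" by (rule comp_vector_spec_rad(1)[OF F C(1)])
  ultimately show ?thesis using that x1 by simp
qed

text \<open>A_i commutes with A_F, so A_i x is again an eigenvector for \<open>\<mu>\<close>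
  supported in the closure, and by uniqueness a multiple of \<open>x\<close>. Positivity of
  \<open>x\<close> on \<open>C\<close> identifies the factor as the radius of the block of
  A_i.\<close>

lemma comp_vector_joint:
  assumes F: "well_chosen L d rg src F" and C: "C \<in> comps" "\<not> trivial_comp L rg src C"
    and x: "comp_vector F C \<mu> x" and v: "v \<in> V"
  shows "(\<Sum>w\<in>V. pc (unitv i) v w * x w) = spec_rad C (Ai i) * x v"
proof -
  note x' = x[unfolded comp_vector_def]
  have CV: "C \<subseteq> V" by (rule comps_subset[OF C(1)])
  define y where "y v = (if v \<in> V then \<Sum>w\<in>V. pc (unitv i) v w * x w else 0)" for v
  obtain c where c: "\<And>v. y v = c * x v"
  proof (rule comp_vector_unique[OF F C x, of y])
    fix v assume v: "v \<notin> upcl C"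
    have "pc (unitv i) v w * x w = 0" for w
    proof (rule ccontr)
      assume "pc (unitv i) v w * x w \<noteq> 0"
      then have "reach v w" "w \<in> upcl C" using x' Ai_reach[of i v w] by (auto simp: vmat_pc)
      then show False using upcl_reach v by blast
    qed
    then have "(\<Sum>w\<in>V. pc (unitv i) v w * x w) = 0" by (rule sum.neutral[OF ballI])
    then show "y v = 0" by (simp add: y_def)
  next
    fix v assume v: "v \<in> V"
    have "(\<Sum>w\<in>V. AF F v w * y w) = (\<Sum>w\<in>V. AF F v w * (\<Sum>u\<in>V. pc (unitv i) w u * x u))"
      by (intro sum.cong) (auto simp: y_def)
    also have "\<dots> = (\<Sum>w\<in>V. pc (unitv i) v w * (\<mu> * x w))"
      unfolding vmat_F_commute_apply[OF v] using x' by (intro sum.cong) auto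
    also have "\<dots> = \<mu> * y v" using v by (simp add: y_def sum_distrib_left algebra_simps)
    finally show "(\<Sum>w\<in>V. AF F v w * y w) = \<mu> * y v" .
  qed (rule that)
  have "spec_rad C (Ai i) = c"
  proof (rule spec_rad_eqI[of C "Ai i" x])
    fix v assume v: "v \<in> C"
    then have "(\<Sum>w\<in>C. Ai i v w * x w) = (\<Sum>w\<in>V. Ai i v w * x w)"
      using CV x' by (intro comp_vector_row[OF C(1), symmetric]) (auto intro: Ai_reach)
    then show "(\<Sum>w\<in>C. Ai i v w * x w) = c * x v" using c[of v] v CV by (auto simp: y_def vmat_pc)
  qed (use x' comps_nonempty[OF C(1)] finite_comps_member[OF C(1)] in auto)
  then show ?thesis using c[of v] v by (simp add: y_def)
qed

section \<open>Joint eigenvectors as convex combinations\<close>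

definition joint_eigenvectors :: "('k \<Rightarrow> real) \<Rightarrow> ('p \<Rightarrow> real) set" where
  "joint_eigenvectors q = {x. (\<forall>v. 0 \<le> x v) \<and> (\<forall>v. v \<notin> V \<longrightarrow> x v = 0) \<and> (\<Sum>v\<in>V. x v) = 1
    \<and> (\<forall>i. \<forall>v\<in>V. (\<Sum>w\<in>V. pc (unitv i) v w * x w) = q i * x v)}"

text \<open>The very list chosen inside \<open>xvec\<close>, so that unfolding \<open>xvec\<close>
  produces A_F for \<open>F0\<close>.\<close>

definition F0 :: "('k \<Rightarrow> nat) list" where "F0 = (SOME F. well_chosen L d rg src F)"

lemma F0: "well_chosen L d rg src F0"
  unfolding F0_def using ex_well_chosen by (rule someI_ex)

abbreviation "xC \<equiv> xvec L d rg src"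
abbreviation "Crb r \<beta> \<equiv> Cr L d rg src r \<beta>"

lemma Cr_comps: "C \<in> Crb r \<beta> \<Longrightarrow> C \<in> comps \<and> \<not> trivial_comp L rg src C"
  by (auto simp: Cr_def pos_harmonic_def F_harmonic_def)

lemma finite_Cr: "finite (Crb r \<beta>)"
  by (rule finite_subset[OF _ finite_comps]) (auto dest: Cr_comps)

text \<open>The vector is built from a list \<open>F\<close> for which \<open>C\<close> is harmonic.
  As a joint eigenvector with eigenvalues \<open>q\<close> it satisfies the equation for
  \<open>F0\<close> too, with eigenvalue the sum of the \<open>mpower q a\<close>, and uniqueness
  for \<open>F0\<close> identifies it with \<open>xvec\<close>.\<close>

lemma xvec_Cr:
  fixes r :: "'k \<Rightarrow> real"
  assumes C: "C \<in> Crb r \<beta>"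
  defines "q \<equiv> \<lambda>i. exp (\<beta> * r i)"
  shows "xC C \<in> joint_eigenvectors q" "comp_vector F0 C (\<Sum>a\<leftarrow>F0. mpower q a) (xC C)"
proof -
  have comp: "C \<in> comps" "\<not> trivial_comp L rg src C" using Cr_comps[OF C] by auto
  \<comment> \<open>The logarithm in \<open>Cr\<close> can be inverted because \<open>C\<close> is a
    positive component.\<close>
  have q: "spec_rad C (Ai i) = q i" for i
    using C by (auto simp: Cr_def q_def pos_harmonic_def positive_comp_def)
  obtain F where F: "well_chosen L d rg src F" "F_harmonic L d rg src F C"
    using C by (auto simp: Cr_def pos_harmonic_def)
  obtain x where x: "comp_vector F C (spec_rad C (AF F)) x" "(\<Sum>v\<in>V. x v) = 1"
    by (rule harmonic_comp_vector[OF F])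
  note x' = x(1)[unfolded comp_vector_def]
  have joint: "(\<Sum>w\<in>V. pc (unitv i) v w * x w) = q i * x v" if "v \<in> V" for i v
    using comp_vector_joint[OF F(1) comp x(1) that] q by simp
  have F0x: "comp_vector F0 C (\<Sum>a\<leftarrow>F0. mpower q a) x"
    using x' joint_eigenvector_vmat_F[of x q, OF joint] by (auto simp: comp_vector_def)
  have sr: "spec_rad C (AF F0) = (\<Sum>a\<leftarrow>F0. mpower q a)"
    by (rule comp_vector_spec_rad(1)[OF F0 comp(1) F0x])
  have "xC C = (THE x. (\<forall>v. 0 \<le> x v) \<and> (\<forall>v. v \<notin> upcl C \<longrightarrow> x v = 0)
        \<and> (\<Sum>v\<in>V. x v) = 1
        \<and> (\<forall>v\<in>V. (\<Sum>w\<in>V. AF F0 v w * x w) = spec_rad C (AF F0) * x v))"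
    by (simp add: xvec_def F0_def Let_def)
  also have "\<dots> = x"
  proof (rule the_equality)
    show "(\<forall>v. 0 \<le> x v) \<and> (\<forall>v. v \<notin> upcl C \<longrightarrow> x v = 0) \<and> (\<Sum>v\<in>V. x v) = 1
        \<and> (\<forall>v\<in>V. (\<Sum>w\<in>V. AF F0 v w * x w) = spec_rad C (AF F0) * x v)"
      using F0x x(2) unfolding sr comp_vector_def by blast
  next
    fix y assume y: "(\<forall>v. 0 \<le> y v) \<and> (\<forall>v. v \<notin> upcl C \<longrightarrow> y v = 0) \<and> (\<Sum>v\<in>V. y v) = 1
        \<and> (\<forall>v\<in>V. (\<Sum>w\<in>V. AF F0 v w * y w) = spec_rad C (AF F0) * y v)"
    obtain c where c: "\<And>v. y v = c * x v"
      using comp_vector_unique[OF F0 comp F0x, of y] y unfolding sr by blast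
    have "(\<Sum>v\<in>V. y v) = c * (\<Sum>v\<in>V. x v)" by (simp add: c sum_distrib_left)
    then have "c = 1" using y x(2) by simp
    then show "y = x" using c by auto
  qed
  finally have xC: "xC C = x" .
  show "comp_vector F0 C (\<Sum>a\<leftarrow>F0. mpower q a) (xC C)" unfolding xC by (rule F0x)
  show "xC C \<in> joint_eigenvectors q"
    unfolding xC joint_eigenvectors_def using x' x(2) joint upcl_subset[of C] by auto
qed

text \<open>All components in \<open>Cr\<close> share the eigenvalue \<open>\<mu>\<close>. If
  \<open>C\<close> met the support of the vector of \<open>C'\<close>, it would lie in the closure
  of \<open>C'\<close> minus \<open>C'\<close>, whose radius is below \<open>\<mu>\<close>, while
  the block on \<open>C\<close> has radius \<open>\<mu>\<close>.\<close>

lemma xvec_Cr_disjoint: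
  assumes C: "C \<in> Crb r \<beta>" "C' \<in> Crb r \<beta>" "C \<noteq> C'" and v: "v \<in> C"
  shows "xC C' v = 0"
proof (rule ccontr)
  define \<mu> where "\<mu> = (\<Sum>a\<leftarrow>F0. mpower (\<lambda>i. exp (\<beta> * r i)) a)"
  note x = xvec_Cr(2)[OF C(1), folded \<mu>_def] and x' = xvec_Cr(2)[OF C(2), folded \<mu>_def]
  have comp: "C \<in> comps" "C' \<in> comps" using Cr_comps C by auto
  assume "xC C' v \<noteq> 0"
  then have "v \<in> upcl C'" using x' by (auto simp: comp_vector_def)
  then have sub: "C \<subseteq> upcl C' - C'"
    using upcl_reach comps_reach[OF comp(1) _ v] comps_disjoint[OF comp] C(3) by blast
  then have ne: "upcl C' - C' \<noteq> {}" using v by blast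
  have DV: "upcl C' - C' \<subseteq> V" using upcl_subset by auto
  have "\<mu> = spec_rad C (AF F0)" using comp_vector_spec_rad(1)[OF F0 comp(1) x] by simp
  also have "\<dots> \<le> spec_rad (upcl C' - C') (AF F0)"
    using sub v DV vmat_F_nonneg finite_subset[OF DV] by (intro spec_rad_mono) auto
  also have "\<dots> < \<mu>" by (rule comp_vector_spec_rad(2)[OF F0 comp(2) x' ne])
  finally show False by simp
qed

lemma joint_eigenvector_decomposition:
  fixes r :: "'k \<Rightarrow> real" and \<beta> :: real
  defines "q \<equiv> \<lambda>i. exp (\<beta> * r i)"
  assumes x: "x \<in> joint_eigenvectors q"
  obtains f where "f \<in> weight_fns (Crb r \<beta>)" "\<And>v. v \<in> V \<Longrightarrow> x v = (\<Sum>C\<in>Crb r \<beta>. f C * xC C v)"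
proof -
  note x' = x[unfolded joint_eigenvectors_def mem_Collect_eq]
  define \<mu> where "\<mu> = (\<Sum>a\<leftarrow>F0. mpower q a)"
  have xF: "(\<Sum>w\<in>V. AF F0 v w * x w) = \<mu> * x v" if "v \<in> V" for v
    unfolding \<mu>_def using x' that by (intro joint_eigenvector_vmat_F) auto
  have qpos: "0 < q i" for i by (simp add: q_def)
  define W where "W = {v\<in>V. 0 < x v}"
  have WV: "W \<subseteq> V" by (auto simp: W_def)
  have x0: "x v = 0" if "v \<notin> W" for v
    using that x' by (cases "v \<in> V") (auto simp: W_def less_le)
  have AFpos: "0 < AF F0 v w \<longleftrightarrow> reach1 v w" if "v \<in> V" "w \<in> V" for v w
    by (rule well_chosen_pos_iff[OF F0 that])
  have W_reach: "v \<in> W" if "reach v w" "w \<in> W" for v w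
    using reach_cases[OF that(1)]
  proof
    assume "reach1 v w"
    then have "0 < AF F0 v w" using AFpos reach_V[OF that(1)] by blast
    then have "0 < x v"
      using x' that xF reach_V[OF that(1)]
      by (intro eigenvector_pos(2)[of "AF F0" v x \<mu> w]) (auto simp: vmat_F_nonneg W_def)
    then show ?thesis using reach_V[OF that(1)] by (simp add: W_def)
  qed (use that in simp)
  define T where "T = {C\<in>comps. C \<subseteq> W \<and> (\<forall>u\<in>C. \<forall>w\<in>W. reach u w \<longrightarrow> w \<in> C)}"
  have reach_T: "\<exists>C\<in>T. \<exists>u\<in>C. reach w u" if w: "w \<in> W" for w
  proof -
    define R where "R u = {z\<in>W. reach u z}" for u
    \<comment> \<open>A vertex from which the fewest vertices of \<open>W\<close> can be reached
      lies in a final component: whatever it reaches in \<open>W\<close> reaches just as much, hence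
      reaches back.\<close>
    define m where "m = (LEAST n. \<exists>u. u \<in> W \<and> reach w u \<and> card (R u) = n)"
    have "\<exists>n u. u \<in> W \<and> reach w u \<and> card (R u) = n" using w WV reach_refl by blast
    then have "\<exists>u. u \<in> W \<and> reach w u \<and> card (R u) = m" unfolding m_def by (rule LeastI_ex)
    then obtain u where u: "u \<in> W" "reach w u" "card (R u) = m" by blast
    have min: "card (R u) \<le> card (R z)" if "z \<in> W" "reach w z" for z
      unfolding u(3) m_def using that by (intro Least_le) blast
    define C where "C = {z. reach u z \<and> reach z u}"
    have C: "C \<in> comps" "u \<in> C" using comp_of[of u] u WV by (auto simp: C_def)
    have "z \<in> C" if z: "u' \<in> C" "z \<in> W" "reach u' z" for u' z
    proof -
      have uz: "reach u z" using z reach_trans by (auto simp: C_def)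
      then have "R z \<subseteq> R u" using reach_trans by (auto simp: R_def)
      moreover have "finite (R u)" using finite_subset[OF WV] by (simp add: R_def)
      moreover have "card (R u) \<le> card (R z)" using min[OF z(2)] uz u(2) reach_trans by blast
      ultimately have "R z = R u" by (metis card_seteq)
      then have "reach z u" using u WV reach_refl by (auto simp: R_def)
      then show ?thesis using uz by (simp add: C_def)
    qed
    moreover have "C \<subseteq> W" using W_reach u(1) by (auto simp: C_def)
    ultimately have "C \<in> T" using C(1) by (auto simp: T_def)
    then show ?thesis using C(2) u(2) by blast
  qed
  have T_comp: "C \<in> comps" "C \<subseteq> W" "C \<subseteq> V" if "C \<in> T" for C
    using that WV by (auto simp: T_def)
  have row: "(\<Sum>w\<in>C. M v w * x w) = (\<Sum>w\<in>V. M v w * x w)"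
    if "C \<in> T" "v \<in> C" "\<And>w. M v w \<noteq> 0 \<Longrightarrow> reach v w" for C v and M :: "'p \<Rightarrow> 'p \<Rightarrow> real"
    using that x0 by (intro sum_comp_row[where U = W, symmetric]) (auto simp: T_def)
  have rowF: "(\<Sum>w\<in>C. AF F0 v w * x w) = \<mu> * x v" if "C \<in> T" "v \<in> C" for C v
    using row[of C v "AF F0"] that T_comp(3)[OF that(1)] xF AF_reach[of v F0] by (simp add: subset_iff)
  have xpos: "0 < x v" if "v \<in> W" for v using that by (simp add: W_def)
  \<comment> \<open>\<open>\<mu>\<close> would be 0 for an empty list. Absence of sources provides a
    path of nonzero degree, which forces \<open>F0\<close> to be nonempty.\<close>
  have \<mu>pos: "0 < \<mu>"
  proof -
    obtain v where v: "v \<in> V" using x' by fastforce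
    obtain l where l: "l \<in> L" "rg l = v" "d l = unitv i"
      using no_sources v unfolding no_sources_def by blast
    have "d l \<noteq> 0" using l(3) by (auto simp: fun_eq_iff unitv_def)
    then have "reach1 v (src l)" using l by (auto simp: reach1_def)
    then have "0 < AF F0 v (src l)" using AFpos v l by auto
    then have "F0 \<noteq> []" using vmat_F_pc[OF v, of F0] by auto
    then obtain a F' where "F0 = a # F'" by (cases F0) auto
    moreover have "0 \<le> (\<Sum>a\<leftarrow>F'. mpower q a)"
      by (intro sum_list_nonneg) (auto simp: mpower_pos[of q, OF qpos] less_imp_le)
    ultimately show ?thesis
      using mpower_pos[of q a, OF qpos] by (simp add: \<mu>_def)
  qed
  \<comment> \<open>Within the support, a row of a final component meets only that component, so
    \<open>\<mu> > 0\<close> needs a path of nonzero degree inside it.\<close>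
  have T_nt: "\<not> trivial_comp L rg src C" if C: "C \<in> T" for C
  proof -
    obtain v where v: "v \<in> C" using comps_nonempty T_comp(1)[OF C] by blast
    then have "0 < x v" using T_comp(2)[OF C] xpos by blast
    then have "0 < (\<Sum>w\<in>C. AF F0 v w * x w)" unfolding rowF[OF C v] using \<mu>pos by simp
    then have "\<not> (\<forall>w\<in>C. AF F0 v w * x w = 0)" using sum.neutral by fastforce
    then obtain w where w: "w \<in> C" "AF F0 v w * x w \<noteq> 0" by blast
    have vw: "v \<in> V" "w \<in> V" using v w T_comp(3)[OF C] by auto
    then have "0 < AF F0 v w" using w(2) vmat_F_nonneg[OF vw(1), of F0 w] by (auto simp: less_le)
    then have "reach1 v w" using AFpos vw by blast
    then show ?thesis by (rule reach1_nontrivial[OF T_comp(1)[OF C] v w(1)])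
  qed
  have T_Cr: "C \<in> Crb r \<beta>" if C: "C \<in> T" for C
  proof -
    note comp = T_comp[OF C] and ne = comps_nonempty[OF T_comp(1)[OF C]]
    have fin: "finite C" using finite_comps_member comp(1) .
    have A: "spec_rad C (Ai i) = q i" for i
    proof (rule spec_rad_eqI[OF fin ne])
      fix v assume v: "v \<in> C"
      show "0 < x v" using xpos comp(2) v by blast
      show "(\<Sum>w\<in>C. Ai i v w * x w) = q i * x v"
        using row[OF C v, of "Ai i"] Ai_reach[of i v] x' v comp(3) by (auto simp: vmat_pc)
    qed simp
    have sr: "spec_rad C (AF F0) = \<mu>"
      using comp xpos rowF[OF C] by (intro spec_rad_eqI[OF fin ne, of "AF F0" x]) (auto simp: vmat_F_nonneg)
    have "spec_rad (upcl C - C) (AF F0) < \<mu>" if D: "upcl C - C \<noteq> {}"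
    proof (rule spec_rad_less_of_exit[OF _ D])
      show sub: "upcl C - C \<subseteq> V" using upcl_subset by auto
      obtain u where u: "u \<in> C" using ne by blast
      fix v assume v: "v \<in> upcl C - C"
      have r1: "reach1 v u" by (rule upcl_diff_reach1[OF comp(1) v u])
      have uV: "u \<in> V" "v \<in> V" using u v comp sub by auto
      have "0 < AF F0 v u" using r1 AFpos[OF uV(2,1)] by blast
      then show "\<exists>u\<in>V - (upcl C - C). 0 < x u \<and> 0 < AF F0 v u"
        using u uV comp(2) xpos by blast
      show "0 < x v" using W_reach[OF reach1_reach[OF r1]] u comp(2) xpos by blast
    qed (use x' xF in auto)
    then have "F_harmonic L d rg src F0 C"
      unfolding F_harmonic_def sr using comp(1) T_nt[OF C] by blast
    then show ?thesis
      using F0 comp(1) A by (auto simp: Cr_def pos_harmonic_def positive_comp_def q_def)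
  qed
  have cv: "comp_vector F0 C \<mu> (xC C)" if "C \<in> T" for C
    using xvec_Cr(2)[OF T_Cr[OF that]] by (simp add: \<mu>_def q_def)
  have "\<exists>c. \<forall>v\<in>C. x v = c * xC C v" if C: "C \<in> T" for C
  proof -
    note comp = T_comp[OF C] and cvC = cv[OF C, unfolded comp_vector_def]
    obtain c where "\<And>v. v \<in> C \<Longrightarrow> x v = c * xC C v"
    proof (rule positive_matrix_eigenvector_unique[of C "AF F0" "xC C" \<mu> x])
      show "\<forall>v\<in>C. \<forall>w\<in>C. 0 < AF F0 v w"
        using nontrivial_reach1[OF comp(1) T_nt[OF C]] AFpos comp(3) by blast
      fix v assume v: "v \<in> C"
      have "(\<Sum>w\<in>V. AF F0 v w * xC C w) = (\<Sum>w\<in>C. AF F0 v w * xC C w)"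
        using cvC v comp by (intro comp_vector_row[OF comp(1)]) (auto intro: AF_reach)
      then show "(\<Sum>w\<in>C. AF F0 v w * xC C w) = \<mu> * xC C v" using cvC v comp by auto
    qed (use finite_comps_member[OF comp(1)] cvC rowF[OF C] in auto)
    then show ?thesis by blast
  qed
  then obtain c where c: "\<And>C v. C \<in> T \<Longrightarrow> v \<in> C \<Longrightarrow> x v = c C * xC C v" by metis
  have c0: "0 \<le> c C" if C: "C \<in> T" for C
  proof -
    obtain v where v: "v \<in> C" using comps_nonempty T_comp(1)[OF C] by blast
    have "0 < x v" "0 < xC C v" using T_comp(2)[OF C] v xpos cv[OF C] by (auto simp: comp_vector_def)
    then show ?thesis using c[OF C v] by (auto simp: zero_less_mult_iff)
  qed
  define f where "f C = (if C \<in> T then c C else 0)" for C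
  define z where "z v = x v - (\<Sum>C\<in>T. f C * xC C v)" for v
  have TC: "T \<subseteq> Crb r \<beta>" using T_Cr by blast
  have finT: "finite T" using finite_subset[OF TC finite_Cr] .
  have fsum: "(\<Sum>C\<in>Crb r \<beta>. f C * g C) = (\<Sum>C\<in>T. f C * g C)" for g :: "'p set \<Rightarrow> real"
    using TC finite_Cr by (intro sum.mono_neutral_right) (auto simp: f_def)
  define D where "D = W - \<Union>T"
  have DV: "D \<subseteq> V" using WV by (auto simp: D_def)
  have z0: "z v = 0" if v: "v \<notin> D" for v
  proof (cases "v \<in> W")
    case True
    then obtain C where C: "C \<in> T" "v \<in> C" using v by (auto simp: D_def)
    \<comment> \<open>On a final component only its own vector is nonzero.\<close>
    have "(\<Sum>C\<in>T. f C * xC C v) = (\<Sum>C'\<in>{C}. f C' * xC C' v)"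
      using C finT xvec_Cr_disjoint[OF T_Cr[OF C(1)] T_Cr _ C(2)]
      by (intro sum.mono_neutral_right) auto
    then show ?thesis using c[OF C] C by (simp add: z_def f_def)
  next
    case False
    have "xC C v = 0" if C: "C \<in> T" for C
    proof (rule ccontr)
      assume "xC C v \<noteq> 0"
      then have "v \<in> upcl C" using cv[OF C] by (auto simp: comp_vector_def)
      then show False using False W_reach T_comp(2)[OF C] by (auto simp: upcl_alt)
    qed
    then show ?thesis using x0[OF False] by (simp add: z_def)
  qed
  have zF: "(\<Sum>w\<in>V. AF F0 v w * z w) = \<mu> * z v" if v: "v \<in> V" for v
  proof -
    have "(\<Sum>w\<in>V. AF F0 v w * z w)
        = (\<Sum>w\<in>V. AF F0 v w * x w) - (\<Sum>w\<in>V. \<Sum>C\<in>T. f C * (AF F0 v w * xC C w))"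
      by (simp add: z_def right_diff_distrib sum_subtractf sum_distrib_left algebra_simps)
    also have "(\<Sum>w\<in>V. \<Sum>C\<in>T. f C * (AF F0 v w * xC C w))
        = (\<Sum>C\<in>T. f C * (\<Sum>w\<in>V. AF F0 v w * xC C w))"
      by (subst sum.swap) (simp add: sum_distrib_left)
    also have "\<dots> = (\<Sum>C\<in>T. f C * (\<mu> * xC C v))"
      using cv v by (intro sum.cong) (auto simp: comp_vector_def)
    finally show ?thesis
      using xF[OF v] by (simp add: z_def right_diff_distrib sum_distrib_left algebra_simps)
  qed
  have "z v = 0" for v
  proof (rule ccontr)
    assume nz: "z v \<noteq> 0"
    then have v: "v \<in> D" using z0 by blast
    have "\<mu> \<le> spec_rad D (AF F0)"
    proof (rule real_eigenvalue_le_spec_rad[of D "AF F0" v z])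
      fix u assume u: "u \<in> D"
      have "(\<Sum>w\<in>D. AF F0 u w * z w) = (\<Sum>w\<in>V. AF F0 u w * z w)"
        using DV z0 by (intro sum.mono_neutral_left) auto
      then show "(\<Sum>w\<in>D. AF F0 u w * z w) = \<mu> * z u" using zF u DV by auto
    qed (use v nz DV finite_subset[OF DV] vmat_F_nonneg in auto)
    moreover have "spec_rad D (AF F0) < \<mu>"
    proof (rule spec_rad_less_of_exit[OF DV, of x])
      fix v assume v: "v \<in> D"
      then show "0 < x v" using xpos by (simp add: D_def)
      obtain C u where u: "C \<in> T" "u \<in> C" "reach v u" using reach_T[of v] v by (auto simp: D_def)
      then have "u \<in> V" "0 < x u" "u \<notin> D" using T_comp[OF u(1)] xpos by (auto simp: D_def)
      moreover have "v \<noteq> u" using v u by (auto simp: D_def)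
      then have "0 < AF F0 v u" using reach_cases[OF u(3)] AFpos \<open>u \<in> V\<close> v DV by blast
      ultimately show "\<exists>u\<in>V - D. 0 < x u \<and> 0 < AF F0 v u" by blast
    qed (use v x' xF in auto)
    ultimately show False by simp
  qed
  then have xf: "x v = (\<Sum>C\<in>Crb r \<beta>. f C * xC C v)" for v
    unfolding fsum by (simp add: z_def)
  have f0: "0 \<le> f C" for C using c0 by (simp add: f_def)
  have "(\<Sum>v\<in>V. x v) = (\<Sum>C\<in>Crb r \<beta>. f C * (\<Sum>v\<in>V. xC C v))"
    unfolding xf sum_distrib_left by (rule sum.swap)
  also have "\<dots> = (\<Sum>C\<in>Crb r \<beta>. f C)"
    using xvec_Cr(1) by (intro sum.cong) (auto simp: joint_eigenvectors_def)
  finally have f1: "(\<Sum>C\<in>Crb r \<beta>. f C) = 1" using x' by simp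
  have "f C \<le> 1" if "C \<in> Crb r \<beta>" for C
    using member_le_sum[OF that _ finite_Cr, of f] f0 f1 by simp
  then have "f \<in> weight_fns (Crb r \<beta>)"
    unfolding weight_fns_def using f0 f1 TC by (auto simp: f_def)
  then show ?thesis using that xf by blast
qed

lemma weight_fns_joint_eigenvector:
  fixes r :: "'k \<Rightarrow> real"
  assumes f: "f \<in> weight_fns (Crb r \<beta>)"
  shows "(\<lambda>v. \<Sum>C\<in>Crb r \<beta>. f C * xC C v) \<in> joint_eigenvectors (\<lambda>i. exp (\<beta> * r i))"
proof -
  note x = xvec_Cr(1)[unfolded joint_eigenvectors_def mem_Collect_eq]
  have f0: "\<And>C. C \<in> Crb r \<beta> \<Longrightarrow> 0 \<le> f C" "(\<Sum>C\<in>Crb r \<beta>. f C) = 1"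
    using f by (auto simp: weight_fns_def)
  have "(\<Sum>v\<in>V. \<Sum>C\<in>Crb r \<beta>. f C * xC C v) = (\<Sum>C\<in>Crb r \<beta>. f C * (\<Sum>v\<in>V. xC C v))"
    unfolding sum_distrib_left by (rule sum.swap)
  also have "\<dots> = 1" using x f0(2) by simp
  moreover have "(\<Sum>w\<in>V. pc (unitv i) v w * (\<Sum>C\<in>Crb r \<beta>. f C * xC C w))
      = exp (\<beta> * r i) * (\<Sum>C\<in>Crb r \<beta>. f C * xC C v)" if v: "v \<in> V" for i v
  proof -
    have "(\<Sum>w\<in>V. pc (unitv i) v w * (\<Sum>C\<in>Crb r \<beta>. f C * xC C w))
      = (\<Sum>C\<in>Crb r \<beta>. f C * (\<Sum>w\<in>V. pc (unitv i) v w * xC C w))"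
      unfolding sum_distrib_left by (subst sum.swap) (simp add: algebra_simps)
    also have "\<dots> = (\<Sum>C\<in>Crb r \<beta>. f C * (exp (\<beta> * r i) * xC C v))"
      using x v by (intro sum.cong) auto
    finally show ?thesis by (simp add: sum_distrib_left algebra_simps)
  qed
  ultimately show ?thesis
    unfolding joint_eigenvectors_def using x f0(1)
    by (auto intro!: sum_nonneg mult_nonneg_nonneg sum.neutral)
qed

text \<open>At a vertex of \<open>C\<close> all other vectors of the combination vanish and
  \<open>xvec\<close> of \<open>C\<close> is positive, so the coefficient of \<open>C\<close> can be
  read off.\<close>

lemma weight_fns_inj:
  fixes r :: "'k \<Rightarrow> real"
  assumes f: "f \<in> weight_fns (Crb r \<beta>)" "g \<in> weight_fns (Crb r \<beta>)"
    and eq: "\<And>v. v \<in> V \<Longrightarrow> (\<Sum>C\<in>Crb r \<beta>. f C * xC C v) = (\<Sum>C\<in>Crb r \<beta>. g C * xC C v)"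
  shows "f = g"
proof
  fix C
  show "f C = g C"
  proof (cases "C \<in> Crb r \<beta>")
    case True
    note comp = Cr_comps[OF True]
    obtain v where v: "v \<in> C" using comps_nonempty comp by blast
    have s: "(\<Sum>C\<in>Crb r \<beta>. h C * xC C v) = h C * xC C v" for h
    proof -
      have "(\<Sum>C\<in>Crb r \<beta>. h C * xC C v) = (\<Sum>C\<in>{C}. h C * xC C v)"
        using True finite_Cr xvec_Cr_disjoint[OF True _ _ v]
        by (intro sum.mono_neutral_right) auto
      then show ?thesis by simp
    qed
    have "0 < xC C v" using xvec_Cr(2)[OF True] v by (simp add: comp_vector_def)
    moreover have "v \<in> V" using comp comps_subset v by blast
    ultimately show ?thesis using eq[of v] unfolding s by simp
  qed (use f in \<open>auto simp: weight_fns_def\<close>)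
qed

end

section \<open>The algebra of a k-graph\<close>

locale graph_algebra = kgraph L d rg src cmp
  for L :: "'p set" and d :: "'p \<Rightarrow> 'k::finite \<Rightarrow> nat" and rg src :: "'p \<Rightarrow> 'p"
    and cmp :: "'p \<Rightarrow> 'p \<Rightarrow> 'p" +
  fixes t :: "'p \<Rightarrow> 'a::cstar_algebra"
  assumes graph_algebra: "is_graph_algebra L d rg src cmp t"
begin

abbreviation "range_deg v n \<equiv> {l\<in>L. rg l = v \<and> d l = n}"

definition mm :: "'p \<Rightarrow> 'p \<Rightarrow> 'a" where "mm l g = t l * adj (t g)"

text \<open>Indexing by pairs turns the spanning set into an image, the form used by
  \<open>extend_functional\<close> and \<open>cstar_span_imageE\<close>.\<close>

definition mq :: "'p \<times> 'p \<Rightarrow> 'a" where "mq q = mm (fst q) (snd q)"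

lemma CK: "CK_family L d rg src cmp t"
  using graph_algebra by (simp add: is_graph_algebra_def)

lemma t_vert:
  assumes "v \<in> V"
  shows "adj (t v) = t v" "t v * t v = t v" "t v \<noteq> 0"
  using CK graph_algebra assms by (auto simp: CK_family_def is_graph_algebra_def)

lemma t_vert_orth: "v \<in> V \<Longrightarrow> w \<in> V \<Longrightarrow> v \<noteq> w \<Longrightarrow> t v * t w = 0"
  using CK by (auto simp: CK_family_def)

lemma t_mult: "l \<in> L \<Longrightarrow> m \<in> L \<Longrightarrow> src l = rg m \<Longrightarrow> t l * t m = t (cmp l m)"
  using CK by (auto simp: CK_family_def)

lemma t_isometry: "l \<in> L \<Longrightarrow> adj (t l) * t l = t (src l)"
  using CK by (auto simp: CK_family_def)

lemma t_sum: "v \<in> V \<Longrightarrow> t v = (\<Sum>l\<in>range_deg v n. t l * adj (t l))"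
  using CK unfolding CK_family_def by blast

lemma dense: "closure (cstar_span (mq ` (L \<times> L))) = UNIV"
proof -
  have "mq ` (L \<times> L) = {t l * adj (t g) | l g. l \<in> L \<and> g \<in> L}"
    by (auto simp: mq_def mm_def image_iff) blast+
  then show ?thesis using graph_algebra by (simp add: is_graph_algebra_def)
qed

lemma t_units:
  assumes "l \<in> L"
  shows "t (rg l) * t l = t l" "t l * t (src l) = t l"
    "adj (t l) * t (rg l) = adj (t l)" "t (src l) * adj (t l) = adj (t l)"
proof -
  show *: "t (rg l) * t l = t l" "t l * t (src l) = t l"
    using assms t_mult[of "rg l" l] t_mult[of l "src l"] by simp_all
  show "adj (t l) * t (rg l) = adj (t l)" "t (src l) * adj (t l) = adj (t l)"
    using arg_cong[OF *(1), of adj] arg_cong[OF *(2), of adj] assms t_vert(1)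
    by (simp_all add: adj_mult)
qed

text \<open>Different ranges are separated by vertex projections. For a common range
  \<open>v\<close>, the range projections of this degree add up to the projection
  \<open>t v\<close>, so \<open>orthogonal_of_sum_projections\<close> applies.\<close>

lemma t_orthogonal:
  assumes l: "l \<in> L" and g: "g \<in> L" and "d l = d g" "l \<noteq> g"
  shows "adj (t l) * t g = 0"
proof (cases "rg l = rg g")
  case False
  have "adj (t l) * t g = adj (t l) * (t (rg l) * t (rg g)) * t g"
    using t_units(3)[OF l] t_units(1)[OF g] by (metis mult.assoc)
  then show ?thesis using t_vert_orth[of "rg l" "rg g"] l g False by simp
next
  case True
  define v where "v = rg g"
  define q where "q m = t m * adj (t m)" for m
  have "q l * q g = 0"
  proof (rule orthogonal_of_sum_projections[of "range_deg v (d g)"])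
    fix m assume m: "m \<in> range_deg v (d g)"
    show "adj (q m) = q m" by (simp add: q_def adj_mult adj_adj)
    have "q m * q m = t m * (adj (t m) * t m) * adj (t m)" by (simp add: q_def mult.assoc)
    also have "\<dots> = q m" using m t_isometry[of m] t_units(2)[of m] by (simp add: q_def)
    finally show "q m * q m = q m" .
  next
    have "v \<in> V" using g by (simp add: v_def)
    then have "(\<Sum>m\<in>range_deg v (d g). q m) = t v" unfolding q_def by (rule t_sum[symmetric])
    then show "(\<Sum>m\<in>range_deg v (d g). q m) * q g = q g"
      using t_units(1)[OF g] by (simp add: q_def v_def flip: mult.assoc)
  qed (use assms True in \<open>auto simp: v_def\<close>)
  then have "adj (t l) * (q l * q g) * t g = 0" by simp
  moreover have "adj (t l) * (q l * q g) * t g = (adj (t l) * t l) * adj (t l) * (t g * (adj (t g) * t g))"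
    by (simp add: q_def mult.assoc)
  ultimately show ?thesis
    using t_isometry[OF l] t_isometry[OF g] t_units[OF l] t_units[OF g] by simp
qed

lemma mm_eq_0:
  assumes "l \<in> L" "g \<in> L" "src l \<noteq> src g"
  shows "mm l g = 0"
proof -
  have "mm l g = t l * (t (src l) * t (src g)) * adj (t g)"
    using t_units(2)[OF assms(1)] t_units(4)[OF assms(2)] unfolding mm_def by (metis mult.assoc)
  then show ?thesis using t_vert_orth[of "src l" "src g"] assms by simp
qed

text \<open>Inserting the Cuntz-Krieger relation at the common source raises both degrees by
  \<open>n\<close>. This is the device for bringing elements to comparable degrees.\<close>

lemma mm_expand:
  assumes l: "l \<in> L" "g \<in> L" "src l = src g"
  shows "mm l g = (\<Sum>k\<in>range_deg (src g) n. mm (cmp l k) (cmp g k))"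
proof -
  have "mm l g = t l * t (src g) * adj (t g)" using t_units(2)[OF l(1)] l by (simp add: mm_def)
  also have "t (src g) = (\<Sum>k\<in>range_deg (src g) n. t k * adj (t k))" using l by (intro t_sum) auto
  also have "t l * (\<Sum>k\<in>range_deg (src g) n. t k * adj (t k)) * adj (t g)
      = (\<Sum>k\<in>range_deg (src g) n. (t l * t k) * adj (t g * t k))"
    by (simp add: sum_distrib_left sum_distrib_right adj_mult mult.assoc)
  also have "\<dots> = (\<Sum>k\<in>range_deg (src g) n. mm (cmp l k) (cmp g k))"
    using l by (intro sum.cong) (auto simp: mm_def t_mult)
  finally show ?thesis .
qed

lemma norm_t: "v \<in> V \<Longrightarrow> norm (t v) = 1" "l \<in> L \<Longrightarrow> norm (t l) = 1"
proof -
  show *: "norm (t v) = 1" if "v \<in> V" for v using t_vert[OF that] by (intro norm_projection_eq_1)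
  assume "l \<in> L"
  then have "(norm (t l))\<^sup>2 = 1" using cstar_identity[of "t l"] t_isometry[of l] *[of "src l"] by simp
  then show "norm (t l) = 1" using norm_ge_zero[of "t l"] unfolding power2_eq_1_iff by linarith
qed

lemma mm_mult:
  assumes "l \<in> L" "g \<in> L" "m \<in> L" "n \<in> L" "src l = src g" "d g = d m"
  shows "mm l g * mm m n = (if g = m then mm l n else 0)"
proof -
  have "mm l g * mm m n = t l * (adj (t g) * t m) * adj (t n)" by (simp add: mm_def mult.assoc)
  then show ?thesis
    using assms t_orthogonal[of g m] t_isometry[of g] t_units(2)[of l] by (auto simp: mm_def)
qed

text \<open>Once the inner degrees \<open>d g + a\<close> and \<open>d m + b\<close> agree, inner
  paths either coincide or are orthogonal. Any such \<open>a\<close> and \<open>b\<close> may be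
  used, so minimal common extensions do not enter.\<close>

lemma mm_mult_expand:
  assumes "l \<in> L" "g \<in> L" "m \<in> L" "n \<in> L" "src l = src g" "src m = src n" "d g + a = d m + b"
  shows "mm l g * mm m n = (\<Sum>j\<in>range_deg (src g) a. \<Sum>k\<in>range_deg (src n) b.
      if cmp g j = cmp m k then mm (cmp l j) (cmp n k) else 0)"
proof -
  have "mm l g * mm m n = (\<Sum>j\<in>range_deg (src g) a. \<Sum>k\<in>range_deg (src n) b.
      mm (cmp l j) (cmp g j) * mm (cmp m k) (cmp n k))"
    unfolding mm_expand[OF assms(1,2,5), of a] mm_expand[OF assms(3,4,6), of b]
    by (rule sum_product)
  also have "\<dots> = (\<Sum>j\<in>range_deg (src g) a. \<Sum>k\<in>range_deg (src n) b.
      if cmp g j = cmp m k then mm (cmp l j) (cmp n k) else 0)"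
    using assms by (intro sum.cong refl mm_mult) auto
  finally show ?thesis .
qed

definition prefix :: "'p \<Rightarrow> 'p \<Rightarrow> bool" where
  "prefix l x \<longleftrightarrow> (\<exists>k\<in>L. rg k = src l \<and> x = cmp l k)"

text \<open>\<open>x\<close> has exactly one initial segment of degree \<open>d l\<close>, and by
  orthogonality of equal degrees the compression survives only if both \<open>l\<close> and
  \<open>g\<close> are that segment.\<close>

lemma compress_mm:
  assumes l: "l \<in> L" and g: "g \<in> L" and x: "x \<in> L" and d: "d l = d g" "d x = d l + n"
  shows "adj (t x) * mm l g * t x = (if l = g \<and> prefix l x then t (src x) else 0)"
proof -
  obtain u k where u: "u \<in> L" "k \<in> L" "src u = rg k" "d u = d l" "d k = n" "x = cmp u k"
    by (rule factorisation[OF x d(2)])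
  have tx: "t x = t u * t k" using u t_mult by simp
  have pre: "prefix l x \<longleftrightarrow> l = u"
    using cmp_cancel(1)[of l _ u k] u l unfolding prefix_def by metis
  have *: "adj (t m) * t x = (if m = u then t k else 0)" if "m \<in> L" "d m = d l" for m
  proof -
    have "adj (t m) * t x = (adj (t m) * t u) * t k" by (simp add: tx mult.assoc)
    then show ?thesis
      using that u t_orthogonal[of m u] t_isometry[of u] t_units(1)[of k] by auto
  qed
  have 1: "adj (t x) * t l = (if l = u then adj (t k) else 0)"
    using arg_cong[OF *[OF l refl], of adj] by (auto simp: adj_mult adj_adj split: if_splits)
  have "adj (t x) * mm l g * t x = (adj (t x) * t l) * (adj (t g) * t x)"
    by (simp add: mm_def mult.assoc)
  also have "\<dots> = (if l = u then adj (t k) else 0) * (if g = u then t k else 0)"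
    unfolding 1 by (subst *[OF g]) (use d in simp_all)
  finally have "adj (t x) * mm l g * t x
    = (if l = u then adj (t k) else 0) * (if g = u then t k else 0)" .
  then show ?thesis using pre t_isometry[of k] u by auto
qed

text \<open>The sum of the vertex projections acts as a left unit on the dense span, hence on
  1.\<close>

lemma one_eq: "1 = (\<Sum>v\<in>V. t v)"
proof -
  define P where "P = (\<Sum>v\<in>V. t v)"
  have Pt: "P * t l = t l" if l: "l \<in> L" for l
  proof -
    have "P * t l = (\<Sum>v\<in>V. t v * (t (rg l) * t l))" using l by (simp add: P_def sum_distrib_right t_units)
    also have "\<dots> = (\<Sum>v\<in>{rg l}. t v * (t (rg l) * t l))"
      using l t_vert_orth[of _ "rg l"]
      by (intro sum.mono_neutral_right) (auto simp: mult.assoc[symmetric])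
    finally show ?thesis using l t_vert(2)[of "rg l"] t_units(1)[OF l] by simp
  qed
  have "P * 1 = 1"
  proof (rule dense_eqI[OF dense])
    fix a assume "a \<in> cstar_span (mq ` (L \<times> L))"
    then obtain S c where S: "finite S" "S \<subseteq> L \<times> L" "a = (\<Sum>q\<in>S. cscale (c q) (mq q))"
      by (rule cstar_span_imageE)
    have "P * mq q = mq q" if "q \<in> S" for q
      using Pt[of "fst q"] that S(2) by (auto simp: mq_def mm_def mult.assoc[symmetric])
    then show "P * a = a" by (simp add: S(3) sum_distrib_left flip: cscale_mult_right)
  qed (auto intro!: continuous_intros)
  then show ?thesis by (simp add: P_def)
qed

definition zpow :: "('k \<Rightarrow> complex) \<Rightarrow> ('k \<Rightarrow> nat) \<Rightarrow> complex" where
  "zpow z n = (\<Prod>i\<in>UNIV. z i ^ n i)"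

lemma zpow_add: "zpow z (m + n) = zpow z m * zpow z n"
  by (simp add: zpow_def power_add prod.distrib)

lemma cmod_zpow: "(\<forall>i. cmod (z i) = 1) \<Longrightarrow> cmod (zpow z n) = 1"
  by (simp add: zpow_def norm_power flip: prod_norm)

text \<open>Multiplying each \<open>t l\<close> by a unimodular factor multiplicative in the degree
  yields another Cuntz-Krieger family in the same algebra.\<close>

lemma gauge_exists:
  assumes z: "\<forall>i. cmod (z i) = 1"
  shows "\<exists>h. star_hom h \<and> (\<forall>l\<in>L. h (t l) = cscale (zpow z (d l)) (t l))"
proof -
  define s where "s l = cscale (zpow z (d l)) (t l)" for l
  have sv: "s v = t v" if "v \<in> V" for v using that by (simp add: s_def zpow_def)
  have zz: "zpow z n * cnj (zpow z n) = 1" for n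
    using cmod_zpow[OF z, of n] by (simp add: complex_norm_square[symmetric])
  have ss: "s l * adj (s l) = t l * adj (t l)" "adj (s l) * s l = adj (t l) * t l" for l
    using zz[of "d l"]
    by (simp_all add: s_def adj_cscale cscale_cscale mult.commute
        flip: cscale_mult_left cscale_mult_right)
  have "CK_family L d rg src cmp s"
    unfolding CK_family_def
  proof (intro conjI ballI allI impI)
    fix l m assume "l \<in> L" "m \<in> L" "src l = rg m"
    then show "s l * s m = s (cmp l m)"
      unfolding s_def cmp(4)[OF \<open>l \<in> L\<close> \<open>m \<in> L\<close> \<open>src l = rg m\<close>] zpow_add
      by (simp add: cscale_cscale t_mult mult.commute flip: cscale_mult_left cscale_mult_right)
  next
    fix v n assume v: "v \<in> V"
    show "s v = (\<Sum>l\<in>range_deg v n. s l * adj (s l))"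
      unfolding ss using t_sum[OF v, of n] sv[OF v] by simp
  next
    fix l assume l: "l \<in> L"
    then show "adj (s l) * s l = s (src l)" using ss(2) t_isometry sv by simp
  qed (use sv t_vert t_vert_orth in auto)
  then show ?thesis using graph_algebra unfolding is_graph_algebra_def s_def by blast
qed

lemma gauge_mm:
  assumes h: "star_hom h" "\<forall>l\<in>L. h (t l) = cscale (zpow z (d l)) (t l)" and "l \<in> L" "g \<in> L"
  shows "h (mm l g) = cscale (zpow z (d l) * cnj (zpow z (d g))) (mm l g)"
  using assms by (simp add: mm_def star_homD[OF h(1)] adj_cscale cscale_cscale mult.commute
      flip: cscale_mult_left cscale_mult_right)

section \<open>Averaging over the gauge action\<close>

text \<open>Orthogonality of characters of the cyclic group of order \<open>M\<close>; both
  exponents being below \<open>M\<close>, they are congruent only if equal.\<close>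

lemma root_of_unity_sum:
  fixes M a b :: nat
  assumes ab: "a < M" "b < M"
  defines "z \<equiv> cis (2 * pi / M)"
  shows "(\<Sum>s<M. (z ^ s) ^ a * cnj ((z ^ s) ^ b)) = (if a = b then of_nat M else 0)"
proof -
  define y where "y = cis (2 * pi * (real a - real b) / M)"
  have M: "M > 0" using ab by simp
  have summand: "(z ^ s) ^ a * cnj ((z ^ s) ^ b) = y ^ s" for s
  proof -
    have "z ^ a * cnj z ^ b = cis (real a * (2 * pi / M) + real b * - (2 * pi / M))"
      by (simp only: z_def Complex.DeMoivre cis_cnj cis_mult)
    also have "real a * (2 * pi / M) + real b * - (2 * pi / M) = 2 * pi * (real a - real b) / M"
      by (simp add: algebra_simps diff_divide_distrib)
    finally have "z ^ a * cnj z ^ b = y" by (simp add: y_def)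
    moreover have "(z ^ s) ^ a * cnj ((z ^ s) ^ b) = (z ^ a * cnj z ^ b) ^ s"
      by (simp add: power_mult_distrib mult.commute flip: power_mult)
    ultimately show ?thesis by simp
  qed
  show ?thesis
  proof (cases "a = b")
    case True
    then show ?thesis unfolding summand by (simp add: y_def)
  next
    case False
    have "y \<noteq> 1"
    proof
      assume "y = 1"
      then have "cos (2 * pi * (real a - real b) / M) = 1" by (simp add: y_def complex_eq_iff)
      then obtain k :: int where "2 * pi * (real a - real b) / M = of_int k * 2 * pi"
        using cos_one_2pi_int by auto
      then have "2 * pi * (real a - real b) = real_of_int k * 2 * pi * real M"
        using M by (simp add: divide_eq_eq)
      also have "\<dots> = 2 * pi * (real_of_int k * real M)" by (simp only: ac_simps)
      finally have "real a - real b = real_of_int k * real M" using pi_neq_zero by (simp only: mult_cancel_left) simp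
      then have "real_of_int (int a - int b) = real_of_int (k * int M)" by simp
      then have "int a - int b = k * int M" by linarith
      moreover have "\<bar>int a - int b\<bar> < int M" using ab by auto
      ultimately have "\<bar>k\<bar> * int M < 1 * int M" by (simp add: abs_mult)
      then have "k = 0" using M by (simp add: mult_less_cancel_right)
      then show False using \<open>int a - int b = k * int M\<close> False by simp
    qed
    moreover have "y ^ M = 1"
    proof -
      have "y ^ M = cis (real M * (2 * pi * (real a - real b) / M))"
        by (simp only: y_def Complex.DeMoivre)
      also have "\<dots> = cis (2 * pi * (real a - real b))" using M by simp
      also have "\<dots> = 1" by (rule cis_multiple_2pi) auto
      finally show ?thesis .
    qed
    ultimately show ?thesis using False unfolding summand by (simp add: sum_gp_strict)
  qed
qed

text \<open>\<open>Z\<close> indexes the points of the torus whose coordinates are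
  \<open>M\<close>-th roots of unity, where \<open>M\<close> exceeds every coordinate of every
  degree in \<open>S\<close>. Averaging over them keeps exactly the terms of equal degrees. The
  constant 2 is the norm bound for \<open>star_hom\<close>.\<close>

lemma gauge_average:
  fixes S :: "('p \<times> 'p) set"
  assumes S: "finite S" "S \<subseteq> L \<times> L"
  shows "norm (\<Sum>q\<in>{q\<in>S. d (fst q) = d (snd q)}. cscale (c q) (mq q))
      \<le> 2 * norm (\<Sum>q\<in>S. cscale (c q) (mq q))"
proof -
  define a where "a = (\<Sum>q\<in>S. cscale (c q) (mq q))"
  define a0 where "a0 = (\<Sum>q\<in>{q\<in>S. d (fst q) = d (snd q)}. cscale (c q) (mq q))"
  define M where "M = Suc (\<Sum>q\<in>S. \<Sum>i\<in>UNIV. d (fst q) i + d (snd q) i)"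
  have M: "d (fst q) i < M" "d (snd q) i < M" if "q \<in> S" for q i
  proof -
    have "d (fst q) i + d (snd q) i \<le> (\<Sum>i\<in>UNIV. d (fst q) i + d (snd q) i)"
      by (intro member_le_sum) auto
    also have "\<dots> \<le> (\<Sum>q\<in>S. \<Sum>i\<in>UNIV. d (fst q) i + d (snd q) i)"
      using S that by (intro member_le_sum) auto
    finally show "d (fst q) i < M" "d (snd q) i < M" by (auto simp: M_def)
  qed
  define z where "z = cis (2 * pi / M)"
  define Z where "Z = (UNIV :: 'k set) \<rightarrow>\<^sub>E {..<M}"
  have finZ: "finite Z" by (simp add: Z_def finite_PiE)
  have cardZ: "real (card Z) = real M ^ CARD('k)" by (simp add: Z_def card_PiE)
  have "\<forall>j. \<exists>h. star_hom h \<and> (\<forall>l\<in>L. h (t l) = cscale (zpow (\<lambda>i. z ^ j i) (d l)) (t l))"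
    by (intro allI gauge_exists) (simp add: z_def norm_power)
  then obtain h where h: "\<And>j. star_hom (h j)"
    "\<And>j. \<forall>l\<in>L. h j (t l) = cscale (zpow (\<lambda>i. z ^ j i) (d l)) (t l)" by metis
  have avg: "(\<Sum>j\<in>Z. zpow (\<lambda>i. z ^ j i) (d l) * cnj (zpow (\<lambda>i. z ^ j i) (d g)))
      = (if d l = d g then of_nat M ^ CARD('k) else 0)" if q: "(l, g) \<in> S" for l g
  proof -
    have "(\<Sum>j\<in>Z. zpow (\<lambda>i. z ^ j i) (d l) * cnj (zpow (\<lambda>i. z ^ j i) (d g)))
        = (\<Sum>j\<in>Z. \<Prod>i\<in>UNIV. (z ^ j i) ^ d l i * cnj ((z ^ j i) ^ d g i))"
      by (simp add: zpow_def prod.distrib)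
    also have "\<dots> = (\<Prod>i\<in>UNIV. \<Sum>s<M. (z ^ s) ^ d l i * cnj ((z ^ s) ^ d g i))"
      unfolding Z_def by (rule prod_sum_PiE[symmetric]) auto
    also have "\<dots> = (\<Prod>i\<in>UNIV. if d l i = d g i then of_nat M else 0)"
      using M[OF q] unfolding z_def by (intro prod.cong refl root_of_unity_sum) auto
    also have "\<dots> = (if d l = d g then of_nat M ^ CARD('k) else 0)"
      by (auto simp: fun_eq_iff)
    finally show ?thesis .
  qed
  have "(\<Sum>j\<in>Z. h j a) = (\<Sum>j\<in>Z. \<Sum>q\<in>S. cscale (c q) (h j (mq q)))"
    by (simp add: a_def star_hom_sum[OF h(1)] star_homD[OF h(1)])
  also have "\<dots> = (\<Sum>q\<in>S. cscale (c q) (\<Sum>j\<in>Z. h j (mq q)))"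
    by (subst sum.swap) (simp add: cscale_sum_right)
  also have "\<dots> = (\<Sum>q\<in>S. if d (fst q) = d (snd q)
      then cscale (of_nat M ^ CARD('k)) (cscale (c q) (mq q)) else 0)"
  proof (rule sum.cong[OF refl])
    fix q assume q: "q \<in> S"
    obtain l g where lg: "q = (l, g)" by (cases q)
    have "(\<Sum>j\<in>Z. h j (mq q)) = (\<Sum>j\<in>Z. cscale (zpow (\<lambda>i. z ^ j i) (d l) * cnj (zpow (\<lambda>i. z ^ j i) (d g))) (mq q))"
      using q S(2) by (intro sum.cong refl) (auto simp: lg mq_def gauge_mm[OF h])
    also have "\<dots> = cscale (if d l = d g then of_nat M ^ CARD('k) else 0) (mq q)"
      using avg q by (simp add: lg flip: cscale_sum_left)
    finally show "cscale (c q) (\<Sum>j\<in>Z. h j (mq q)) = (if d (fst q) = d (snd q)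
      then cscale (of_nat M ^ CARD('k)) (cscale (c q) (mq q)) else 0)"
      by (simp add: lg cscale_cscale mult.commute)
  qed
  also have "\<dots> = cscale (of_nat M ^ CARD('k)) a0"
    using S by (auto simp: a0_def cscale_sum_right sum.inter_filter intro!: sum.cong)
  finally have "norm (cscale (of_nat M ^ CARD('k)) a0) = norm (\<Sum>j\<in>Z. h j a)" by simp
  also have "\<dots> \<le> real (card Z) * (2 * norm a)"
    by (intro sum_norm_bound star_hom_norm_le h)
  finally have "real M ^ CARD('k) * norm a0 \<le> real M ^ CARD('k) * (2 * norm a)"
    by (simp add: norm_cscale norm_power cardZ)
  moreover have "0 < M" by (simp add: M_def)
  then have "0 < real M ^ CARD('k)" by simp
  ultimately show ?thesis unfolding a_def a0_def by (simp only: mult_le_cancel_left_pos)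
qed

end

section \<open>Gauge-invariant KMS states\<close>

lemma rdot_add: "rdot r (\<lambda>i. f i + g i) = rdot r f + rdot r g"
  by (simp add: rdot_def distrib_left sum.distrib)

lemma rdot_diff: "rdot r (\<lambda>i. f i - g i) = rdot r f - rdot r g"
  by (simp add: rdot_def right_diff_distrib sum_subtractf)

lemma bounded_linear_sum: "bounded_linear w \<Longrightarrow> w (\<Sum>i\<in>I. f i) = (\<Sum>i\<in>I. w (f i))"
  by (simp add: bounded_linear.linear linear_sum)

lemma exp_rdot: "exp (- \<beta> * rdot r (\<lambda>i. real (n i))) * mpower (\<lambda>i. exp (\<beta> * r i)) n = 1"
proof -
  have "mpower (\<lambda>i. exp (\<beta> * r i)) n = exp (\<beta> * rdot r (\<lambda>i. real (n i)))"
    by (simp add: mpower_def rdot_def exp_sum sum_distrib_left algebra_simps flip: exp_of_nat_mult)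
  then show ?thesis by (simp flip: exp_add)
qed

context kgraph
begin

lemma sum_range_deg:
  "(\<Sum>l\<in>{l\<in>L. rg l = v \<and> d l = n}. x (src l)) = (\<Sum>w\<in>V. pc n v w * x w)"
proof -
  have "(\<Sum>l\<in>{l\<in>L. rg l = v \<and> d l = n}. x (src l))
      = (\<Sum>w\<in>V. \<Sum>l\<in>{l\<in>{l\<in>L. rg l = v \<and> d l = n}. src l = w}. x (src l))"
    by (rule sum.group[symmetric]) auto
  also have "\<dots> = (\<Sum>w\<in>V. \<Sum>l\<in>pths v n w. x w)"
    by (intro sum.cong refl) (auto simp: paths_def)
  finally show ?thesis by (simp add: pc_def)
qed

end

section \<open>The functional prescribed by a joint eigenvector\<close>

locale graph_algebra_weight = graph_algebra L d rg src cmp t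
  for L :: "'p set" and d :: "'p \<Rightarrow> 'k::finite \<Rightarrow> nat" and rg src :: "'p \<Rightarrow> 'p"
    and cmp :: "'p \<Rightarrow> 'p \<Rightarrow> 'p" and t :: "'p \<Rightarrow> 'a::cstar_algebra" +
  fixes r :: "'k \<Rightarrow> real" and \<beta> :: real and \<psi> :: "'p \<Rightarrow> real"
  assumes psi: "\<psi> \<in> joint_eigenvectors (\<lambda>i. exp (\<beta> * r i))"
begin

text \<open>The value wanted at \<open>mm l l\<close>. It behaves like the measure of the cylinder
  of all long paths that start with \<open>l\<close>.\<close>

definition \<rho> :: "'p \<Rightarrow> real" where
  "\<rho> l = exp (- \<beta> * rdot r (\<lambda>i. real (d l i))) * \<psi> (src l)"

definition \<phi> :: "'p \<times> 'p \<Rightarrow> complex" where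
  "\<phi> q = (if fst q = snd q then of_real (\<rho> (fst q)) else 0)"

lemma psi_nonneg: "0 \<le> \<psi> v" and psi_sum: "(\<Sum>v\<in>V. \<psi> v) = 1"
  using psi by (auto simp: joint_eigenvectors_def)

lemma rho_nonneg [simp]: "0 \<le> \<rho> l"
  by (simp add: \<rho>_def psi_nonneg)

lemma psi_range_deg:
  "v \<in> V \<Longrightarrow> exp (- \<beta> * rdot r (\<lambda>i. real (n i))) * (\<Sum>l\<in>range_deg v n. \<psi> (src l)) = \<psi> v"
proof -
  assume v: "v \<in> V"
  have "(\<Sum>w\<in>V. pc n v w * \<psi> w) = mpower (\<lambda>i. exp (\<beta> * r i)) n * \<psi> v"
    using psi v by (intro joint_eigenvector) (auto simp: joint_eigenvectors_def)
  then show ?thesis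
    using exp_rdot[of \<beta> r n] by (simp add: sum_range_deg mult.assoc[symmetric])
qed

lemma rho_cmp:
  "l \<in> L \<Longrightarrow> k \<in> L \<Longrightarrow> src l = rg k \<Longrightarrow>
    \<rho> (cmp l k) = exp (- \<beta> * rdot r (\<lambda>i. real (d l i))) * \<rho> k"
  by (simp add: \<rho>_def rdot_add exp_add[symmetric] algebra_simps)

text \<open>Additivity of the cylinder measure: the extensions of \<open>l\<close> by degree
  \<open>n\<close> split the cylinder of \<open>l\<close>. This is the eigenvector equation for A^n
  at the source of \<open>l\<close>.\<close>

lemma rho_prefix:
  assumes l: "l \<in> L"
  shows "(\<Sum>x\<in>{x\<in>L. d x = d l + n \<and> prefix l x}. \<rho> x) = \<rho> l"
proof -
  have "(\<Sum>x\<in>{x\<in>L. d x = d l + n \<and> prefix l x}. \<rho> x) = (\<Sum>k\<in>range_deg (src l) n. \<rho> (cmp l k))"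
  proof (rule sum.reindex_bij_betw[symmetric])
    have "inj_on (cmp l) (range_deg (src l) n)"
    proof (rule inj_onI)
      fix k k' assume k: "k \<in> range_deg (src l) n" "k' \<in> range_deg (src l) n" "cmp l k = cmp l k'"
      show "k = k'" by (rule cmp_cancel(2)[of l k l k']) (use k l in simp_all)
    qed
    moreover have "cmp l ` range_deg (src l) n = {x\<in>L. d x = d l + n \<and> prefix l x}"
    proof (intro equalityI subsetI)
      fix x assume "x \<in> {x\<in>L. d x = d l + n \<and> prefix l x}"
      then obtain k where k: "k \<in> L" "rg k = src l" "x = cmp l k" "d x = d l + n"
        by (auto simp: prefix_def)
      then have "d l + d k = d l + n" using cmp(4)[of l k] l by simp
      then have "d k = n" by (rule add_left_imp_eq)
      then show "x \<in> cmp l ` range_deg (src l) n" using k by auto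
    next
      fix x assume "x \<in> cmp l ` range_deg (src l) n"
      then obtain k where k: "k \<in> L" "rg k = src l" "d k = n" "x = cmp l k" by auto
      then have "x \<in> L" "d x = d l + n" using cmp[of l k] l by auto
      then show "x \<in> {x\<in>L. d x = d l + n \<and> prefix l x}" using k by (auto simp: prefix_def)
    qed
    ultimately show "bij_betw (cmp l) (range_deg (src l) n) {x\<in>L. d x = d l + n \<and> prefix l x}"
      by (simp add: bij_betw_def)
  qed
  also have "\<dots> = (\<Sum>k\<in>range_deg (src l) n. exp (- \<beta> * rdot r (\<lambda>i. real (d l i))) * \<rho> k)"
    using l by (intro sum.cong refl rho_cmp) simp_all
  also have "\<dots> = (\<Sum>k\<in>range_deg (src l) n. exp (- \<beta> * rdot r (\<lambda>i. real (d l i))) *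
      (exp (- \<beta> * rdot r (\<lambda>i. real (n i))) * \<psi> (src k)))"
    by (intro sum.cong refl) (simp add: \<rho>_def)
  also have "\<dots> = exp (- \<beta> * rdot r (\<lambda>i. real (d l i))) * \<psi> (src l)"
    using psi_range_deg[of "src l" n] l by (simp only: sum_distrib_left[symmetric] rg_src_V)
  finally show ?thesis by (simp add: \<rho>_def)
qed

lemma rho_degree_sum: "(\<Sum>x\<in>{x\<in>L. d x = n}. \<rho> x) = 1"
proof -
  have "(\<Sum>x\<in>{x\<in>L. d x = n}. \<rho> x) = (\<Sum>v\<in>V. \<Sum>x\<in>{x\<in>{x\<in>L. d x = n}. rg x = v}. \<rho> x)"
    using finite_degree by (intro sum.group[symmetric]) auto
  also have "\<dots> = (\<Sum>v\<in>V. \<Sum>x\<in>range_deg v n. exp (- \<beta> * rdot r (\<lambda>i. real (n i))) * \<psi> (src x))"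
    by (intro sum.cong) (auto simp: \<rho>_def)
  also have "\<dots> = (\<Sum>v\<in>V. \<psi> v)"
    by (intro sum.cong refl) (simp only: psi_range_deg sum_distrib_left[symmetric])
  finally show ?thesis by (simp add: psi_sum)
qed

text \<open>Compressing the degree-zero part \<open>a\<^sub>0\<close> by \<open>t\<^sub>x\<close> with \<open>d x = N\<close> large gives
  a scalar multiple of a vertex projection, and the functional is a convex combination of these scalars.\<close>
lemma functional_bound:
  assumes S: "finite S" "S \<subseteq> L \<times> L"
  shows "cmod (\<Sum>q\<in>S. c q * \<phi> q) \<le> 2 * norm (\<Sum>q\<in>S. cscale (c q) (mq q))"
proof -
  define S0 where "S0 = {q\<in>S. d (fst q) = d (snd q)}"
  define a0 where "a0 = (\<Sum>q\<in>S0. cscale (c q) (mq q))"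
  \<comment> \<open>\<open>N\<close> dominates the degree of every first entry, so for a path
    \<open>x\<close> of degree \<open>N\<close> each such entry either is an initial segment of
    \<open>x\<close> or is orthogonal to it.\<close>
  define N where "N i = (\<Sum>q\<in>S. d (fst q) i)" for i
  define X where "X = {x\<in>L. d x = N}"
  have finX: "finite X" unfolding X_def by (rule finite_degree)
  define K where "K x = (\<Sum>q\<in>S0. if fst q = snd q \<and> prefix (fst q) x then c q else 0)" for x
  have N: "\<exists>n. N = d (fst q) + n" if "q \<in> S" for q
  proof -
    have "d (fst q) i \<le> N i" for i unfolding N_def using S that by (intro member_le_sum) auto
    then show ?thesis by (intro exI[of _ "\<lambda>i. N i - d (fst q) i"]) (auto simp: fun_eq_iff)
  qed
  have finS0: "finite S0" using S by (simp add: S0_def)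
  have K: "cmod (K x) \<le> norm a0" if x: "x \<in> X" for x
  proof -
    have "adj (t x) * a0 * t x = (\<Sum>q\<in>S0. cscale (c q) (adj (t x) * mq q * t x))"
      by (simp add: a0_def sum_distrib_left sum_distrib_right flip: cscale_mult_left cscale_mult_right)
    also have "\<dots> = (\<Sum>q\<in>S0. cscale (if fst q = snd q \<and> prefix (fst q) x then c q else 0) (t (src x)))"
    proof (rule sum.cong[OF refl])
      fix q assume q: "q \<in> S0"
      then have "q \<in> S" by (simp add: S0_def)
      then obtain n where n: "N = d (fst q) + n" using N by blast
      have "adj (t x) * mm (fst q) (snd q) * t x = (if fst q = snd q \<and> prefix (fst q) x then t (src x) else 0)"
        using q x S n by (intro compress_mm[of _ _ _ n]) (auto simp: S0_def X_def)
      then show "cscale (c q) (adj (t x) * mq q * t x)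
          = cscale (if fst q = snd q \<and> prefix (fst q) x then c q else 0) (t (src x))"
        by (cases "fst q = snd q \<and> prefix (fst q) x") (auto simp: mq_def)
    qed
    also have "\<dots> = cscale (K x) (t (src x))" by (simp add: K_def cscale_sum_left)
    finally have "cmod (K x) = norm (adj (t x) * a0 * t x)"
      using x by (simp add: norm_cscale norm_t X_def)
    also have "\<dots> \<le> norm (adj (t x)) * norm a0 * norm (t x)"
      by (intro order_trans[OF norm_mult_ineq] mult_right_mono norm_mult_ineq) auto
    finally show ?thesis using x by (simp add: norm_t X_def)
  qed
  have "(\<Sum>q\<in>S. c q * \<phi> q) = (\<Sum>q\<in>S0. c q * \<phi> q)"
    using S by (intro sum.mono_neutral_right) (auto simp: S0_def \<phi>_def)
  also have "\<dots> = (\<Sum>q\<in>S0. \<Sum>x\<in>X. of_real (\<rho> x) * (if fst q = snd q \<and> prefix (fst q) x then c q else 0))"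
  proof (rule sum.cong[OF refl])
    fix q assume q: "q \<in> S0"
    then have "q \<in> S" by (simp add: S0_def)
      then obtain n where n: "N = d (fst q) + n" using N by blast
    show "c q * \<phi> q = (\<Sum>x\<in>X. of_real (\<rho> x) * (if fst q = snd q \<and> prefix (fst q) x then c q else 0))"
    proof (cases "fst q = snd q")
      case True
      have "\<rho> (fst q) = (\<Sum>x\<in>{x\<in>L. d x = d (fst q) + n \<and> prefix (fst q) x}. \<rho> x)"
        using q S by (intro rho_prefix[symmetric]) (auto simp: S0_def)
      also have "\<dots> = (\<Sum>x\<in>X. if prefix (fst q) x then \<rho> x else 0)"
        using finX by (subst sum.inter_filter[symmetric]) (auto simp: X_def n intro: sum.cong)
      finally have "\<phi> q = (\<Sum>x\<in>X. of_real (if prefix (fst q) x then \<rho> x else 0))"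
        using True by (simp add: \<phi>_def)
      then show ?thesis
        using True by (auto simp: sum_distrib_left intro!: sum.cong)
    qed (simp add: \<phi>_def)
  qed
  also have "\<dots> = (\<Sum>x\<in>X. of_real (\<rho> x) * K x)"
    by (subst sum.swap) (simp add: K_def sum_distrib_left)
  also have "cmod \<dots> \<le> (\<Sum>x\<in>X. \<rho> x * norm a0)"
    using K by (intro sum_norm_le) (auto simp: norm_mult intro!: mult_left_mono)
  also have "\<dots> = norm a0" using rho_degree_sum[of N] by (simp add: X_def flip: sum_distrib_right)
  also have "norm a0 \<le> 2 * norm (\<Sum>q\<in>S. cscale (c q) (mq q))"
    unfolding a0_def S0_def by (rule gauge_average[OF S])
  finally show ?thesis .
qed

lemma functional_exists:
  "\<exists>w::'a \<Rightarrow> complex. bounded_linear w \<and> (\<forall>c a. w (cscale c a) = c * w a)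
    \<and> (\<forall>l\<in>L. \<forall>g\<in>L. w (mm l g) = (if l = g then of_real (\<rho> l) else 0))"
proof -
  obtain w where w: "bounded_linear w" "\<And>c a. w (cscale c a) = c * w a"
    and wq: "\<And>q. q \<in> L \<times> L \<Longrightarrow> w (mq q) = \<phi> q"
    by (rule extend_functional[OF dense _ functional_bound]) auto
  have "w (mm l g) = (if l = g then of_real (\<rho> l) else 0)" if "l \<in> L" "g \<in> L" for l g
    using wq[of "(l, g)"] that by (simp add: mq_def \<phi>_def)
  then show ?thesis using w by blast
qed

end

section \<open>Positivity and uniqueness of functionals\<close>

context graph_algebra
begin

text \<open>Only the first degree is made constant. That suffices for \<open>adj a * a\<close>,
  where the first entries meet in the middle, and makes \<open>mm_mult\<close> applicable without
  further expansion.\<close>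

lemma span_normal_form:
  assumes "a \<in> cstar_span (mq ` (L \<times> L))"
  obtains N where "a \<in> cstar_span (mq ` {q\<in>L\<times>L. d (fst q) = N \<and> src (fst q) = src (snd q)})"
proof -
  obtain S c where S: "finite S" "S \<subseteq> L \<times> L" "a = (\<Sum>q\<in>S. cscale (c q) (mq q))"
    using assms by (rule cstar_span_imageE)
  define N where "N i = (\<Sum>q\<in>S. d (fst q) i)" for i
  define Q where "Q = {q\<in>L\<times>L. d (fst q) = N \<and> src (fst q) = src (snd q)}"
  have "mq q \<in> cstar_span (mq ` Q)" if q: "q \<in> S" for q
  proof (cases "src (fst q) = src (snd q)")
    case True
    have qL: "fst q \<in> L" "snd q \<in> L" using q S by auto
    have "d (fst q) i \<le> N i" for i unfolding N_def using S q by (intro member_le_sum) auto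
    then have N: "N = d (fst q) + (\<lambda>i. N i - d (fst q) i)" by (auto simp: fun_eq_iff)
    define n where "n = (\<lambda>i. N i - d (fst q) i)"
    have "mq q = (\<Sum>k\<in>range_deg (src (snd q)) n. mq (cmp (fst q) k, cmp (snd q) k))"
      unfolding mq_def using mm_expand[OF qL True, of n] by simp
    also have "\<dots> \<in> cstar_span (mq ` Q)"
    proof (intro cstar_span_sum cstar_span_base imageI)
      fix k assume k: "k \<in> range_deg (src (snd q)) n"
      then have "d (cmp (fst q) k) = N"
        using qL True cmp(4)[of "fst q" k] N by (simp add: n_def)
      then show "(cmp (fst q) k, cmp (snd q) k) \<in> Q" using k qL True by (auto simp: Q_def)
    qed
    finally show ?thesis .
  next
    case False
    then have "mq q = 0" using q S mm_eq_0[of "fst q" "snd q"] by (auto simp: mq_def)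
    then show ?thesis by (simp add: cstar_span_0)
  qed
  then have "a \<in> cstar_span (mq ` Q)"
    unfolding S(3) by (intro cstar_span_sum cstar_span_cscale)
  then show ?thesis unfolding Q_def by (rule that)
qed

lemma adj_mm: "adj (mm l g) = mm g l"
  by (simp add: mm_def adj_mult adj_adj)

lemma mm_vert: "v \<in> V \<Longrightarrow> mm v v = t v"
  by (simp add: mm_def t_vert)

text \<open>Rewriting \<open>a\<close> as a combination of elements \<open>t\<^sub>x t\<^sub>y\<^sup>*\<close> with \<open>d x\<close> constant makes
  \<open>\<omega>(a\<^sup>* a)\<close> a sum of squares.\<close>
lemma positive_functional:
  fixes w :: "'a \<Rightarrow> complex"
  assumes w: "bounded_linear w" "\<And>c a. w (cscale c a) = c * w a"
    and wm: "\<And>l g. l \<in> L \<Longrightarrow> g \<in> L \<Longrightarrow> w (mm l g) = (if l = g then of_real (\<rho> l) else 0)"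
    and \<rho>: "\<And>l. l \<in> L \<Longrightarrow> 0 \<le> \<rho> l"
  shows "Im (w (adj a * a)) = 0 \<and> 0 \<le> Re (w (adj a * a))"
proof -
  define G where "G = {a. Im (w (adj a * a)) = 0 \<and> 0 \<le> Re (w (adj a * a))}"
  have cont: "continuous_on UNIV (\<lambda>a. w (adj a * a))"
    by (intro bounded_linear.continuous_on[OF w(1)] continuous_intros
        bounded_linear.continuous_on[OF bounded_linear_adj])
  have "closed G"
    unfolding G_def
    by (intro closed_Collect_conj closed_Collect_eq closed_Collect_le continuous_intros cont)
  moreover have "cstar_span (mq ` (L \<times> L)) \<subseteq> G"
  proof
    fix a assume "a \<in> cstar_span (mq ` (L \<times> L))"
    then obtain N where "a \<in> cstar_span (mq ` {q\<in>L\<times>L. d (fst q) = N \<and> src (fst q) = src (snd q)})"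
      by (rule span_normal_form)
    then obtain S c where S: "finite S" "S \<subseteq> {q\<in>L\<times>L. d (fst q) = N \<and> src (fst q) = src (snd q)}"
      and a: "a = (\<Sum>q\<in>S. cscale (c q) (mq q))"
      by (rule cstar_span_imageE)
    have wsum: "w (\<Sum>i\<in>I. f i) = (\<Sum>i\<in>I. w (f i))" for I :: "('p \<times> 'p) set" and f
      by (rule bounded_linear_sum[OF w(1)])
    have summand: "w (adj (mq p) * mq q) = (if p = q then of_real (\<rho> (snd p)) else 0)"
      if p: "p \<in> S" and q: "q \<in> S" for p q
    proof -
      have "adj (mq p) * mq q = (if fst p = fst q then mm (snd p) (snd q) else 0)"
        unfolding mq_def adj_mm using p q S by (intro mm_mult) auto
      moreover have "snd p \<in> L" "snd q \<in> L" using p q S(2) by auto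
      ultimately show ?thesis
        using wm[of "snd p" "snd q"] w(2)[of 0 0] by (auto simp: prod_eq_iff)
    qed
    have "adj a * a = (\<Sum>p\<in>S. \<Sum>q\<in>S. cscale (cnj (c p) * c q) (adj (mq p) * mq q))"
      by (simp add: a adj_sum adj_cscale sum_product cscale_cscale mult.commute
          flip: cscale_mult_left cscale_mult_right)
    then have "w (adj a * a) = (\<Sum>p\<in>S. \<Sum>q\<in>S. cnj (c p) * c q * w (adj (mq p) * mq q))"
      by (simp add: wsum w(2))
    also have "\<dots> = (\<Sum>p\<in>S. \<Sum>q\<in>S. if p = q then cnj (c p) * c p * of_real (\<rho> (snd p)) else 0)"
      by (intro sum.cong refl) (simp add: summand)
    also have "\<dots> = (\<Sum>p\<in>S. of_real ((cmod (c p))\<^sup>2 * \<rho> (snd p)))"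
    proof (rule sum.cong[OF refl])
      fix p assume "p \<in> S"
      moreover have "cnj (c p) * c p = of_real ((cmod (c p))\<^sup>2)"
        by (simp only: complex_norm_square mult.commute)
      ultimately show "(\<Sum>q\<in>S. if p = q then cnj (c p) * c p * of_real (\<rho> (snd p)) else 0)
          = of_real ((cmod (c p))\<^sup>2 * \<rho> (snd p))"
        using S(1) by simp
    qed
    also have "\<dots> = of_real (\<Sum>p\<in>S. (cmod (c p))\<^sup>2 * \<rho> (snd p))" by simp
    finally have *: "w (adj a * a) = of_real (\<Sum>p\<in>S. (cmod (c p))\<^sup>2 * \<rho> (snd p))" .
    have "0 \<le> (\<Sum>p\<in>S. (cmod (c p))\<^sup>2 * \<rho> (snd p))"
      using S \<rho> by (intro sum_nonneg mult_nonneg_nonneg) auto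
    then show "a \<in> G" unfolding G_def mem_Collect_eq * by simp
  qed
  ultimately have "closure (cstar_span (mq ` (L \<times> L))) \<subseteq> G" by (rule closure_minimal[rotated])
  then show ?thesis using dense by (auto simp: G_def)
qed

lemma functional_eqI:
  fixes w w' :: "'a \<Rightarrow> complex"
  assumes w: "bounded_linear w" "\<And>c a. w (cscale c a) = c * w a"
    and w': "bounded_linear w'" "\<And>c a. w' (cscale c a) = c * w' a"
    and eq: "\<And>l g. l \<in> L \<Longrightarrow> g \<in> L \<Longrightarrow> w (mm l g) = w' (mm l g)"
  shows "w a = w' a"
proof (rule dense_eqI[OF dense])
  fix a assume "a \<in> cstar_span (mq ` (L \<times> L))"
  then obtain S c where S: "finite S" "S \<subseteq> L \<times> L" and a: "a = (\<Sum>q\<in>S. cscale (c q) (mq q))"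
    by (rule cstar_span_imageE)
  have "w a = (\<Sum>q\<in>S. c q * w (mq q))" "w' a = (\<Sum>q\<in>S. c q * w' (mq q))"
    by (simp_all add: a bounded_linear_sum[OF w(1)] bounded_linear_sum[OF w'(1)] w(2) w'(2))
  then show "w a = w' a"
    using S(2) eq by (auto simp: mq_def intro!: sum.cong)
qed (auto intro!: bounded_linear.continuous_on[OF w(1)] bounded_linear.continuous_on[OF w'(1)] continuous_intros)

end

context graph_algebra_weight
begin

text \<open>The two equations on \<open>(j, k)\<close> trade places when the factors are exchanged,
  so both sides of the KMS condition become sums over the same pairs.\<close>

lemma functional_product:
  fixes w :: "'a \<Rightarrow> complex"
  assumes w: "bounded_linear w"
    and wm: "\<And>l g. l \<in> L \<Longrightarrow> g \<in> L \<Longrightarrow> w (mm l g) = (if l = g then of_real (\<rho> l) else 0)"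
    and "l \<in> L" "g \<in> L" "m \<in> L" "n \<in> L" "src l = src g" "src m = src n" "d g + a = d m + b"
  shows "w (mm l g * mm m n) = (\<Sum>j\<in>range_deg (src g) a. \<Sum>k\<in>range_deg (src n) b.
      if cmp g j = cmp m k \<and> cmp l j = cmp n k then of_real (\<rho> (cmp l j)) else 0)"
proof -
  have w0: "w 0 = 0" using linear_0[OF bounded_linear.linear[OF w]] .
  have "w (mm l g * mm m n) = (\<Sum>j\<in>range_deg (src g) a. \<Sum>k\<in>range_deg (src n) b.
      w (if cmp g j = cmp m k then mm (cmp l j) (cmp n k) else 0))"
    unfolding mm_mult_expand[OF assms(3-9)]
    by (simp add: bounded_linear_sum[OF w])
  also have "\<dots> = (\<Sum>j\<in>range_deg (src g) a. \<Sum>k\<in>range_deg (src n) b.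
      if cmp g j = cmp m k \<and> cmp l j = cmp n k then of_real (\<rho> (cmp l j)) else 0)"
    using assms(3-8) by (intro sum.cong refl) (auto simp: wm w0)
  finally show ?thesis .
qed

text \<open>A pair \<open>(j, k)\<close> has weight \<open>\<rho> (cmp l j)\<close> on one side and
  \<open>\<rho> (cmp m k) = \<rho> (cmp g j)\<close> on the other. The tail \<open>j\<close> is
  shared, so the ratio depends only on \<open>d l\<close> and \<open>d g\<close> and is the KMS
  factor. If \<open>d n + d g\<close> and \<open>d l + d m\<close> differ, no pair contributes on
  either side.\<close>

lemma functional_KMS:
  fixes w :: "'a \<Rightarrow> complex"
  assumes w: "bounded_linear w"
    and wm: "\<And>l g. l \<in> L \<Longrightarrow> g \<in> L \<Longrightarrow> w (mm l g) = (if l = g then of_real (\<rho> l) else 0)"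
    and L: "l \<in> L" "g \<in> L" "m \<in> L" "n \<in> L"
  shows "w (mm l g * mm m n)
    = of_real (exp (- \<beta> * rdot r (\<lambda>i. real (d l i) - real (d g i)))) * w (mm m n * mm l g)"
proof (cases "src l = src g \<and> src m = src n")
  case False
  then have "mm l g = 0 \<or> mm m n = 0" using mm_eq_0 L by blast
  then show ?thesis using linear_0[OF bounded_linear.linear[OF w]] by auto
next
  case True
  then have s: "src l = src g" "src m = src n" by auto
  define e where "e = exp (- \<beta> * rdot r (\<lambda>i. real (d l i) - real (d g i)))"
  define R1 R2 where "R1 = range_deg (src g) (d m)" and "R2 = range_deg (src n) (d g)"
  have 1: "w (mm l g * mm m n) = (\<Sum>j\<in>R1. \<Sum>k\<in>R2.
      if cmp g j = cmp m k \<and> cmp l j = cmp n k then of_real (\<rho> (cmp l j)) else 0)"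
    unfolding R1_def R2_def
    by (rule functional_product[OF w wm L s]) (auto simp: add.commute)
  show ?thesis
  proof (cases "d n + d g = d l + d m")
    case True
    \<comment> \<open>In the balanced case the reversed product, with inner degrees
      \<open>d n\<close> and \<open>d l\<close>, can be raised by \<open>d g\<close> and
      \<open>d m\<close>; these are the index sets \<open>R2\<close> and \<open>R1\<close> already
      in use.\<close>
    have 2: "w (mm m n * mm l g) = (\<Sum>k\<in>R2. \<Sum>j\<in>R1.
        if cmp n k = cmp l j \<and> cmp m k = cmp g j then of_real (\<rho> (cmp m k)) else 0)"
      using functional_product[OF w wm L(3,4,1,2) s(2,1) True] s
      by (simp add: R1_def R2_def)
    have e: "\<rho> (cmp l j) = e * \<rho> (cmp g j)" if "j \<in> R1" for j
      using that L s
      by (simp add: R1_def rho_cmp e_def rdot_diff algebra_simps flip: exp_add)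
    have "w (mm l g * mm m n) = (\<Sum>j\<in>R1. \<Sum>k\<in>R2. of_real e *
        (if cmp n k = cmp l j \<and> cmp m k = cmp g j then of_real (\<rho> (cmp m k)) else 0))"
      unfolding 1 using e by (intro sum.cong refl) auto
    also have "\<dots> = of_real e * w (mm m n * mm l g)"
      unfolding 2 by (subst sum.swap) (simp add: sum_distrib_left)
    finally show ?thesis by (simp add: e_def)
  next
    case False
    have "w (mm l g * mm m n) = 0"
      unfolding 1
    proof (intro sum.neutral ballI)
      fix j k assume jk: "j \<in> R1" "k \<in> R2"
      have "cmp l j \<noteq> cmp n k"
      proof
        assume "cmp l j = cmp n k"
        moreover have "d (cmp l j) = d l + d m" "d (cmp n k) = d n + d g"
          using jk L s by (auto simp: R1_def R2_def)
        ultimately show False using False by simp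
      qed
      then show "(if cmp g j = cmp m k \<and> cmp l j = cmp n k then complex_of_real (\<rho> (cmp l j)) else 0) = 0"
        by simp
    qed
    moreover have "w (mm m n * mm l g) = 0"
    proof -
      have 2: "w (mm m n * mm l g) = (\<Sum>k\<in>range_deg (src n) (d l). \<Sum>j\<in>range_deg (src g) (d n).
          if cmp n k = cmp l j \<and> cmp m k = cmp g j then of_real (\<rho> (cmp m k)) else 0)"
        using functional_product[OF w wm L(3,4,1,2) s(2,1), of "d l" "d n"] s
        by (simp add: add.commute)
      show ?thesis
        unfolding 2
      proof (intro sum.neutral ballI)
        fix k j assume jk: "k \<in> range_deg (src n) (d l)" "j \<in> range_deg (src g) (d n)"
        have "cmp m k \<noteq> cmp g j"
        proof
          assume "cmp m k = cmp g j"
          moreover have "d (cmp m k) = d m + d l" "d (cmp g j) = d g + d n"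
            using jk L s by auto
          ultimately show False using False by (simp add: add.commute)
        qed
        then show "(if cmp n k = cmp l j \<and> cmp m k = cmp g j then complex_of_real (\<rho> (cmp m k)) else 0) = 0"
          by simp
      qed
    qed
    ultimately show ?thesis by simp
  qed
qed

lemma gi_KMS_state_exists:
  obtains w where "w \<in> gi_KMS_states L d t r \<beta>" "\<And>v. v \<in> V \<Longrightarrow> w (t v) = of_real (\<psi> v)"
proof -
  obtain w where w: "bounded_linear w" "\<And>c a. w (cscale c a) = c * w a"
    and wm: "\<And>l g. l \<in> L \<Longrightarrow> g \<in> L \<Longrightarrow> w (mm l g) = (if l = g then of_real (\<rho> l) else 0)"
    using functional_exists by blast
  have wv: "w (t v) = of_real (\<psi> v)" if "v \<in> V" for v
    using wm[of v v] mm_vert[OF that] that by (simp add: \<rho>_def rdot_def)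
  have "w 1 = (\<Sum>v\<in>V. w (t v))"
    unfolding one_eq by (rule bounded_linear_sum[OF w(1)])
  also have "\<dots> = 1" using psi_sum wv by (simp flip: of_real_sum)
  finally have "is_state w"
    unfolding is_state_def
    using w(2) positive_functional[OF w wm] linear_add[OF bounded_linear.linear[OF w(1)]] by auto
  moreover have "is_KMS L d t r \<beta> w"
    unfolding is_KMS_def cscale_mult_right[symmetric] w(2) mm_def[symmetric]
    using \<open>is_state w\<close> by (intro conjI ballI functional_KMS[OF w(1) wm])
  moreover have "gauge_invariant L d t w"
    unfolding gauge_invariant_def
  proof (intro allI impI)
    fix z :: "'k \<Rightarrow> complex" and h a
    assume z: "\<forall>i. cmod (z i) = 1"
      and "star_hom h \<and> (\<forall>l\<in>L. h (t l) = cscale (\<Prod>i\<in>UNIV. z i ^ d l i) (t l))"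
    then have h: "star_hom h" "\<forall>l\<in>L. h (t l) = cscale (zpow z (d l)) (t l)"
      by (auto simp: zpow_def)
    have zz: "zpow z n * cnj (zpow z n) = 1" for n
      using cmod_zpow[OF z, of n] by (simp add: complex_norm_square[symmetric])
    \<comment> \<open>Both functionals agree on the spanning elements: \<open>h\<close> fixes the
      diagonal ones, and the others have value 0 on either side.\<close>
    show "w (h a) = w a"
    proof (rule functional_eqI[of "\<lambda>a. w (h a)" w])
      show "bounded_linear (\<lambda>a. w (h a))"
        by (rule bounded_linear_compose[OF w(1) star_hom_bounded_linear[OF h(1)]])
      show "w (h (cscale c a)) = c * w (h a)" for c a by (simp add: star_homD[OF h(1)] w(2))
      show "w (h (mm l g)) = w (mm l g)" if "l \<in> L" "g \<in> L" for l g
        using gauge_mm[OF h that] zz by (simp add: w(2) wm that)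
    qed (use w in auto)
  qed
  ultimately show ?thesis using that wv by (simp add: gi_KMS_states_def)
qed

end

section \<open>From gauge-invariant KMS states to eigenvectors\<close>

context graph_algebra
begin

text \<open>Gauge invariance kills the elements of unequal degrees. For equal degrees the KMS
  condition moves \<open>t l\<close> to the right of \<open>adj (t g)\<close>, where orthogonality
  leaves only \<open>l = g\<close>.\<close>

lemma gi_KMS_value:
  assumes w: "w \<in> gi_KMS_states L d t r \<beta>" and l: "l \<in> L" "g \<in> L"
  shows "w (mm l g) = (if l = g then of_real (exp (- \<beta> * rdot r (\<lambda>i. real (d l i)))) * w (t (src l)) else 0)"
proof -
  have state: "is_state w" and gi: "gauge_invariant L d t w"
    and KMS: "\<forall>l\<in>L. \<forall>g\<in>L. \<forall>m\<in>L. \<forall>n\<in>L.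
        w ((t l * adj (t g)) * (t m * adj (t n))) =
        w ((t m * adj (t n)) * cscale (complex_of_real (exp (- \<beta> * rdot r (\<lambda>i. real (d l i) - real (d g i)))))
                                     (t l * adj (t g)))"
    using w by (auto simp: gi_KMS_states_def is_KMS_def)
  show ?thesis
  proof (cases "d l = d g")
    case False
    then obtain i where i: "d l i \<noteq> d g i" by auto
    \<comment> \<open>The angle makes the gauge factor of \<open>mm l g\<close> equal to -1, so its
      value equals its own negative.\<close>
    define \<theta> where "\<theta> = pi / (real (d l i) - real (d g i))"
    define z where "z = (\<lambda>j. if j = i then cis \<theta> else 1)"
    have z: "\<forall>j. cmod (z j) = 1" by (simp add: z_def)
    have zp: "zpow z n = cis \<theta> ^ n i" for n
    proof -
      have "zpow z n = (\<Prod>j\<in>UNIV. if j = i then cis \<theta> ^ n i else 1)"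
        unfolding zpow_def z_def by (intro prod.cong) auto
      then show ?thesis by simp
    qed
    have "zpow z (d l) * cnj (zpow z (d g)) = cis (real (d l i) * \<theta>) * cis (- (real (d g i) * \<theta>))"
      by (simp only: zp Complex.DeMoivre cis_cnj)
    also have "\<dots> = cis ((real (d l i) - real (d g i)) * \<theta>)"
      by (simp add: cis_mult algebra_simps)
    also have "(real (d l i) - real (d g i)) * \<theta> = pi" using i by (simp add: \<theta>_def)
    finally have m1: "zpow z (d l) * cnj (zpow z (d g)) = -1" by simp
    obtain h where h: "star_hom h" "\<forall>l\<in>L. h (t l) = cscale (zpow z (d l)) (t l)"
      using gauge_exists[OF z] by blast
    have "w (mm l g) = w (h (mm l g))"
      using gi z h unfolding gauge_invariant_def zpow_def by metis
    also have "\<dots> = - w (mm l g)" unfolding gauge_mm[OF h l] m1 by (simp add: is_stateD[OF state])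
    finally show ?thesis using False by auto
  next
    case True
    define e where "e = exp (- \<beta> * rdot r (\<lambda>i. real (d l i)))"
    \<comment> \<open>Source projections are inserted so that each factor has the shape required by
      \<open>is_KMS\<close>.\<close>
    have "mm l g = (t l * adj (t (src l))) * (t (src g) * adj (t g))"
      using t_units(2)[OF l(1)] t_units(4)[OF l(2)] l t_vert(1) by (simp add: mm_def)
    then have "w (mm l g) = w ((t (src g) * adj (t g)) * cscale (of_real e) (t l * adj (t (src l))))"
      using KMS l by (simp add: e_def)
    also have "\<dots> = of_real e * w (adj (t g) * t l)"
      using t_units(2)[OF l(1)] t_units(4)[OF l(2)] l t_vert(1)
      by (simp add: is_stateD[OF state] flip: cscale_mult_right)
    also have "adj (t g) * t l = (if l = g then t (src l) else 0)"
      using t_orthogonal[OF l(2,1)] t_isometry[OF l(1)] True by auto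
    finally show ?thesis by (simp add: e_def is_stateD[OF state])
  qed
qed

lemma gi_KMS_bounded:
  assumes "w \<in> gi_KMS_states L d t r \<beta>"
  shows "bounded_linear w" "w (cscale c a) = c * w a" "is_state w"
proof -
  show "is_state w" using assms by (auto simp: gi_KMS_states_def is_KMS_def)
  then show "bounded_linear w" "w (cscale c a) = c * w a"
    by (auto intro: is_state_bounded is_stateD)
qed

lemma gi_KMS_unique:
  assumes w: "w \<in> gi_KMS_states L d t r \<beta>" "w' \<in> gi_KMS_states L d t r \<beta>"
    and eq: "\<And>v. v \<in> V \<Longrightarrow> w (t v) = w' (t v)"
  shows "w = w'"
proof
  fix a show "w a = w' a"
  proof (rule functional_eqI)
    fix l g assume lg: "l \<in> L" "g \<in> L"
    show "w (mm l g) = w' (mm l g)"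
      unfolding gi_KMS_value[OF w(1) lg] gi_KMS_value[OF w(2) lg] using eq lg by simp
  qed (rule gi_KMS_bounded[OF w(1)] gi_KMS_bounded[OF w(2)])+
qed

text \<open>Evaluating the state on the Cuntz-Krieger relation of degree \<open>unitv i\<close> at
  \<open>v\<close>, with \<open>gi_KMS_value\<close> for each summand, gives the eigenvector
  equation.\<close>

lemma gi_KMS_eigenvector:
  assumes w: "w \<in> gi_KMS_states L d t r \<beta>"
  obtains x where "x \<in> joint_eigenvectors (\<lambda>i. exp (\<beta> * r i))" "\<And>v. v \<in> V \<Longrightarrow> w (t v) = of_real (x v)"
proof -
  have state: "is_state w" by (rule gi_KMS_bounded(3)[OF w])
  define x where "x v = (if v \<in> V then Re (w (t v)) else 0)" for v
  have wx: "w (t v) = of_real (x v)" "0 \<le> x v" if "v \<in> V" for v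
    using is_stateD(3,4)[OF state, of "t v"] t_vert[OF that] that by (auto simp: x_def complex_eq_iff)
  have "of_real (\<Sum>v\<in>V. x v) = (\<Sum>v\<in>V. w (t v))" by (simp add: wx)
  also have "\<dots> = 1"
    unfolding is_state_sum[OF state, symmetric] one_eq[symmetric] by (rule is_stateD(5)[OF state])
  finally have sum1: "(\<Sum>v\<in>V. x v) = 1" using of_real_eq_1_iff by blast
  have "(\<Sum>u\<in>V. pc (unitv i) v u * x u) = exp (\<beta> * r i) * x v" if v: "v \<in> V" for i v
  proof -
    define e where "e = exp (- \<beta> * rdot r (\<lambda>j. real (unitv i j)))"
    have "of_real (x v) = w (t v)" using wx v by simp
    also have "\<dots> = (\<Sum>l\<in>range_deg v (unitv i). w (mm l l))"
      unfolding t_sum[OF v, of "unitv i"] is_state_sum[OF state] mm_def ..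
    also have "\<dots> = (\<Sum>l\<in>range_deg v (unitv i). of_real (e * x (src l)))"
      using gi_KMS_value[OF w] wx by (intro sum.cong refl) (auto simp: e_def)
    also have "\<dots> = of_real (e * (\<Sum>u\<in>V. pc (unitv i) v u * x u))"
      by (simp add: sum_distrib_left flip: sum_range_deg)
    finally have "x v = e * (\<Sum>u\<in>V. pc (unitv i) v u * x u)" by (simp only: of_real_eq_iff)
    then have "exp (\<beta> * r i) * x v = (e * mpower (\<lambda>i. exp (\<beta> * r i)) (unitv i)) * (\<Sum>u\<in>V. pc (unitv i) v u * x u)"
      by (simp add: algebra_simps)
    then show ?thesis unfolding e_def exp_rdot by simp
  qed
  then have "x \<in> joint_eigenvectors (\<lambda>i. exp (\<beta> * r i))"
    unfolding joint_eigenvectors_def using sum1 wx(2) by (auto simp: x_def)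
  then show ?thesis using that wx(1) by blast
qed

lemma gi_KMS_convex:
  assumes w: "w \<in> gi_KMS_states L d t r \<beta>" "w' \<in> gi_KMS_states L d t r \<beta>" and c: "0 \<le> c" "c \<le> (1::real)"
  shows "(\<lambda>a. of_real c * w a + of_real (1 - c) * w' a) \<in> gi_KMS_states L d t r \<beta>"
proof -
  note s = gi_KMS_bounded(3)[OF w(1)] and s' = gi_KMS_bounded(3)[OF w(2)]
  have "is_state (\<lambda>a. of_real c * w a + of_real (1 - c) * w' a)"
    unfolding is_state_def
  proof (intro conjI allI)
    fix a
    show "0 \<le> Re (of_real c * w (adj a * a) + of_real (1 - c) * w' (adj a * a))"
      using c is_stateD(4)[OF s, of a] is_stateD(4)[OF s', of a]
      by (simp del: of_real_diff add: add_nonneg_nonneg)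
  qed (simp_all add: is_stateD[OF s] is_stateD[OF s'] algebra_simps)
  then show ?thesis
    using w unfolding gi_KMS_states_def is_KMS_def gauge_invariant_def mem_Collect_eq by simp
qed

end

section \<open>The affine bijection\<close>

lemma weight_fns_convex:
  assumes f: "f \<in> weight_fns CC" and g: "g \<in> weight_fns CC" and c: "0 \<le> c" "c \<le> (1::real)"
  shows "(\<lambda>C. c * f C + (1 - c) * g C) \<in> weight_fns CC"
proof -
  have "c * f C + (1 - c) * g C \<le> 1" if "C \<in> CC" for C
  proof -
    have "c * f C + (1 - c) * g C \<le> c * 1 + (1 - c) * 1"
      using f g c that by (intro add_mono mult_left_mono) (auto simp: weight_fns_def)
    then show ?thesis by simp
  qed
  moreover have "(\<Sum>C\<in>CC. c * f C + (1 - c) * g C) = 1"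
    using f g by (simp add: weight_fns_def sum.distrib flip: sum_distrib_left)
  ultimately show ?thesis
    using f g c by (auto simp: weight_fns_def)
qed

theorem theorem7p12:
  fixes L :: "'p set" and d :: "'p \<Rightarrow> 'k::finite \<Rightarrow> nat"
    and rg src :: "'p \<Rightarrow> 'p" and cmp :: "'p \<Rightarrow> 'p \<Rightarrow> 'p"
    and t :: "'p \<Rightarrow> 'a::cstar_algebra"
    and r :: "'k \<Rightarrow> real" and \<beta> :: real
  assumes "is_kgraph L d rg src cmp"
    and "kg_finite L d"
    and "no_sources L d rg"
    and "is_graph_algebra L d rg src cmp t"
  shows "\<exists>\<Phi>. bij_betw \<Phi> (weight_fns (Cr L d rg src r \<beta>)) (gi_KMS_states L d t r \<beta>)
    \<and> (\<forall>f\<in>weight_fns (Cr L d rg src r \<beta>). \<forall>g\<in>weight_fns (Cr L d rg src r \<beta>). \<forall>c::real.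
         0 \<le> c \<and> c \<le> 1 \<longrightarrow>
         \<Phi> (\<lambda>C. c * f C + (1 - c) * g C) = (\<lambda>a. of_real c * \<Phi> f a + of_real (1 - c) * \<Phi> g a))
    \<and> (\<forall>f\<in>weight_fns (Cr L d rg src r \<beta>). \<forall>l\<in>L. \<forall>g\<in>L.
         \<Phi> f (t l * adj (t g)) =
           (if l = g then complex_of_real (exp (- \<beta> * rdot r (\<lambda>i. real (d l i)))
               * (\<Sum>C\<in>Cr L d rg src r \<beta>. f C * xvec L d rg src C (src l)))
            else 0))"
proof -
  interpret graph_algebra L d rg src cmp t
    by (intro graph_algebra.intro kgraph.intro graph_algebra_axioms.intro assms)
  define CC where "CC = Cr L d rg src r \<beta>"
  define \<psi> where "\<psi> f = (\<lambda>v. \<Sum>C\<in>CC. f C * xvec L d rg src C v)" for f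
  \<comment> \<open>By \<open>gi_KMS_unique\<close> the vertex values fix the state, so the choice
    is no freedom. Injectivity, surjectivity and affinity all reduce to comparing these
    values.\<close>
  define \<Phi> where "\<Phi> f = (SOME w. w \<in> gi_KMS_states L d t r \<beta> \<and> (\<forall>v\<in>vert L d. w (t v) = of_real (\<psi> f v)))" for f
  have \<Phi>: "\<Phi> f \<in> gi_KMS_states L d t r \<beta>" "\<And>v. v \<in> vert L d \<Longrightarrow> \<Phi> f (t v) = of_real (\<psi> f v)"
    if f: "f \<in> weight_fns CC" for f
  proof -
    interpret graph_algebra_weight L d rg src cmp t r \<beta> "\<psi> f"
      by unfold_locales (unfold \<psi>_def CC_def, rule weight_fns_joint_eigenvector[OF f[unfolded CC_def]])
    have "\<exists>w. w \<in> gi_KMS_states L d t r \<beta> \<and> (\<forall>v\<in>vert L d. w (t v) = of_real (\<psi> f v))"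
      by (rule gi_KMS_state_exists) blast
    then have "\<Phi> f \<in> gi_KMS_states L d t r \<beta> \<and> (\<forall>v\<in>vert L d. \<Phi> f (t v) = of_real (\<psi> f v))"
      unfolding \<Phi>_def by (rule someI_ex)
    then show "\<Phi> f \<in> gi_KMS_states L d t r \<beta>" "\<And>v. v \<in> vert L d \<Longrightarrow> \<Phi> f (t v) = of_real (\<psi> f v)"
      by auto
  qed
  have bij: "bij_betw \<Phi> (weight_fns CC) (gi_KMS_states L d t r \<beta>)"
    unfolding bij_betw_def
  proof (intro conjI equalityI subsetI)
    show "inj_on \<Phi> (weight_fns CC)"
    proof (rule inj_onI)
      fix f g assume fg: "f \<in> weight_fns CC" "g \<in> weight_fns CC" "\<Phi> f = \<Phi> g"
      have "\<psi> f v = \<psi> g v" if "v \<in> vert L d" for v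
        using \<Phi>(2)[OF fg(1) that] \<Phi>(2)[OF fg(2) that] fg(3) by simp
      then show "f = g"
        using fg(1,2) unfolding CC_def \<psi>_def by (intro weight_fns_inj)
    qed
    show "w \<in> gi_KMS_states L d t r \<beta>" if "w \<in> \<Phi> ` weight_fns CC" for w
      using that \<Phi>(1) by blast
    show "w \<in> \<Phi> ` weight_fns CC" if w: "w \<in> gi_KMS_states L d t r \<beta>" for w
    proof -
      obtain x where x: "x \<in> joint_eigenvectors (\<lambda>i. exp (\<beta> * r i))"
        "\<And>v. v \<in> vert L d \<Longrightarrow> w (t v) = of_real (x v)"
        by (rule gi_KMS_eigenvector[OF w]) blast
      obtain f where f: "f \<in> weight_fns CC" "\<And>v. v \<in> vert L d \<Longrightarrow> x v = \<psi> f v"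
        using joint_eigenvector_decomposition[OF x(1)] unfolding CC_def \<psi>_def by blast
      have "w = \<Phi> f" using x(2) f \<Phi>[OF f(1)] by (intro gi_KMS_unique[OF w]) auto
      then show ?thesis using f(1) by blast
    qed
  qed
  have affine: "\<Phi> (\<lambda>C. c * f C + (1 - c) * g C) = (\<lambda>a. of_real c * \<Phi> f a + of_real (1 - c) * \<Phi> g a)"
    if fg: "f \<in> weight_fns CC" "g \<in> weight_fns CC" and c: "0 \<le> c \<and> c \<le> 1" for f g and c :: real
  proof (rule gi_KMS_unique)
    have h: "(\<lambda>C. c * f C + (1 - c) * g C) \<in> weight_fns CC"
      using fg c by (intro weight_fns_convex) auto
    show "\<Phi> (\<lambda>C. c * f C + (1 - c) * g C) \<in> gi_KMS_states L d t r \<beta>" by (rule \<Phi>(1)[OF h])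
    show "(\<lambda>a. of_real c * \<Phi> f a + of_real (1 - c) * \<Phi> g a) \<in> gi_KMS_states L d t r \<beta>"
      using c by (intro gi_KMS_convex \<Phi>(1) fg) auto
    fix v assume v: "v \<in> vert L d"
    have "\<psi> (\<lambda>C. c * f C + (1 - c) * g C) v = c * \<psi> f v + (1 - c) * \<psi> g v"
      by (simp add: \<psi>_def distrib_right sum.distrib sum_distrib_left mult.assoc)
    then show "\<Phi> (\<lambda>C. c * f C + (1 - c) * g C) (t v) = of_real c * \<Phi> f (t v) + of_real (1 - c) * \<Phi> g (t v)"
      unfolding \<Phi>(2)[OF h v] \<Phi>(2)[OF fg(1) v] \<Phi>(2)[OF fg(2) v] by (simp only: of_real_add of_real_mult)
  qed
  have val: "\<Phi> f (t l * adj (t g)) = (if l = g then complex_of_real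
      (exp (- \<beta> * rdot r (\<lambda>i. real (d l i))) * \<psi> f (src l)) else 0)"
    if "f \<in> weight_fns CC" "l \<in> L" "g \<in> L" for f l g
  proof -
    have "\<Phi> f (t (src l)) = of_real (\<psi> f (src l))" using that by (intro \<Phi>(2)) auto
    then show ?thesis
      using gi_KMS_value[OF \<Phi>(1)[OF that(1)] that(2,3)] by (cases "l = g") (simp_all add: mm_def)
  qed
  show ?thesis
    unfolding CC_def[symmetric]
  proof (intro exI[of _ \<Phi>] conjI ballI allI impI)
    fix f l g assume "f \<in> weight_fns CC" "l \<in> L" "g \<in> L"
    from val[OF this] show "\<Phi> f (t l * adj (t g)) =
        (if l = g then complex_of_real (exp (- \<beta> * rdot r (\<lambda>i. real (d l i)))
          * (\<Sum>C\<in>CC. f C * xvec L d rg src C (src l))) else 0)"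
      unfolding \<psi>_def .
  qed (rule bij affine; assumption)+
qed

end
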